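(* Let $\mathbb{K}$ be an arbitrary field and let $H_{\min}(t)=\sum_{n=0}^\infty d_nt^n$, where $d_n=\min_{\xi\in\mathbb{K}^9}\dim\widehat{Q}^\xi_n$, be the minimal Hilbert series of a generalized Sklyanin algebra over $\mathbb{K}$. If $\mathbb{K}\neq\mathbb{Z}_2$ ($\mathbb{K}$ is not the $2$-element field), then $H_{\min}(t)=1+3t+6t^2+9t^3+9t^4$. If $\mathbb{K}=\mathbb{Z}_2$, then $H_{\min}(t)=1+3t+6t^2+9t^3+9t^4+5t^5+t^6$. In any case, there exists a generalized Sklyanin algebra $A$ over $\mathbb{K}$ such that $H_A=H_{\min}$.
   Context: For $\xi=(p_1,p_2,p_3,q_1,q_2,q_3,r_1,r_2,r_3)\in\mathbb{K}^9$, the generalized Sklyanin algebra $\widehat{Q}^\xi$ is the associative unital $\mathbb{K}$-algebra given by the generators $x,y,z$ and the relations $p_1yz+q_1zy+r_1xx=0$, $p_2zx+q_2xz+r_2yy=0$, $p_3xy+q_3yx+r_3zz=0$, graded by $\deg x=\deg y=\deg z=1$; $\widehat{Q}^\xi_n$ is its degree $n$ component. For a graded algebra $A$ with finite-dimensional components $A_j$, $H_A(t)=\sum_{j\ge 0}\dim_{\mathbb{K}}A_j\,t^j$ is its Hilbert series. *)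

theory Defs
  imports
    "HOL-Library.Poly_Mapping"
    "HOL-Library.Cardinality"
    "HOL-Computational_Algebra.Formal_Power_Series"
    "HOL-Algebra.Embedded_Algebras"
    "HOL-Algebra.QuotRing"
    "HOL-Algebra.Algebraic_Closure_Type"
begin

text \<open>
  The free monoid on three generators, written additively because the multiplication of
  \<^typ>\<open>'a \<Rightarrow>\<^sub>0 'b\<close> is convolution along the addition of \<^typ>\<open>'a\<close>. The free associative unital
  algebra on x, y, z is then the monoid algebra \<open>gword \<Rightarrow>\<^sub>0 'k\<close>.
\<close>

datatype gen = GenX | GenY | GenZ

datatype gword = Word (letters: "gen list")

instantiation gword :: monoid_add
begin

definition zero_gword :: gword where "0 = Word []"

definition plus_gword :: "gword \<Rightarrow> gword \<Rightarrow> gword"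
  where "u + v = Word (letters u @ letters v)"

instance
  by standard (simp_all add: zero_gword_def plus_gword_def)

end

type_synonym 'k free_alg = "gword \<Rightarrow>\<^sub>0 'k"

definition gvar :: "gen \<Rightarrow> 'k::field free_alg"
  where "gvar g = Poly_Mapping.single (Word [g]) 1"

definition scalar :: "'k \<Rightarrow> 'k::field free_alg"
  where "scalar c = Poly_Mapping.single 0 c"

definition homogeneous_part :: "nat \<Rightarrow> 'k::field free_alg set"
  where "homogeneous_part n = {f. \<forall>w\<in>Poly_Mapping.keys f. length (letters w) = n}"

text \<open>The parameter space: 9-tuples \<open>(p1, p2, p3, q1, q2, q3, r1, r2, r3)\<close>.\<close>

type_synonym 'k params = "'k \<times> 'k \<times> 'k \<times> 'k \<times> 'k \<times> 'k \<times> 'k \<times> 'k \<times> 'k"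

fun sklyanin_relations :: "'k::field params \<Rightarrow> 'k free_alg set"
  where
    "sklyanin_relations (p1, p2, p3, q1, q2, q3, r1, r2, r3) =
      (let x = gvar GenX; y = gvar GenY; z = gvar GenZ in
        {scalar p1 * y * z + scalar q1 * z * y + scalar r1 * x * x,
         scalar p2 * z * x + scalar q2 * x * z + scalar r2 * y * y,
         scalar p3 * x * y + scalar q3 * y * x + scalar r3 * z * z})"

definition sklyanin_ideal :: "'k::field params \<Rightarrow> 'k free_alg set"
  where "sklyanin_ideal \<xi> = Idl\<^bsub>ring_of_type_algebra\<^esub> (sklyanin_relations \<xi>)"

definition sklyanin_algebra :: "'k::field params \<Rightarrow> 'k free_alg set ring"
  where "sklyanin_algebra \<xi> = ring_of_type_algebra Quot (sklyanin_ideal \<xi>)"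

definition sklyanin_proj :: "'k::field params \<Rightarrow> 'k free_alg \<Rightarrow> 'k free_alg set"
  where "sklyanin_proj \<xi> f = sklyanin_ideal \<xi> +>\<^bsub>ring_of_type_algebra\<^esub> f"

text \<open>
  The copy of the ground field in the quotient algebra; as the relations are homogeneous of
  degree 2, it is a subfield, and vector space dimensions are taken over it.
\<close>

definition sklyanin_scalars :: "'k::field params \<Rightarrow> 'k free_alg set set"
  where "sklyanin_scalars \<xi> = range (\<lambda>c. sklyanin_proj \<xi> (scalar c))"

definition sklyanin_component :: "'k::field params \<Rightarrow> nat \<Rightarrow> 'k free_alg set set"
  where "sklyanin_component \<xi> n = sklyanin_proj \<xi> ` homogeneous_part n"

definition sklyanin_dim :: "'k::field params \<Rightarrow> nat \<Rightarrow> nat"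
  where "sklyanin_dim \<xi> n =
    ring.dim (sklyanin_algebra \<xi>) (sklyanin_scalars \<xi>) (sklyanin_component \<xi> n)"

definition sklyanin_hilbert_series :: "'k::field params \<Rightarrow> int fps"
  where "sklyanin_hilbert_series \<xi> = Abs_fps (\<lambda>n. int (sklyanin_dim \<xi> n))"

text \<open>
  Each coefficient is minimized separately. The infimum of a nonempty set of natural
  numbers is its least element.
\<close>

definition min_hilbert_series :: "'k::field itself \<Rightarrow> int fps"
  where "min_hilbert_series _ = Abs_fps (\<lambda>n. int (INF \<xi>::'k params. sklyanin_dim \<xi> n))"

end

theory Submission
  imports Defs
begin

text \<open>
  A component of degree \<open>n\<close> of a generalized Sklyanin algebra is the space of all noncommutative
  polynomials of degree \<open>n\<close>, of dimension \<open>3 ^ n\<close>, modulo the span of the translates by words of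
  the three quadratic relations. Its dual is the space of functions on words of length \<open>n\<close> that
  vanish, extended linearly, on all these translates. Lower bounds for dimensions are therefore
  certified by functions dual to some words (\<open>sklyanin_dim_ge\<close>), and upper bounds by words on
  which such a function is determined by its values (\<open>sklyanin_dim_le\<close>).

  The lower bounds 6, 9, 9 in degrees 2, 3, 4 hold for all parameters and are those of Golod and
  Shafarevich (\<open>golod_shafarevich\<close>): three relations cannot cut the components down faster. The
  same inequality shows that an algebra with three independent relations which vanishes in
  degree 5 attains all of them (\<open>sklyanin_dims_if_dim_5_eq_0\<close>). So over a field with more than
  two elements it suffices to find one algebra that vanishes in degree 5. Rewriting words by a
  noncommutative Groebner basis does this for the relations \<open>zy + xx\<close>, \<open>zx + yy\<close>, \<open>xy - yx + e
  zz\<close> outside characteristic 3, for every \<open>e\<close> that avoids the zeros of a few polynomials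
  (\<open>generic_family\<close>), and for one specific algebra in characteristic 3 (\<open>char_three_family\<close>). In
  characteristic 2 the parameter must lie outside the prime field, which is where the
  two-element field becomes exceptional (\<open>finite_example\<close>).

  Over the two-element field there are \<open>8\<^sup>3\<close> parameter tuples. Up to cyclic permutation of the
  variables, passage to the opposite algebra and exchange of two variables, each of the algebras
  acts on one of 17 explicit small modules, whose matrix coefficients are functionals that give
  the lower bounds 5 and 1 in degrees 5 and 6 (\<open>two_element_field_bounds\<close>). The algebra with
  relations \<open>zy + xx\<close>, \<open>xz + yy\<close>, \<open>xy + yx + zz\<close> attains them and vanishes from degree 7 on
  (\<open>char_two_example\<close>).
\<close>

section \<open>The free algebra as a vector space\<close>

abbreviation wmono :: "gen list \<Rightarrow> 'k::field free_alg"
  where "wmono w \<equiv> Poly_Mapping.single (Word w) 1"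

lemma mono_mult: "wmono u * wmono v = (wmono (u @ v) :: 'k::field free_alg)"
  by (simp add: mult_single plus_gword_def)

lemma mono_Nil: "wmono [] = (1 :: 'k::field free_alg)"
  by (simp add: zero_gword_def[symmetric])

lemma scalar_mult_single:
  "scalar a * Poly_Mapping.single w b = (Poly_Mapping.single w (a * b) :: 'k::field free_alg)"
  by (simp add: scalar_def mult_single)

lemma lookup_scalar_mult:
  "Poly_Mapping.lookup (scalar a * f) w = a * Poly_Mapping.lookup (f :: 'k::field free_alg) w"
  using mult_map_scale_conv_mult[of a f]
  by (simp add: scalar_def map.rep_eq when_def flip: mult_map_scale_conv_mult)

lemma scalar_mult: "scalar (a * b) = scalar a * (scalar b :: 'k::field free_alg)"
  by (simp add: scalar_def mult_single)

lemma scalar_add: "scalar (a + b) = scalar a + (scalar b :: 'k::field free_alg)"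
  by (simp add: scalar_def single_add)

lemma scalar_one: "scalar 1 = (1 :: 'k::field free_alg)"
  by (simp add: scalar_def)

interpretation fa: vector_space "\<lambda>c (f :: 'k::field free_alg). scalar c * f"
  by standard (simp_all add: scalar_mult scalar_add scalar_one algebra_simps)

text \<open>Every polynomial is the combination of its own monomials; linear statements about the free
  algebra are reduced to monomials through this identity.\<close>

lemma mono_expansion:
  "f = (\<Sum>w\<in>Poly_Mapping.keys f. scalar (Poly_Mapping.lookup f w) * wmono (letters w))"
  for f :: "'k::field free_alg"
proof (rule poly_mapping_eqI)
  fix v
  have "Poly_Mapping.lookup (\<Sum>w\<in>Poly_Mapping.keys f.
          scalar (Poly_Mapping.lookup f w) * wmono (letters w)) v
      = (\<Sum>w\<in>Poly_Mapping.keys f. if w = v then Poly_Mapping.lookup f w else 0)"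
    unfolding lookup_sum lookup_scalar_mult lookup_single
    by (intro sum.cong) (auto simp: when_def)
  also have "\<dots> = Poly_Mapping.lookup f v"
    by (auto simp: in_keys_iff)
  finally show "Poly_Mapping.lookup f v = Poly_Mapping.lookup (\<Sum>w\<in>Poly_Mapping.keys f.
          scalar (Poly_Mapping.lookup f w) * wmono (letters w)) v" ..
qed

lemma scalar_central: "f * scalar c = scalar c * (f :: 'k::field free_alg)"
proof -
  have single: "Poly_Mapping.single w a * scalar c = scalar c * Poly_Mapping.single w a"
    for w :: gword and a :: 'k
    by (simp add: scalar_def mult_single mult.commute)
  show ?thesis
    by (subst (1 2) mono_expansion[of f])
       (simp add: sum_distrib_left sum_distrib_right scalar_mult_single single)
qed

lemma mult_scalar_left: "f * (scalar c * g) = scalar c * (f * (g :: 'k::field free_alg))"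
  by (metis mult.assoc scalar_central)

text \<open>Multiplication by a fixed element is linear, so spans may be multiplied generatorwise.\<close>

lemma mult_left_span:
  assumes "f \<in> fa.span S" "\<And>s. s \<in> S \<Longrightarrow> g * s \<in> fa.span T"
  shows "g * f \<in> fa.span T"
  using assms(1)
  by (induction rule: fa.span_induct_alt)
     (auto simp: distrib_left mult_scalar_left fa.span_zero
       intro!: fa.span_add fa.span_scale assms(2))

lemma mult_right_span:
  assumes "f \<in> fa.span S" "\<And>s. s \<in> S \<Longrightarrow> s * g \<in> fa.span T"
  shows "f * g \<in> fa.span T"
  using assms(1)
  by (induction rule: fa.span_induct_alt)
     (auto simp: distrib_right mult.assoc fa.span_zero
       intro!: fa.span_add fa.span_scale assms(2))

definition words :: "nat \<Rightarrow> gen list set"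
  where "words n = {w. length w = n}"

lemma UNIV_gen: "UNIV = {GenX, GenY, GenZ}"
  using gen.exhaust by auto

instance gen :: finite
  by standard (simp add: UNIV_gen)

lemma finite_words: "finite (words n)" and card_words: "card (words n) = 3 ^ n"
proof -
  have "words n = {w. set w \<subseteq> (UNIV :: gen set) \<and> length w = n}"
    by (simp add: words_def)
  moreover have "card (UNIV :: gen set) = 3"
    by (simp add: UNIV_gen)
  ultimately show "finite (words n)" "card (words n) = 3 ^ n"
    using finite_lists_length_eq[of "UNIV :: gen set" n]
      card_lists_length_eq[of "UNIV :: gen set" n] by simp_all
qed

lemma inj_mono: "inj (wmono :: gen list \<Rightarrow> 'k::field free_alg)"
  by (rule injI) (metis gword.inject keys_single one_neq_zero singleton_iff insertI1)

lemma independent_monos: "fa.independent (wmono ` W :: 'k::field free_alg set)"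
  unfolding fa.independent_explicit_finite_subsets
proof (intro allI impI ballI)
  fix A :: "'k free_alg set" and u a
  assume A: "A \<subseteq> wmono ` W" "finite A" and zero: "(\<Sum>v\<in>A. scalar (u v) * v) = 0" and a: "a \<in> A"
  obtain w where w: "a = wmono w" using A(1) a by auto
  have "0 = Poly_Mapping.lookup (\<Sum>v\<in>A. scalar (u v) * v) (Word w)"
    by (simp add: zero)
  also have "\<dots> = (\<Sum>v\<in>A. if v = a then u v else 0)"
    unfolding lookup_sum lookup_scalar_mult
  proof (intro sum.cong refl)
    fix v assume "v \<in> A"
    then obtain w' where "v = wmono w'" using A(1) by auto
    then show "u v * Poly_Mapping.lookup v (Word w) = (if v = a then u v else 0)"
      using inj_mono by (auto simp: w lookup_single when_def inj_def)
  qed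
  also have "\<dots> = u a"
    using A(2) a by simp
  finally show "u a = 0" ..
qed

lemma homogeneous_part_eq_span: "homogeneous_part n = (fa.span (wmono ` words n) :: 'k::field
  free_alg set)"
proof (intro equalityI subsetI)
  fix f :: "'k free_alg" assume "f \<in> homogeneous_part n"
  then have "letters w \<in> words n" if "w \<in> Poly_Mapping.keys f" for w
    using that by (simp add: homogeneous_part_def words_def)
  then have "(\<Sum>w\<in>Poly_Mapping.keys f. scalar (Poly_Mapping.lookup f w) * wmono (letters w))
      \<in> fa.span (wmono ` words n)"
    by (intro fa.span_sum fa.span_scale fa.span_base) blast
  then show "f \<in> fa.span (wmono ` words n)"
    using mono_expansion[of f] by simp
next
  fix f :: "'k free_alg" assume "f \<in> fa.span (wmono ` words n)"
  then show "f \<in> homogeneous_part n"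
  proof (induction rule: fa.span_induct_alt)
    case (step c x y)
    then obtain w where "w \<in> words n" "x = wmono w" by auto
    with step show ?case
      using keys_add[of "scalar c * x" y] unfolding homogeneous_part_def
      by (auto simp: scalar_mult_single words_def split: if_splits)
  qed (simp add: homogeneous_part_def)
qed

section \<open>The ideal of relations\<close>

text \<open>The translates \<open>u r v\<close> of the defining relations \<open>r\<close> by words \<open>u\<close>, \<open>v\<close> that have degree
  \<open>n\<close>; they span the degree \<open>n\<close> part of the ideal.\<close>

definition relators :: "'k::field params \<Rightarrow> nat \<Rightarrow> 'k free_alg set"
  where "relators \<xi> n = {wmono u * r * wmono v | u r v.
           r \<in> sklyanin_relations \<xi> \<and> length u + 2 + length v = n}"

lemma relators_subset: "relators \<xi> n \<subseteq> homogeneous_part n"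
proof
  fix f assume "f \<in> relators \<xi> n"
  then obtain u r v where f: "f = wmono u * r * wmono v" "r \<in> sklyanin_relations \<xi>"
      "length u + 2 + length v = n"
    by (auto simp: relators_def)
  obtain p1 p2 p3 q1 q2 q3 r1 r2 r3 where xi: "\<xi> = (p1, p2, p3, q1, q2, q3, r1, r2, r3)"
    by (cases \<xi>) auto
  have mem: "scalar c * wmono w \<in> homogeneous_part n" if "length w = n" for c :: 'a and w
    unfolding homogeneous_part_eq_span
    by (intro fa.span_scale fa.span_base) (simp add: words_def that)
  have "\<exists>a b c g1 h1 g2 h2 g3 h3. r = scalar a * wmono [g1, h1] + scalar b * wmono [g2, h2]
          + scalar c * wmono [g3, h3]"
    using f(2) unfolding xi
    by (fastforce simp: Let_def gvar_def mult.assoc mult_single plus_gword_def)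
  then obtain a b c g1 h1 g2 h2 g3 h3 where
    r: "r = scalar a * wmono [g1, h1] + scalar b * wmono [g2, h2] + scalar c * wmono [g3, h3]"
    by blast
  have "f = scalar a * wmono (u @ [g1, h1] @ v) + scalar b * wmono (u @ [g2, h2] @ v)
          + scalar c * wmono (u @ [g3, h3] @ v)"
    by (simp add: f(1) r distrib_left distrib_right mult_scalar_left mult.assoc mono_mult)
  then show "f \<in> homogeneous_part n"
    using f(3) mem unfolding homogeneous_part_eq_span
    by (auto intro!: fa.span_add)
qed

lemma mono_mult_relators:
  assumes "f \<in> relators \<xi> n" shows "wmono w * f \<in> relators \<xi> (length w + n)"
proof -
  obtain u r v where "f = wmono u * r * wmono v" "r \<in> sklyanin_relations \<xi>"
      "length u + 2 + length v = n"
    using assms by (auto simp: relators_def)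
  then have "wmono w * f = wmono (w @ u) * r * wmono v" "length (w @ u) + 2 + length v = length w
    + n"
    by (simp_all add: mono_mult[symmetric] mult.assoc)
  then show ?thesis using \<open>r \<in> _\<close> unfolding relators_def by blast
qed

lemma relators_mult_mono:
  assumes "f \<in> relators \<xi> n" shows "f * wmono w \<in> relators \<xi> (n + length w)"
proof -
  obtain u r v where "f = wmono u * r * wmono v" "r \<in> sklyanin_relations \<xi>"
      "length u + 2 + length v = n"
    using assms by (auto simp: relators_def)
  then have "f * wmono w = wmono u * r * wmono (v @ w)" "length u + 2 + length (v @ w) = n +
    length w"
    by (simp_all add: mono_mult[symmetric] mult.assoc)
  then show ?thesis using \<open>r \<in> _\<close> unfolding relators_def by blast
qed

interpretation fr: ring "ring_of_type_algebra :: 'k::field free_alg ring"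
proof -
  have "\<exists>g. f + g = 0" for f :: "'k free_alg"
    using add.right_inverse by blast
  then show "ring (ring_of_type_algebra :: 'k free_alg ring)"
    unfolding ring_of_type_algebra_def using add.right_inverse
    by unfold_locales (auto simp: algebra_simps Units_def)
qed

lemma fr_simps:
  "carrier (ring_of_type_algebra :: 'k::field free_alg ring) = UNIV"
  "f \<otimes>\<^bsub>ring_of_type_algebra\<^esub> g = (f * g :: 'k free_alg)"
  "f \<oplus>\<^bsub>ring_of_type_algebra\<^esub> g = (f + g :: 'k free_alg)"
  "\<zero>\<^bsub>ring_of_type_algebra\<^esub> = (0 :: 'k free_alg)"
  "\<one>\<^bsub>ring_of_type_algebra\<^esub> = (1 :: 'k free_alg)"
  by (simp_all add: ring_of_type_algebra_def)

lemma fr_minus: "f \<ominus>\<^bsub>ring_of_type_algebra\<^esub> g = (f - g :: 'k::field free_alg)"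
proof -
  have "(f \<ominus>\<^bsub>ring_of_type_algebra\<^esub> g) \<oplus>\<^bsub>ring_of_type_algebra\<^esub> g = f"
    using fr.minus_eq[of f g] fr.a_assoc[of f "\<ominus>\<^bsub>ring_of_type_algebra\<^esub> g" g] fr.l_neg[of g]
    by (simp add: fr_simps)
  then show ?thesis by (simp add: fr_simps eq_diff_eq)
qed

lemma ideal_sklyanin: "ideal (sklyanin_ideal \<xi>) (ring_of_type_algebra :: 'k::field free_alg ring)"
  unfolding sklyanin_ideal_def by (rule fr.genideal_ideal) (simp add: fr_simps)

text \<open>The span of all translates of the relations is closed under multiplication by words, hence
  by all polynomials, so it already is a two-sided ideal.\<close>

lemma sklyanin_ideal_eq_span:
  "sklyanin_ideal \<xi> = fa.span (\<Union>n. relators \<xi> n)" (is "_ = fa.span ?G")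
proof
  have left: "f * g \<in> fa.span ?G" if "g \<in> fa.span ?G" for f g
    using that
  proof (rule mult_left_span)
    fix s assume "s \<in> ?G"
    then have "Poly_Mapping.single w 1 * s \<in> fa.span ?G" for w
      by (cases w) (auto intro!: fa.span_base dest: mono_mult_relators)
    then show "f * s \<in> fa.span ?G"
      by (subst mono_expansion[of f])
         (simp add: sum_distrib_right mult.assoc fa.span_sum fa.span_scale)
  qed
  have right: "g * f \<in> fa.span ?G" if "g \<in> fa.span ?G" for f g
    using that
  proof (rule mult_right_span)
    fix s assume "s \<in> ?G"
    then have "s * Poly_Mapping.single w 1 \<in> fa.span ?G" for w
      by (cases w) (auto intro!: fa.span_base dest: relators_mult_mono)
    then show "s * f \<in> fa.span ?G"
      by (subst mono_expansion[of f])
         (simp add: sum_distrib_left mult_scalar_left fa.span_sum fa.span_scale)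
  qed
  have uminus: "\<ominus>\<^bsub>ring_of_type_algebra\<^esub> f = - f" for f :: "'a free_alg"
    using fr_minus[of 0 f] by (simp add: fr.minus_eq fr_simps)
  have "ideal (fa.span ?G) ring_of_type_algebra"
  proof (rule idealI[OF fr.ring_axioms])
    show "subgroup (fa.span ?G) (add_monoid ring_of_type_algebra)"
      by (rule fr.add.subgroupI)
         (auto simp: fr_simps uminus[unfolded a_inv_def] a_inv_def[symmetric] uminus fa.span_neg
           fa.span_add intro: fa.span_zero)
  qed (simp_all add: fr_simps left right)
  moreover have "sklyanin_relations \<xi> \<subseteq> relators \<xi> 2"
  proof
    fix r assume "r \<in> sklyanin_relations \<xi>"
    then show "r \<in> relators \<xi> 2"
      unfolding relators_def
      by (auto simp: mono_Nil intro!: exI[of _ "[]"] exI[of _ r])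
  qed
  then have "sklyanin_relations \<xi> \<subseteq> fa.span ?G"
    using fa.span_superset[of ?G] by blast
  ultimately show "sklyanin_ideal \<xi> \<subseteq> fa.span ?G"
    unfolding sklyanin_ideal_def by (rule fr.genideal_minimal)
  interpret ideal "sklyanin_ideal \<xi>" ring_of_type_algebra by (rule ideal_sklyanin)
  have "?G \<subseteq> sklyanin_ideal \<xi>"
  proof (clarsimp simp: relators_def)
    fix u v r assume "r \<in> sklyanin_relations \<xi>"
    then have "r \<in> sklyanin_ideal \<xi>"
      using fr.genideal_self[of "sklyanin_relations \<xi>"] by (auto simp: sklyanin_ideal_def fr_simps)
    then show "wmono u * r * wmono v \<in> sklyanin_ideal \<xi>"
      using I_l_closed I_r_closed by (simp add: fr_simps)
  qed
  moreover have "fa.subspace (sklyanin_ideal \<xi>)"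
    using a_closed I_l_closed additive_subgroup.zero_closed[OF is_additive_subgroup]
    by (intro fa.subspaceI) (auto simp: fr_simps)
  ultimately show "fa.span ?G \<subseteq> sklyanin_ideal \<xi>"
    by (rule fa.span_minimal)
qed


lemma lookup_homogeneous:
  assumes "f \<in> homogeneous_part m" "length (letters w) \<noteq> m"
  shows "Poly_Mapping.lookup f w = 0"
  using assms by (auto simp: homogeneous_part_def in_keys_iff)

text \<open>The relations are homogeneous, so the ideal is the direct sum of the spans of its
  relators of each degree: an element of the ideal is a sum of homogeneous elements of the
  ideal, and comparing degrees leaves a single summand.\<close>

lemma sklyanin_ideal_homogeneous:
  "sklyanin_ideal \<xi> \<inter> homogeneous_part n = fa.span (relators \<xi> n)"
proof (intro equalityI subsetI)
  fix f assume f: "f \<in> sklyanin_ideal \<xi> \<inter> homogeneous_part n"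
  then have "f \<in> fa.span (\<Union>m. relators \<xi> m)"
    by (simp add: sklyanin_ideal_eq_span)
  then have "\<exists>g\<in>fa.span (relators \<xi> n).
      \<forall>w. length (letters w) = n \<longrightarrow> Poly_Mapping.lookup f w = Poly_Mapping.lookup g w"
  proof (induction rule: fa.span_induct_alt)
    case base
    show ?case by (rule bexI[OF _ fa.span_zero]) simp
  next
    case (step c x y)
    then obtain g m where g: "g \<in> fa.span (relators \<xi> n)" "x \<in> relators \<xi> m"
      "\<And>w. length (letters w) = n \<Longrightarrow> Poly_Mapping.lookup y w = Poly_Mapping.lookup g w"
      by blast
    show ?case
    proof (cases "m = n")
      case True
      with g show ?thesis
        by (intro bexI[of _ "scalar c * x + g"] fa.span_add fa.span_scale)
           (auto simp: lookup_add intro: fa.span_base)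
    next
      case False
      then have "Poly_Mapping.lookup x w = 0" if "length (letters w) = n" for w
        using that g(2) relators_subset[of \<xi> m] by (intro lookup_homogeneous[of x m]) blast+
      with g show ?thesis
        by (intro bexI[of _ g]) (auto simp: lookup_add lookup_scalar_mult)
    qed
  qed
  then obtain g where g: "g \<in> fa.span (relators \<xi> n)"
    "\<And>w. length (letters w) = n \<Longrightarrow> Poly_Mapping.lookup f w = Poly_Mapping.lookup g w" by blast
  moreover have "g \<in> homogeneous_part n"
    using g(1) fa.span_mono[OF relators_subset[of \<xi> n]]
    unfolding homogeneous_part_eq_span fa.span_span by blast
  then have "Poly_Mapping.lookup f w = Poly_Mapping.lookup g w" for w
    using f g(2)[of w] lookup_homogeneous[of f n w] lookup_homogeneous[of g n w]
    by (cases "length (letters w) = n") auto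
  then have "f = g"
    by (rule poly_mapping_eqI)
  ultimately show "f \<in> fa.span (relators \<xi> n)" by simp
next
  fix f assume f: "f \<in> fa.span (relators \<xi> n)"
  have "relators \<xi> n \<subseteq> (\<Union>m. relators \<xi> m)" by blast
  then have "f \<in> sklyanin_ideal \<xi>"
    using f fa.span_mono unfolding sklyanin_ideal_eq_span by blast
  moreover have "f \<in> homogeneous_part n"
    using f fa.span_mono[OF relators_subset[of \<xi> n]]
    unfolding homogeneous_part_eq_span fa.span_span by blast
  ultimately show "f \<in> sklyanin_ideal \<xi> \<inter> homogeneous_part n" by simp
qed

section \<open>Dimensions of the components\<close>

lemma relators_less_2: "n < 2 \<Longrightarrow> relators \<xi> n = {}"
  by (auto simp: relators_def)

text \<open>The relations live in degree 2, so the ideal contains no nonzero constant; this is what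
  makes the image of the ground field a field.\<close>

lemma one_notin_sklyanin_ideal: "1 \<notin> sklyanin_ideal \<xi>"
proof
  assume "1 \<in> sklyanin_ideal \<xi>"
  moreover have "(1 :: 'a free_alg) \<in> homogeneous_part 0"
    by (simp add: homogeneous_part_def zero_gword_def)
  ultimately have "(1 :: 'a free_alg) \<in> fa.span (relators \<xi> 0)"
    using sklyanin_ideal_homogeneous by blast
  then show False by (simp add: relators_less_2)
qed

lemma sklyanin_proj_eq_iff: "sklyanin_proj \<xi> f = sklyanin_proj \<xi> g \<longleftrightarrow> f - g \<in> sklyanin_ideal \<xi>"
  using fr.quotient_eq_iff_same_a_r_cos[OF ideal_sklyanin, of f g \<xi>]
  by (simp add: sklyanin_proj_def fr_simps fr_minus)

text \<open>The constants are the image of a field under a ring homomorphism into a nonzero ring.\<close>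

lemma subfield_scalars: "subfield (range scalar) (ring_of_type_algebra :: 'k::field free_alg ring)"
proof -
  have K: "field (ring_of_type_algebra :: 'k ring)" by (rule field_from_type_algebra)
  have "scalar \<in> ring_hom (ring_of_type_algebra :: 'k ring) (ring_of_type_algebra :: 'k free_alg
    ring)"
    by (simp add: ring_hom_def ring_of_type_algebra_def scalar_mult scalar_add scalar_one)
  then have "ring_hom_ring (ring_of_type_algebra :: 'k ring) (ring_of_type_algebra :: 'k free_alg
    ring) scalar"
    by (intro ring_hom_ringI2 fr.ring_axioms ring_from_type_algebra)
  then have "subfield (scalar ` carrier (ring_of_type_algebra :: 'k ring)) (ring_of_type_algebra
    :: 'k free_alg ring)"
    using field.carrier_is_subfield[OF K]
    by (intro ring_hom_ring.img_is_subfield(2)) (auto simp: fr_simps)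
  then show ?thesis by (simp add: ring_of_type_algebra_def)
qed

lemma fr_Span_eq_span: "fr.Span (range scalar) us = (fa.span (set us) :: 'k::field free_alg set)"
proof (induction us)
  case (Cons u us)
  have "fr.Span (range scalar) (u # us)
      = {scalar c * u + v | c v. v \<in> fa.span (set us)}"
    using Cons by (auto simp: fr.line_extension_mem_iff fr_simps set_eq_iff)
  also have "\<dots> = fa.span (set (u # us))"
  proof (intro equalityI subsetI)
    fix f assume "f \<in> fa.span (set (u # us))"
    then obtain c where "f - scalar c * u \<in> fa.span (set us)"
      by (auto simp: fa.span_insert)
    moreover have "f = scalar c * u + (f - scalar c * u)" by simp
    ultimately show "f \<in> {scalar c * u + v | c v. v \<in> fa.span (set us)}" by blast
  next
    fix f assume "f \<in> {scalar c * u + v | c v. v \<in> fa.span (set us)}"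
    then obtain c v where "f = scalar c * u + v" "v \<in> fa.span (set us)" by blast
    then have "f - scalar c * u \<in> fa.span (set us)" by simp
    then show "f \<in> fa.span (set (u # us))"
      by (auto simp: fa.span_insert)
  qed
  finally show ?case .
qed (simp add: fr_simps)


text \<open>The bridge from the quotient algebra to linear algebra in the free algebra: a complement
  of the degree \<open>n\<close> part of the ideal in the space of all degree \<open>n\<close> polynomials projects to a
  basis of the component.\<close>

lemma sklyanin_dim_eq_card:
  fixes \<xi> :: "'k::field params"
  assumes indep: "fa.independent (B \<union> C)" and disj: "B \<inter> C = {}" and fin: "finite C"
    and B: "fa.span B = fa.span (relators \<xi> n)" and BC: "fa.span (B \<union> C) = homogeneous_part n"
  shows "sklyanin_dim \<xi> n = card C"
proof -
  let ?F = "ring_of_type_algebra :: 'k free_alg ring" and ?A = "sklyanin_algebra \<xi>"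
    and ?\<pi> = "sklyanin_proj \<xi>"
  interpret I: ideal "sklyanin_ideal \<xi>" ?F by (rule ideal_sklyanin)
  have \<pi>: "?\<pi> = (+>\<^bsub>?F\<^esub>) (sklyanin_ideal \<xi>)"
    by (auto simp: sklyanin_proj_def)
  interpret h: ring_hom_ring ?F ?A ?\<pi>
    unfolding \<pi> sklyanin_algebra_def by (rule I.rcos_ring_hom_ring)
  have "?\<pi> 1 \<noteq> ?\<pi> 0"
    using one_notin_sklyanin_ideal[of \<xi>] by (simp add: sklyanin_proj_eq_iff)
  then have "\<one>\<^bsub>?A\<^esub> \<noteq> \<zero>\<^bsub>?A\<^esub>"
    using h.hom_one h.hom_zero by (simp add: fr_simps)
  then have K: "subfield (sklyanin_scalars \<xi>) ?A"
    using h.img_is_subfield(2)[OF subfield_scalars]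
    by (simp add: sklyanin_scalars_def image_image)
  have Span: "h.S.Span (sklyanin_scalars \<xi>) (map ?\<pi> us) = ?\<pi> ` fa.span (set us)" for us
    using h.Span_hom[of "range scalar" us]
    by (simp only: fr_Span_eq_span fr_simps sklyanin_scalars_def image_image subset_UNIV)
  obtain cs where cs: "set cs = C" "distinct cs"
    using fin finite_distinct_list by blast
  have C: "C \<subseteq> homogeneous_part n"
    using BC fa.span_superset[of "B \<union> C"] by blast
  have ind: "h.S.independent (sklyanin_scalars \<xi>) (map ?\<pi> us)"
    if "set us \<subseteq> C" "distinct us" for us
    using that
  proof (induction us)
    case (Cons u us)
    have "?\<pi> u \<notin> ?\<pi> ` fa.span (set us)"
    proof
      assume "?\<pi> u \<in> ?\<pi> ` fa.span (set us)"
      then obtain v where v: "v \<in> fa.span (set us)" "u - v \<in> sklyanin_ideal \<xi>"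
        by (auto simp: sklyanin_proj_eq_iff)
      have "u \<in> homogeneous_part n" "v \<in> homogeneous_part n"
        using Cons.prems C v(1) fa.span_mono[of "set us" "homogeneous_part n"]
        by (auto simp: homogeneous_part_eq_span fa.span_span)
      then have "u - v \<in> homogeneous_part n"
        by (simp add: homogeneous_part_eq_span fa.span_diff)
      then have "u - v \<in> fa.span B"
        using v(2) B sklyanin_ideal_homogeneous[of \<xi> n] by blast
      then have "u - v \<in> fa.span ((B \<union> C) - {u})" "v \<in> fa.span ((B \<union> C) - {u})"
        using v(1) Cons.prems disj fa.span_mono[of B "(B \<union> C) - {u}"]
          fa.span_mono[of "set us" "(B \<union> C) - {u}"] by auto
      then have "u - v + v \<in> fa.span ((B \<union> C) - {u})"
        by (rule fa.span_add)
      then have "fa.dependent (B \<union> C)"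
        using Cons.prems unfolding fa.dependent_def by auto
      with indep show False by simp
    qed
    then show ?case
      using Cons by (auto simp del: h.S.Span.simps simp: Span fr_simps intro!:
        h.S.independent.li_Cons h.hom_closed)
  qed simp
  have "sklyanin_component \<xi> n = ?\<pi> ` fa.span C"
  proof (intro equalityI subsetI)
    fix a assume "a \<in> sklyanin_component \<xi> n"
    then obtain f where f: "f \<in> fa.span (B \<union> C)" "a = ?\<pi> f"
      using BC by (auto simp: sklyanin_component_def)
    then obtain b c where "f = b + c" "b \<in> fa.span B" "c \<in> fa.span C"
      by (auto simp: fa.span_Un)
    moreover have "fa.span B \<subseteq> sklyanin_ideal \<xi>"
      using B sklyanin_ideal_homogeneous by blast
    ultimately show "a \<in> ?\<pi> ` fa.span C"
      using f(2) sklyanin_proj_eq_iff[of \<xi> f c] by (intro image_eqI[of _ _ c]) auto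
  next
    fix a assume "a \<in> ?\<pi> ` fa.span C"
    then show "a \<in> sklyanin_component \<xi> n"
      using BC fa.span_mono[of C "B \<union> C"] by (auto simp: sklyanin_component_def)
  qed
  then have "h.S.dimension (card C) (sklyanin_scalars \<xi>) (sklyanin_component \<xi> n)"
    using h.S.dimension_independent[OF ind[of cs]] cs distinct_card[OF cs(2)]
    by (simp only: Span length_map)
  then show ?thesis
    using h.S.dimI[OF K] by (simp add: sklyanin_dim_def over_def)
qed

text \<open>A basis of the degree \<open>n\<close> part of the ideal, extended to a basis of all \<open>3 ^ n\<close>
  dimensions: the added vectors count the dimension of the component. All later dimension
  estimates are made with such a pair.\<close>

lemma sklyanin_basis_exists:
  fixes \<xi> :: "'k::field params"
  obtains B C where "fa.independent (B \<union> C)" "B \<inter> C = {}" "finite B" "finite C"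
    "fa.span B = fa.span (relators \<xi> n)" "fa.span (B \<union> C) = homogeneous_part n"
    "card C = sklyanin_dim \<xi> n" "card B + card C = 3 ^ n"
proof -
  obtain B where B: "B \<subseteq> relators \<xi> n" "fa.independent B" "relators \<xi> n \<subseteq> fa.span B"
    using fa.maximal_independent_subset by blast
  obtain D where D: "B \<subseteq> D" "D \<subseteq> homogeneous_part n" "fa.independent D" "homogeneous_part n \<subseteq>
    fa.span D"
    using fa.maximal_independent_subset_extend[of B "homogeneous_part n"] B relators_subset by blast
  have span_D: "fa.span D = homogeneous_part n"
    using D fa.span_minimal[of D "homogeneous_part n"] fa.subspace_span
    by (auto simp: homogeneous_part_eq_span)
  have "finite D \<and> card D \<le> card (wmono ` words n :: 'k free_alg set)"
    using D by (intro fa.independent_span_bound) (auto simp: finite_words homogeneous_part_eq_span)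
  moreover have "card (wmono ` words n :: 'k free_alg set) \<le> card D" if "finite D"
  proof -
    have "wmono ` words n \<subseteq> fa.span D"
      using D(4) fa.span_superset[of "wmono ` words n"]
      unfolding homogeneous_part_eq_span by (rule order_trans[rotated])
    then show ?thesis
      using fa.independent_span_bound[OF that independent_monos, of "words n"] by blast
  qed
  moreover have "card (wmono ` words n :: 'k free_alg set) = 3 ^ n"
    by (subst card_image) (auto intro: inj_on_subset[OF inj_mono] simp: card_words)
  ultimately have card_D: "finite D" "card D = 3 ^ n" by auto
  have span_B: "fa.span B = fa.span (relators \<xi> n)"
    unfolding fa.span_eq using B by (auto intro: fa.span_base)
  have BC: "B \<union> (D - B) = D" using D(1) by blast
  show ?thesis
  proof
    show "fa.independent (B \<union> (D - B))" "B \<inter> (D - B) = {}" "finite B" "finite (D - B)"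
      "fa.span B = fa.span (relators \<xi> n)" "fa.span (B \<union> (D - B)) = homogeneous_part n"
      using D(3) card_D(1) span_B span_D finite_subset[OF D(1) card_D(1)] unfolding BC
      by simp_all
    then show "card (D - B) = sklyanin_dim \<xi> n"
      by (intro sklyanin_dim_eq_card[symmetric, of B])
    show "card B + card (D - B) = 3 ^ n"
      using card_D D(1) card_mono[OF card_D(1) D(1)]
      by (simp add: card_Diff_subset finite_subset[OF D(1)])
  qed
qed

section \<open>Functionals on words\<close>

text \<open>A functional on the free algebra is a function on words. It descends to the algebra
  exactly if it annihilates every translate of every relation, and the functionals on words of
  length \<open>n\<close> that do so form the dual space of the degree \<open>n\<close> component.\<close>

fun annihilates :: "'k::field params \<Rightarrow> (gen list \<Rightarrow> 'k) \<Rightarrow> bool"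
  where "annihilates (p1, p2, p3, q1, q2, q3, r1, r2, r3) F \<longleftrightarrow> (\<forall>u v.
    p1 * F (u @ [GenY, GenZ] @ v) + q1 * F (u @ [GenZ, GenY] @ v) + r1 * F (u @ [GenX, GenX] @ v)
      = 0 \<and>
    p2 * F (u @ [GenZ, GenX] @ v) + q2 * F (u @ [GenX, GenZ] @ v) + r2 * F (u @ [GenY, GenY] @ v)
      = 0 \<and>
    p3 * F (u @ [GenX, GenY] @ v) + q3 * F (u @ [GenY, GenX] @ v) + r3 * F (u @ [GenZ, GenZ] @ v)
      = 0)"

lemma sklyanin_relations_words:
  "sklyanin_relations (p1, p2, p3, q1, q2, q3, r1, r2, r3) =
    {scalar p1 * wmono [GenY, GenZ] + scalar q1 * wmono [GenZ, GenY] + scalar r1 * wmono [GenX,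
      GenX],
     scalar p2 * wmono [GenZ, GenX] + scalar q2 * wmono [GenX, GenZ] + scalar r2 * wmono [GenY,
       GenY],
     scalar p3 * wmono [GenX, GenY] + scalar q3 * wmono [GenY, GenX] + scalar r3 * wmono [GenZ,
       GenZ]}"
  by (simp add: Let_def gvar_def mult.assoc mono_mult)

lemma relators_words:
  "relators (p1, p2, p3, q1, q2, q3, r1, r2, r3) n =
    (\<Union>u. \<Union>v \<in> {v. length u + 2 + length v = n}.
    {scalar p1 * wmono (u @ [GenY, GenZ] @ v) + scalar q1 * wmono (u @ [GenZ, GenY] @ v)
       + scalar r1 * wmono (u @ [GenX, GenX] @ v),
     scalar p2 * wmono (u @ [GenZ, GenX] @ v) + scalar q2 * wmono (u @ [GenX, GenZ] @ v)
       + scalar r2 * wmono (u @ [GenY, GenY] @ v),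
     scalar p3 * wmono (u @ [GenX, GenY] @ v) + scalar q3 * wmono (u @ [GenY, GenX] @ v)
       + scalar r3 * wmono (u @ [GenZ, GenZ] @ v)})"
proof -
  have sandwich: "wmono u * (scalar a * wmono w1 + scalar b * wmono w2 + scalar c * wmono w3) *
    wmono v
      = scalar a * wmono (u @ w1 @ v) + scalar b * wmono (u @ w2 @ v) + scalar c * wmono (u @ w3 @
        v)"
    for u v w1 w2 w3 and a b c :: 'a
    by (simp only: distrib_left distrib_right mult_scalar_left mult.assoc mono_mult append_assoc)
  have "relators \<xi> n = (\<Union>u. \<Union>v \<in> {v. length u + 2 + length v = n}.
      (\<lambda>r. wmono u * r * wmono v) ` sklyanin_relations \<xi>)" for \<xi> :: "'a params"
    by (auto simp: relators_def)
  then show ?thesis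
    by (simp only: sklyanin_relations_words image_insert image_empty sandwich)
qed

definition evaluate :: "(gen list \<Rightarrow> 'k) \<Rightarrow> 'k::field free_alg \<Rightarrow> 'k"
  where "evaluate F f = (\<Sum>w\<in>Poly_Mapping.keys f. Poly_Mapping.lookup f w * F (letters w))"

lemma evaluate_superset:
  assumes "finite A" "Poly_Mapping.keys f \<subseteq> A"
  shows "evaluate F f = (\<Sum>w\<in>A. Poly_Mapping.lookup f w * F (letters w))"
  unfolding evaluate_def using assms
  by (intro sum.mono_neutral_left) (auto simp: in_keys_iff)

lemma evaluate_add: "evaluate F (f + g) = evaluate F f + evaluate F g"
  using keys_add[of f g]
  by (simp add: evaluate_superset[of "Poly_Mapping.keys f \<union> Poly_Mapping.keys g"]
    lookup_add distrib_right sum.distrib)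

lemma evaluate_scalar: "evaluate F (scalar c * f) = c * evaluate F f"
proof -
  have "Poly_Mapping.keys (scalar c * f) \<subseteq> Poly_Mapping.keys f"
    by (auto simp: in_keys_iff lookup_scalar_mult)
  then show ?thesis
    by (simp add: evaluate_superset[of "Poly_Mapping.keys f"] lookup_scalar_mult
      sum_distrib_left mult.assoc)
qed

lemma evaluate_mono: "evaluate F (wmono w) = F w"
  by (simp add: evaluate_def)

lemma evaluate_zero: "evaluate F 0 = 0"
  by (simp add: evaluate_def)

lemma evaluate_span_eq_0:
  assumes "f \<in> fa.span S" "\<And>s. s \<in> S \<Longrightarrow> evaluate F s = 0"
  shows "evaluate F f = 0"
  using assms(1)
  by (induction rule: fa.span_induct_alt) (simp_all add: evaluate_zero evaluate_add
    evaluate_scalar assms(2))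

lemma annihilates_relators:
  assumes "annihilates \<xi> F" "f \<in> relators \<xi> n"
  shows "evaluate F f = 0"
  using assms
  by (cases \<xi>) (auto simp: relators_words evaluate_add evaluate_scalar evaluate_mono)

text \<open>Functionals that vanish on the ideal and are dual to \<open>m\<close> words show that these words stay
  independent of each other and of the ideal.\<close>

lemma sklyanin_dim_ge:
  fixes \<xi> :: "'k::field params"
  assumes ann: "\<And>i. i < m \<Longrightarrow> annihilates \<xi> (F i)"
    and len: "\<And>i. i < m \<Longrightarrow> length (w i) = n"
    and dual: "\<And>i j. i < m \<Longrightarrow> j < m \<Longrightarrow> F i (w j) = (if i = j then 1 else 0)"
  shows "m \<le> sklyanin_dim \<xi> n"
proof -
  obtain B C where B: "fa.independent (B \<union> C)" "B \<inter> C = {}" "finite B" "finite C"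
    "fa.span B = fa.span (relators \<xi> n)" "fa.span (B \<union> C) = homogeneous_part n"
    "card C = sklyanin_dim \<xi> n" "card B + card C = 3 ^ n"
    by (rule sklyanin_basis_exists)
  have vanish: "evaluate (F i) b = 0" if "i < m" "b \<in> B" for i b
    using that B(5) fa.span_base[of b B]
    by (intro evaluate_span_eq_0[of b "relators \<xi> n"]) (auto intro: annihilates_relators ann)
  have "fa.independent (B \<union> (\<lambda>i. wmono (w i)) ` {..<k}) \<and>
        card (B \<union> (\<lambda>i. wmono (w i)) ` {..<k}) = card B + k" if "k \<le> m" for k
    using that
  proof (induction k)
    case 0
    then show ?case using B(1) fa.independent_mono by fastforce
  next
    case (Suc k)
    let ?S = "B \<union> (\<lambda>i. wmono (w i)) ` {..<k}"
    have "wmono (w k) \<notin> fa.span ?S"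
    proof
      assume "wmono (w k) \<in> fa.span ?S"
      then have "evaluate (F k) (wmono (w k)) = 0"
      proof (rule evaluate_span_eq_0)
        fix s assume "s \<in> ?S"
        then show "evaluate (F k) s = 0"
          using Suc.prems vanish dual by (auto simp: evaluate_mono)
      qed
      then show False using Suc.prems dual[of k k] by (simp add: evaluate_mono)
    qed
    then have "fa.independent (insert (wmono (w k)) ?S)" "wmono (w k) \<notin> ?S"
      using Suc fa.independent_insertI[of "wmono (w k)" ?S] fa.span_base[of "wmono (w k)" ?S] by
        auto
    moreover from this(2) have "card (insert (wmono (w k)) ?S) = Suc (card ?S)"
      using B(3) by (intro card_insert_disjoint) simp
    moreover have "B \<union> (\<lambda>i. wmono (w i)) ` {..<Suc k} = insert (wmono (w k)) ?S"
      by (auto simp: lessThan_Suc)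
    ultimately show ?case
      using Suc by simp
  qed
  from this[of m] have D: "fa.independent (B \<union> (\<lambda>i. wmono (w i)) ` {..<m})"
    "card (B \<union> (\<lambda>i. wmono (w i)) ` {..<m}) = card B + m" by auto
  have "B \<union> (\<lambda>i. wmono (w i)) ` {..<m} \<subseteq> fa.span (wmono ` words n)"
  proof -
    have "B \<subseteq> fa.span (wmono ` words n)"
      using B(6) fa.span_superset[of "B \<union> C"] by (simp add: homogeneous_part_eq_span)
    moreover have "wmono (w i) \<in> fa.span (wmono ` words n)" if "i < m" for i
      using len[OF that] by (intro fa.span_base imageI) (simp add: words_def)
    ultimately show ?thesis by blast
  qed
  then have "card (B \<union> (\<lambda>i. wmono (w i)) ` {..<m}) \<le> card (wmono ` words n :: 'k free_alg set)"
    using fa.independent_span_bound[OF _ D(1)] finite_words by blast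
  also have "\<dots> \<le> 3 ^ n"
    using card_image_le[OF finite_words, of wmono n] by (simp add: card_words)
  finally show ?thesis using D(2) B(7,8) by simp
qed

text \<open>A vector outside a span can be added to a basis of it, and the functional that is 1 on the
  new basis vector and 0 on the others separates the two.\<close>

lemma separating_functional:
  fixes x :: "'k::field free_alg"
  assumes x: "x \<notin> fa.span S"
  obtains \<psi> :: "'k free_alg \<Rightarrow> 'k" where "\<And>f g. \<psi> (f + g) = \<psi> f + \<psi> g"
    "\<And>c f. \<psi> (scalar c * f) = c * \<psi> f" "\<And>f. f \<in> fa.span S \<Longrightarrow> \<psi> f = 0" "\<psi> x = 1"
proof -
  interpret ground: vector_space "(*) :: 'k \<Rightarrow> 'k \<Rightarrow> 'k"
    by standard (simp_all add: algebra_simps)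
  note ground.scale_scale [simp del]
  interpret vector_space_pair "\<lambda>c (f :: 'k free_alg). scalar c * f" "(*) :: 'k \<Rightarrow> 'k \<Rightarrow> 'k" ..
  obtain T where T: "T \<subseteq> S" "fa.independent T" "S \<subseteq> fa.span T"
    using fa.maximal_independent_subset by blast
  have notin: "x \<notin> fa.span T"
    using x T(1) fa.span_mono by blast
  then have "fa.independent (insert x T)"
    using T(2) by (rule fa.independent_insertI)
  then obtain \<psi> where \<psi>: "Vector_Spaces.linear (\<lambda>c f. scalar c * f) (*) \<psi>"
    "\<forall>t\<in>insert x T. \<psi> t = (if t = x then 1 else 0 :: 'k)"
    using linear_independent_extend[of "insert x T" "\<lambda>t. if t = x then 1 else 0"] by blast
  interpret \<psi>: Vector_Spaces.linear "\<lambda>c (f :: 'k free_alg). scalar c * f" "(*) :: 'k \<Rightarrow> 'k \<Rightarrow> 'k" \<psi>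
    by (rule \<psi>(1))
  have lin: "\<psi> (f + g) = \<psi> f + \<psi> g" "\<psi> (scalar c * f) = c * \<psi> f" for f g c
    by (rule \<psi>.add, rule \<psi>.scale)
  have \<psi>_0: "\<psi> 0 = 0"
    using lin(2)[of 0 0] by simp
  have "\<psi> f = 0" if "f \<in> fa.span T" for f
    using that
  proof (induction rule: fa.span_induct_alt)
    case (step c t y)
    moreover have "t \<noteq> x"
      using step(1) fa.span_base[of t T] notin by blast
    ultimately show ?case using \<psi>(2) by (simp add: lin)
  qed (rule \<psi>_0)
  then have "\<psi> f = 0" if "f \<in> fa.span S" for f
    using that fa.span_minimal[OF T(3) fa.subspace_span] by blast
  then show thesis
    using \<psi>(2) by (intro that[of \<psi>] lin) simp_all
qed

text \<open>The converse estimate: if a word were not a combination of the words in \<open>N\<close> modulo the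
  ideal, a functional would vanish on \<open>N\<close> and on the ideal but not on that word.\<close>

lemma sklyanin_dim_le:
  fixes \<xi> :: "'k::field params"
  assumes fin: "finite N" and len: "N \<subseteq> words n"
    and det: "\<And>F w. annihilates \<xi> F \<Longrightarrow> (\<And>w. w \<in> N \<Longrightarrow> F w = 0) \<Longrightarrow> length w = n \<Longrightarrow> F w = 0"
  shows "sklyanin_dim \<xi> n \<le> card N"
proof -
  obtain B C where B: "fa.independent (B \<union> C)" "B \<inter> C = {}" "finite B" "finite C"
    "fa.span B = fa.span (relators \<xi> n)" "fa.span (B \<union> C) = homogeneous_part n"
    "card C = sklyanin_dim \<xi> n" "card B + card C = 3 ^ n"
    by (rule sklyanin_basis_exists)
  let ?S = "B \<union> wmono ` N"
  have "wmono w \<in> fa.span ?S" if w: "w \<in> words n" for w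
  proof (rule ccontr)
    assume notin: "wmono w \<notin> fa.span ?S"
    obtain \<psi> :: "'k free_alg \<Rightarrow> 'k" where add: "\<And>f g. \<psi> (f + g) = \<psi> f + \<psi> g"
      and scale: "\<And>c f. \<psi> (scalar c * f) = c * \<psi> f"
      and zero: "\<And>f. f \<in> fa.span ?S \<Longrightarrow> \<psi> f = 0" and one: "\<psi> (wmono w) = 1"
      using separating_functional[OF notin] by blast
    define F where "F v = (if length v = n then \<psi> (wmono v) else 0)" for v
    have "annihilates \<xi> F"
    proof -
      obtain p1 p2 p3 q1 q2 q3 r1 r2 r3 where xi: "\<xi> = (p1, p2, p3, q1, q2, q3, r1, r2, r3)"
        by (cases \<xi>) auto
      have rel: "\<psi> f = 0" if "f \<in> relators \<xi> n" for f
        using that B(5) fa.span_base[of f "relators \<xi> n"] fa.span_mono[of B ?S] by (intro zero) auto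
      show ?thesis
        unfolding xi annihilates.simps
      proof (intro allI)
        fix u v
        show "p1 * F (u @ [GenY, GenZ] @ v) + q1 * F (u @ [GenZ, GenY] @ v) + r1 * F (u @ [GenX,
          GenX] @ v) = 0 \<and>
          p2 * F (u @ [GenZ, GenX] @ v) + q2 * F (u @ [GenX, GenZ] @ v) + r2 * F (u @ [GenY, GenY]
            @ v) = 0 \<and>
          p3 * F (u @ [GenX, GenY] @ v) + q3 * F (u @ [GenY, GenX] @ v) + r3 * F (u @ [GenZ, GenZ]
            @ v) = 0"
        proof (cases "length u + 2 + length v = n")
          case True
          then have
            "scalar p1 * wmono (u @ [GenY, GenZ] @ v) + scalar q1 * wmono (u @ [GenZ, GenY] @ v)
               + scalar r1 * wmono (u @ [GenX, GenX] @ v) \<in> relators \<xi> n"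
            "scalar p2 * wmono (u @ [GenZ, GenX] @ v) + scalar q2 * wmono (u @ [GenX, GenZ] @ v)
               + scalar r2 * wmono (u @ [GenY, GenY] @ v) \<in> relators \<xi> n"
            "scalar p3 * wmono (u @ [GenX, GenY] @ v) + scalar q3 * wmono (u @ [GenY, GenX] @ v)
               + scalar r3 * wmono (u @ [GenZ, GenZ] @ v) \<in> relators \<xi> n"
            unfolding xi relators_words
            by (intro UN_I[of u] UNIV_I UN_I[of v]; simp)+
          from this[THEN rel] show ?thesis
            using True by (simp add: F_def add scale)
        qed (auto simp: F_def)
      qed
    qed
    moreover have "F v = 0" if "v \<in> N" for v
      using that len zero[of "wmono v"] fa.span_base[of "wmono v" ?S] by (auto simp: F_def
        words_def)
    ultimately have "F w = 0"
      using w det by (auto simp: words_def)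
    then show False
      using w one by (simp add: F_def words_def)
  qed
  then have "wmono ` words n \<subseteq> fa.span ?S" by blast
  moreover have "finite ?S" using B(3) fin by simp
  ultimately have "card (wmono ` words n :: 'k free_alg set) \<le> card ?S"
    by (intro conjunct2[OF fa.independent_span_bound[OF _ independent_monos]])
  moreover have "card (wmono ` words n :: 'k free_alg set) = 3 ^ n"
    using card_image[OF inj_on_subset[OF inj_mono subset_UNIV], of "words n"] by (simp add:
      card_words)
  moreover have "card ?S \<le> card B + card N"
    using card_Un_le[of B "wmono ` N"] card_image_le[OF fin, of "wmono :: _ \<Rightarrow> 'k free_alg"]
    by linarith
  ultimately show ?thesis using B(7,8) by simp
qed

section \<open>The Golod-Shafarevich inequality\<close>

text \<open>Write \<open>V\<close> for the space of linear forms, \<open>R\<close> for the span of the relations and \<open>I\<^sub>k\<close> for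
  the degree \<open>k\<close> part of the ideal. Then \<open>I\<^sub>n\<^sub>+\<^sub>2 = V I\<^sub>n\<^sub>+\<^sub>1 + R V\<^sup>n\<close>. Split \<open>V\<^sup>n\<close> as \<open>I\<^sub>n\<close>
  plus a complement \<open>C\<close> of the dimension of the component. The products in \<open>R I\<^sub>n\<close> lie in \<open>V V
  I\<^sub>n\<close>, hence in \<open>V I\<^sub>n\<^sub>+\<^sub>1\<close>, so only \<open>R C\<close> is new, and \<open>R\<close> has dimension 9 minus that of the
  degree 2 component.\<close>

lemma golod_shafarevich:
  fixes \<xi> :: "'k::field params"
  shows "3 * sklyanin_dim \<xi> (n + 1) \<le> sklyanin_dim \<xi> (n + 2) + (9 - sklyanin_dim \<xi> 2) *
    sklyanin_dim \<xi> n"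
proof -
  let ?V = "\<lambda>n. homogeneous_part n :: 'k free_alg set"
  obtain R R' where R: "fa.independent (R \<union> R')" "R \<inter> R' = {}" "finite R" "finite R'"
    "fa.span R = fa.span (relators \<xi> 2)" "fa.span (R \<union> R') = homogeneous_part 2"
    "card R' = sklyanin_dim \<xi> 2" "card R + card R' = 3 ^ 2"
    by (rule sklyanin_basis_exists)
  obtain B C where B: "fa.independent (B \<union> C)" "B \<inter> C = {}" "finite B" "finite C"
    "fa.span B = fa.span (relators \<xi> n)" "fa.span (B \<union> C) = homogeneous_part n"
    "card C = sklyanin_dim \<xi> n" "card B + card C = 3 ^ n"
    by (rule sklyanin_basis_exists)
  obtain B1 C1 where B1: "fa.independent (B1 \<union> C1)" "B1 \<inter> C1 = {}" "finite B1" "finite C1"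
    "fa.span B1 = fa.span (relators \<xi> (n + 1))" "fa.span (B1 \<union> C1) = homogeneous_part (n + 1)"
    "card C1 = sklyanin_dim \<xi> (n + 1)" "card B1 + card C1 = 3 ^ (n + 1)"
    by (rule sklyanin_basis_exists)
  obtain B2 C2 where B2: "fa.independent (B2 \<union> C2)" "B2 \<inter> C2 = {}" "finite B2" "finite C2"
    "fa.span B2 = fa.span (relators \<xi> (n + 2))" "fa.span (B2 \<union> C2) = homogeneous_part (n + 2)"
    "card C2 = sklyanin_dim \<xi> (n + 2)" "card B2 + card C2 = 3 ^ (n + 2)"
    by (rule sklyanin_basis_exists)
  define G where "G = (\<Union>g. (\<lambda>b. wmono [g] * b) ` B1) \<union> (\<lambda>(\<rho>, c). \<rho> * c) ` (R \<times> C)"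
  have shift: "wmono [g] * f \<in> fa.span G" if "f \<in> fa.span (relators \<xi> (n + 1))" for g f
    using that unfolding B1(5)[symmetric]
    by (rule mult_left_span) (auto simp: G_def intro!: fa.span_base)
  have "relators \<xi> (n + 2) \<subseteq> fa.span G"
  proof
    fix f assume "f \<in> relators \<xi> (n + 2)"
    then obtain u r v where f: "f = wmono u * r * wmono v" "r \<in> sklyanin_relations \<xi>"
        "length u + 2 + length v = n + 2"
      by (auto simp: relators_def)
    show "f \<in> fa.span G"
    proof (cases u)
      case (Cons g u')
      then have "f = wmono [g] * (wmono u' * r * wmono v)"
        by (simp add: f(1) mult.assoc[symmetric] mono_mult)
      moreover have "wmono u' * r * wmono v \<in> relators \<xi> (n + 1)"
        using f Cons unfolding relators_def by auto
      ultimately show ?thesis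
        using shift[OF fa.span_base] by simp
    next
      case Nil
      have v: "wmono v \<in> fa.span (B \<union> C)"
        using f(3) Nil unfolding B(6) by (simp add: homogeneous_part_def)
      then obtain b c where bc: "wmono v = b + c" "b \<in> fa.span B" "c \<in> fa.span C"
        by (auto simp: fa.span_Un)
      have "r = wmono [] * r * wmono []" by (simp add: mono_Nil)
      then have "r \<in> relators \<xi> 2"
        using f(2) unfolding relators_def by fastforce
      then have r: "r \<in> fa.span R" "r \<in> ?V 2"
        using R(5) fa.span_base relators_subset by blast+
      have "r * b \<in> fa.span G"
        using r(2) unfolding homogeneous_part_eq_span
      proof (rule mult_right_span)
        fix s :: "'k free_alg" assume "s \<in> wmono ` words 2"
        then obtain g h where s: "s = wmono [g] * wmono [h]"
          by (auto simp: words_def mono_mult numeral_2_eq_2 length_Suc_conv)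
        have "wmono [h] * b \<in> fa.span (relators \<xi> (n + 1))"
          using bc(2) unfolding B(5)
          by (rule mult_left_span) (use mono_mult_relators[of _ \<xi> n "[h]"] in \<open>auto intro!:
            fa.span_base\<close>)
        then show "s * b \<in> fa.span G"
          unfolding s mult.assoc by (rule shift)
      qed
      moreover have "r * c \<in> fa.span G"
        using r(1)
      proof (rule mult_right_span)
        fix \<rho> assume "\<rho> \<in> R"
        then show "\<rho> * c \<in> fa.span G"
          by (intro mult_left_span[OF bc(3)]) (auto simp: G_def intro!: fa.span_base)
      qed
      ultimately show ?thesis
        using f(1) Nil by (simp add: mono_Nil bc(1) distrib_left fa.span_add)
    qed
  qed
  then have "fa.span B2 \<subseteq> fa.span G"
    unfolding B2(5) using fa.span_minimal fa.subspace_span by blast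
  then have "B2 \<subseteq> fa.span G" using fa.span_superset by blast
  moreover have "finite G" by (simp add: G_def B1(3) R(3) B(4))
  moreover have "fa.independent B2" using B2(1) fa.independent_mono by blast
  ultimately have "card B2 \<le> card G" using fa.independent_span_bound by blast
  also have "\<dots> \<le> card (\<Union>g. (\<lambda>b. wmono [g] * b) ` B1) + card ((\<lambda>(\<rho>, c). \<rho> * c) ` (R \<times> C))"
    unfolding G_def by (rule card_Un_le)
  also have "\<dots> \<le> 3 * card B1 + card R * card C"
  proof (rule add_mono)
    have "card (\<Union>g. (\<lambda>b. wmono [g] * b) ` B1) \<le> (\<Sum>g\<in>UNIV. card ((\<lambda>b. wmono [g] * b) ` B1))"
      by (rule card_UN_le) simp
    also have "\<dots> \<le> (\<Sum>g\<in>(UNIV :: gen set). card B1)"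
      by (intro sum_mono card_image_le B1(3))
    finally show "card (\<Union>g. (\<lambda>b. wmono [g] * b) ` B1) \<le> 3 * card B1"
      by (simp add: UNIV_gen)
    show "card ((\<lambda>(\<rho>, c). \<rho> * c) ` (R \<times> C)) \<le> card R * card C"
      using card_image_le[of "R \<times> C"] R(3) B(4) by (simp add: card_cartesian_product)
  qed
  finally have "card B2 \<le> 3 * card B1 + card R * card C" .
  moreover have "card R = 9 - sklyanin_dim \<xi> 2" using R(7,8) by simp
  moreover have "(3::nat) ^ (n + 2) = 9 * 3 ^ n" "(3::nat) ^ (n + 1) = 3 * 3 ^ n" by simp_all
  ultimately show ?thesis
    using B(7) B1(7,8) B2(7,8) by simp
qed

lemma sklyanin_dim_0: "sklyanin_dim \<xi> 0 = 1" and sklyanin_dim_1: "sklyanin_dim \<xi> 1 = 3"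
proof -
  have "sklyanin_dim \<xi> n = 3 ^ n" if "n < 2" for n
  proof -
    obtain B C where B: "fa.independent (B \<union> C)" "B \<inter> C = {}" "finite B" "finite C"
    "fa.span B = fa.span (relators \<xi> n)" "fa.span (B \<union> C) = homogeneous_part n"
    "card C = sklyanin_dim \<xi> n" "card B + card C = 3 ^ n"
    by (rule sklyanin_basis_exists)
    have "B \<subseteq> {0}" using B(5) fa.span_superset[of B] by (simp add: relators_less_2[OF that])
    moreover have "0 \<notin> B" using B(1) fa.dependent_zero by blast
    ultimately have "B = {}" by blast
    then show ?thesis using B by simp
  qed
  from this[of 0] this[of 1] show "sklyanin_dim \<xi> 0 = 1" "sklyanin_dim \<xi> 1 = 3" by simp_all
qed

lemma sklyanin_dim_2: "6 \<le> sklyanin_dim \<xi> 2" "sklyanin_dim \<xi> 2 \<le> 9"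
proof -
  obtain B C where B: "fa.independent (B \<union> C)" "B \<inter> C = {}" "finite B" "finite C"
    "fa.span B = fa.span (relators \<xi> 2)" "fa.span (B \<union> C) = homogeneous_part 2"
    "card C = sklyanin_dim \<xi> 2" "card B + card C = 3 ^ 2"
    by (rule sklyanin_basis_exists)
  have "relators \<xi> 2 \<subseteq> sklyanin_relations \<xi>"
    by (auto simp: relators_def mono_Nil)
  then have "B \<subseteq> fa.span (sklyanin_relations \<xi>)"
    using B(5) fa.span_mono fa.span_superset by blast
  moreover have "fa.independent B" using B(1) fa.independent_mono by blast
  moreover have "finite (sklyanin_relations \<xi>) \<and> card (sklyanin_relations \<xi>) \<le> 3"
  proof -
    obtain p1 p2 p3 q1 q2 q3 r1 r2 r3 where "\<xi> = (p1, p2, p3, q1, q2, q3, r1, r2, r3)"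
      by (cases \<xi>) auto
    then show ?thesis
      by (simp only: sklyanin_relations_words) (simp add: card_insert_if)
  qed
  ultimately have "card B \<le> 3"
    using fa.independent_span_bound[of "sklyanin_relations \<xi>" B] by auto
  then show "6 \<le> sklyanin_dim \<xi> 2" "sklyanin_dim \<xi> 2 \<le> 9" using B(7,8) by auto
qed

lemma sklyanin_dim_3: "9 \<le> sklyanin_dim \<xi> 3"
  using golod_shafarevich[of \<xi> 1] sklyanin_dim_1[of \<xi>] sklyanin_dim_2[of \<xi>]
  by (simp add: numeral_2_eq_2[symmetric])

text \<open>With \<open>r\<close> independent relations the Golod-Shafarevich bound in degree 4 is \<open>81 - 27 r +
  r\<^sup>2\<close>, and its least value for \<open>r \<le> 3\<close> is attained at \<open>r = 3\<close>.\<close>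

lemma sklyanin_dim_4: "9 \<le> sklyanin_dim \<xi> 4"
proof -
  define r where "r = 9 - sklyanin_dim \<xi> 2"
  have d2: "sklyanin_dim \<xi> 2 = 9 - r" "r \<le> 3"
    using sklyanin_dim_2[of \<xi>] by (auto simp: r_def)
  have "27 \<le> sklyanin_dim \<xi> 3 + 6 * r"
    using golod_shafarevich[of \<xi> 1] sklyanin_dim_1[of \<xi>] d2(2)
    by (simp add: d2(1) numeral_2_eq_2[symmetric])
  moreover have "3 * sklyanin_dim \<xi> 3 \<le> sklyanin_dim \<xi> 4 + r * sklyanin_dim \<xi> 2"
    using golod_shafarevich[of \<xi> 2] by (simp only: r_def) simp
  moreover have "r = 0 \<or> r = 1 \<or> r = 2 \<or> r = 3" using d2(2) by auto
  ultimately show ?thesis using d2(1) by auto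
qed

text \<open>If the algebra dies in degree 5, the inequality in that degree bounds degree 4 by degree 3
  from above, while one degree lower it bounds degree 4 from below. Together with the lower
  bound in degree 3 only the value 9 is left in both.\<close>

lemma sklyanin_dims_if_dim_5_eq_0:
  assumes "sklyanin_dim \<xi> 5 = 0" "sklyanin_dim \<xi> 2 = 6"
  shows "sklyanin_dim \<xi> 3 = 9" "sklyanin_dim \<xi> 4 = 9"
proof -
  have "3 * sklyanin_dim \<xi> 3 \<le> sklyanin_dim \<xi> 4 + 18" "3 * sklyanin_dim \<xi> 4 \<le> 3 * sklyanin_dim \<xi> 3"
    using golod_shafarevich[of \<xi> 2] golod_shafarevich[of \<xi> 3] by (simp_all add: assms)
  then show "sklyanin_dim \<xi> 3 = 9" "sklyanin_dim \<xi> 4 = 9"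
    using sklyanin_dim_3[of \<xi>] by linarith+
qed

section \<open>Lower bounds over the two-element field\<close>

text \<open>Over the field with two elements there are only \<open>8\<^sup>3\<close> parameter tuples. They are handled
  as triples \<open>(p, q, r)\<close> of zeros and ones, one for each relation, and the lower bounds in
  degrees 5 and 6 come from explicit right modules that satisfy the relations.\<close>

type_synonym coeffs = "(nat \<times> nat \<times> nat) \<times> (nat \<times> nat \<times> nat) \<times> (nat \<times> nat \<times> nat)"

fun params_of :: "coeffs \<Rightarrow> 'k::field params"
  where "params_of ((p1, q1, r1), (p2, q2, r2), (p3, q3, r3)) =
    (of_nat p1, of_nat p2, of_nat p3, of_nat q1, of_nat q2, of_nat q3, of_nat r1, of_nat r2,
      of_nat r3)"

text \<open>A right module over the field with two elements, given on a basis indexed by natural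
  numbers: row \<open>i\<close> lists the indices of the basis vectors whose sum is the image of the basis
  vector \<open>i\<close> under x, y and z respectively. Basis vectors without a row are sent to 0.\<close>

type_synonym module_table = "(nat list \<times> nat list \<times> nat list) list"

fun act :: "module_table \<Rightarrow> gen \<Rightarrow> nat \<Rightarrow> nat list"
  where "act M g i = (if i < length M then
    (case M ! i of (xs, ys, zs) \<Rightarrow> (case g of GenX \<Rightarrow> xs | GenY \<Rightarrow> ys | GenZ \<Rightarrow> zs)) else [])"

declare act.simps [simp del]

fun run :: "module_table \<Rightarrow> gen list \<Rightarrow> nat \<Rightarrow> nat list"
  where
    "run M [] i = [i]"
  | "run M (g # w) i = concat (map (run M w) (act M g i))"

text \<open>The coefficient of the basis vector \<open>j\<close> in the image of the basis vector \<open>i\<close> under the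
  word \<open>w\<close>. As a function of \<open>w\<close> it is a functional that annihilates the relations that hold in
  the module.\<close>

definition coordinate :: "module_table \<Rightarrow> nat \<Rightarrow> nat \<Rightarrow> gen list \<Rightarrow> 'k::field"
  where "coordinate M j i w = (\<Sum>k\<leftarrow>run M w i. of_bool (k = j))"

text \<open>Every entry occurs an even number of times, so the corresponding sum of basis vectors is 0
  in characteristic 2.\<close>

function cancels :: "nat list \<Rightarrow> bool"
  where
    "cancels [] = True"
  | "cancels (x # xs) = (x \<in> set xs \<and> cancels (remove1 x xs))"
  by pat_completeness auto
termination
  by (relation "measure length") (auto simp: length_remove1)

text \<open>The coefficients \<open>p\<close>, \<open>q\<close>, \<open>r\<close> enter as multiplicities, so the relation with these
  coefficients kills a basis vector if the concatenated lists cancel in pairs.\<close>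

fun relation_holds :: "module_table \<Rightarrow> nat \<times> nat \<times> nat \<Rightarrow> gen list \<Rightarrow> gen list \<Rightarrow> gen list \<Rightarrow> bool"
  where "relation_holds M (p, q, r) u v w = list_all (\<lambda>i. cancels
    (concat (replicate p (run M u i)) @ concat (replicate q (run M v i)) @ concat (replicate r
      (run M w i))))
    [0..<length M]"

lemma cancels_sum:
  assumes "(2 :: 'k::field) = 0" "cancels xs"
  shows "(\<Sum>k\<leftarrow>xs. f k :: 'k) = 0"
  using assms(2)
proof (induction xs rule: cancels.induct)
  case (2 x xs)
  have "f x + f x = 0"
    using assms(1) by (simp flip: mult_2)
  then show ?case
    using 2 by (simp add: sum_list_map_remove1[of x xs f] add.assoc[symmetric])
qed simp

lemma sum_list_concat_map:
  "(\<Sum>k\<leftarrow>concat xss. f k) = (\<Sum>xs\<leftarrow>xss. \<Sum>k\<leftarrow>xs. f k :: 'k::field)"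
  by (induction xss) simp_all

lemma coordinate_append:
  "coordinate M j i (u @ w) = (\<Sum>k\<leftarrow>run M u i. coordinate M j k w :: 'k::field)"
proof (induction u arbitrary: i)
  case (Cons g u)
  have "coordinate M j i (g # v) = (\<Sum>k\<leftarrow>act M g i. coordinate M j k v :: 'k)" for i v
    by (simp add: coordinate_def sum_list_concat_map comp_def)
  with Cons show ?case
    by (simp add: sum_list_concat_map comp_def)
qed (simp add: coordinate_def)

lemma sum_list_concat_replicate:
  "(\<Sum>k\<leftarrow>concat (replicate n xs). f k) = of_nat n * (\<Sum>k\<leftarrow>xs. f k :: 'k::field)"
  by (induction n) (simp_all add: algebra_simps)

lemma relation_holds_coordinate:
  assumes two: "(2 :: 'k::field) = 0" and holds: "relation_holds M (p, q, r) w1 w2 w3"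
    and ne: "w1 \<noteq> []" "w2 \<noteq> []" "w3 \<noteq> []"
  shows "of_nat p * coordinate M j i (u @ w1 @ v) + of_nat q * coordinate M j i (u @ w2 @ v)
    + of_nat r * coordinate M j i (u @ w3 @ v) = (0 :: 'k)"
proof -
  have start: "of_nat p * coordinate M j i (w1 @ v) + of_nat q * coordinate M j i (w2 @ v)
    + of_nat r * coordinate M j i (w3 @ v) = (0 :: 'k)" for i
  proof (cases "i < length M")
    case True
    then have "cancels (concat (replicate p (run M w1 i)) @ concat (replicate q (run M w2 i))
        @ concat (replicate r (run M w3 i)))"
      using holds by (simp add: list_all_iff)
    from cancels_sum[OF two this, of "\<lambda>k. coordinate M j k v"] show ?thesis
      by (simp add: sum_list_concat_replicate coordinate_append add.assoc)
  next
    case False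
    then have "run M w i = []" if "w \<noteq> []" for w
      using that by (cases w) (simp_all add: act.simps)
    then show ?thesis by (simp add: coordinate_append ne)
  qed
  have "of_nat p * coordinate M j i (u @ w1 @ v) + of_nat q * coordinate M j i (u @ w2 @ v)
      + of_nat r * coordinate M j i (u @ w3 @ v)
    = (\<Sum>k\<leftarrow>run M u i. of_nat p * coordinate M j k (w1 @ v) + of_nat q * coordinate M j k (w2 @ v)
      + of_nat r * coordinate M j k (w3 @ v) :: 'k)"
    by (simp add: coordinate_append[of M j i u] sum_list_addf sum_list_const_mult)
  then show ?thesis by (simp add: start)
qed

text \<open>The hypothesis of the lower bound for dimensions, as a predicate that can be transported
  along symmetries.\<close>

definition dual_family :: "'k::field params \<Rightarrow> nat \<Rightarrow> nat \<Rightarrow> bool"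
  where "dual_family \<xi> n m \<longleftrightarrow> (\<exists>F w. (\<forall>i<m. annihilates \<xi> (F i) \<and> length (w i) = n) \<and>
    (\<forall>i<m. \<forall>j<m. F i (w j) = (if i = j then 1 else 0)))"

lemma dual_family_dim: "dual_family \<xi> n m \<Longrightarrow> m \<le> sklyanin_dim \<xi> n"
  unfolding dual_family_def by (metis sklyanin_dim_ge)

fun supports :: "module_table \<Rightarrow> coeffs \<Rightarrow> bool"
  where "supports M (t1, t2, t3) \<longleftrightarrow>
    relation_holds M t1 [GenY, GenZ] [GenZ, GenY] [GenX, GenX] \<and>
    relation_holds M t2 [GenZ, GenX] [GenX, GenZ] [GenY, GenY] \<and>
    relation_holds M t3 [GenX, GenY] [GenY, GenX] [GenZ, GenZ]"

definition reaches :: "module_table \<Rightarrow> gen list list \<Rightarrow> bool"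
  where "reaches M ws \<longleftrightarrow> list_all (\<lambda>w. length (run M w 0) = 1) ws \<and>
    distinct (map (\<lambda>w. hd (run M w 0)) ws)"

lemma dual_family_table:
  assumes two: "(2 :: 'k::field) = 0" and supp: "supports M b"
    and reach: "reaches M ws" and len: "\<forall>w\<in>set ws. length w = n"
  shows "dual_family (params_of b :: 'k params) n (length ws)"
  unfolding dual_family_def
proof (intro exI[of _ "\<lambda>i. coordinate M (hd (run M (ws ! i) 0)) 0"] exI[of _ "(!) ws"] conjI allI
  impI)
  fix i assume i: "i < length ws"
  obtain p1 q1 r1 p2 q2 r2 p3 q3 r3 where b: "b = ((p1, q1, r1), (p2, q2, r2), (p3, q3, r3))"
    by (cases b) auto
  show "annihilates (params_of b :: 'k params) (coordinate M (hd (run M (ws ! i) 0)) 0)"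
    using supp unfolding b params_of.simps annihilates.simps supports.simps
    by (intro allI conjI relation_holds_coordinate[OF two]) simp_all
  show "length (ws ! i) = n" using i len by simp
  fix j assume j: "j < length ws"
  have "length (run M (ws ! j) 0) = 1"
    using reach j by (simp add: reaches_def list_all_length)
  then obtain k where k: "run M (ws ! j) 0 = [k]"
    by (auto simp: length_Suc_conv)
  have "hd (run M (ws ! i) 0) = hd (run M (ws ! j) 0) \<longleftrightarrow> i = j"
    using reach i j unfolding reaches_def distinct_conv_nth by fastforce
  then show "coordinate M (hd (run M (ws ! i) 0)) 0 (ws ! j) = (if i = j then 1 else (0 :: 'k))"
    by (auto simp: coordinate_def k)
qed

text \<open>Three transformations of the parameters that preserve dimensions: the cyclic permutation
  of the variables, the passage to the opposite algebra, and the exchange of y and z combined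
  with the passage to the opposite algebra. On functionals they act by renaming letters and
  reversing words.\<close>

fun rotate_params :: "coeffs \<Rightarrow> coeffs"
  where "rotate_params (t1, t2, t3) = (t2, t3, t1)"

fun opposite_params :: "coeffs \<Rightarrow> coeffs"
  where "opposite_params ((p1, q1, r1), (p2, q2, r2), (p3, q3, r3)) = ((q1, p1, r1), (q2, p2, r2),
    (q3, p3, r3))"

fun flip_params :: "coeffs \<Rightarrow> coeffs"
  where "flip_params (t1, t2, t3) = (t1, t3, t2)"

fun cycle_gen :: "gen \<Rightarrow> gen"
  where "cycle_gen GenX = GenZ" | "cycle_gen GenY = GenX" | "cycle_gen GenZ = GenY"

fun flip_gen :: "gen \<Rightarrow> gen"
  where "flip_gen GenX = GenX" | "flip_gen GenY = GenZ" | "flip_gen GenZ = GenY"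

lemma dual_family_transport:
  assumes fam: "dual_family \<xi> n m"
    and ann: "\<And>F. annihilates \<xi> F \<Longrightarrow> annihilates \<xi>' (\<lambda>w. F (\<sigma> w))"
    and inv: "\<And>w. \<sigma> (\<tau> w) = w" and len: "\<And>w. length (\<tau> w) = length w"
  shows "dual_family \<xi>' n m"
proof -
  obtain F w where F: "\<And>i. i < m \<Longrightarrow> annihilates \<xi> (F i) \<and> length (w i) = n"
    "\<And>i j. i < m \<Longrightarrow> j < m \<Longrightarrow> F i (w j) = (if i = j then 1 else 0)"
    using fam unfolding dual_family_def by blast
  then show ?thesis
    unfolding dual_family_def
    by (intro exI[of _ "\<lambda>i w. F i (\<sigma> w)"] exI[of _ "\<lambda>i. \<tau> (w i)"]) (simp add: ann inv len)
qed

lemma dual_family_rotate: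
  assumes "dual_family (params_of (rotate_params b) :: 'k::field params) n m"
  shows "dual_family (params_of b :: 'k params) n m"
  using assms
proof (rule dual_family_transport[where \<sigma> = "map cycle_gen" and \<tau> = "map (cycle_gen \<circ> cycle_gen)"])
  fix F :: "gen list \<Rightarrow> 'k" assume F: "annihilates (params_of (rotate_params b)) F"
  obtain p1 q1 r1 p2 q2 r2 p3 q3 r3 where b: "b = ((p1, q1, r1), (p2, q2, r2), (p3, q3, r3))"
    by (cases b) auto
  show "annihilates (params_of b) (\<lambda>w. F (map cycle_gen w))"
    using F by (simp add: b)
next
  have "cycle_gen (cycle_gen (cycle_gen g)) = g" for g by (cases g) auto
  then show "map cycle_gen (map (cycle_gen \<circ> cycle_gen) w) = w" for w
    by (simp add: comp_def)
qed simp

lemma dual_family_opposite: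
  assumes "dual_family (params_of (opposite_params b) :: 'k::field params) n m"
  shows "dual_family (params_of b :: 'k params) n m"
  using assms
proof (rule dual_family_transport[where \<sigma> = "rev" and \<tau> = "rev"])
  fix F :: "gen list \<Rightarrow> 'k" assume F: "annihilates (params_of (opposite_params b)) F"
  obtain p1 q1 r1 p2 q2 r2 p3 q3 r3 where b: "b = ((p1, q1, r1), (p2, q2, r2), (p3, q3, r3))"
    by (cases b) auto
  show "annihilates (params_of b) (\<lambda>w. F (rev w))"
    using F by (simp add: b add.commute)
qed simp_all

lemma dual_family_flip:
  assumes "dual_family (params_of (flip_params b) :: 'k::field params) n m"
  shows "dual_family (params_of b :: 'k params) n m"
  using assms
proof (rule dual_family_transport[where \<sigma> = "\<lambda>w. rev (map flip_gen w)" and \<tau> = "\<lambda>w. rev (map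
  flip_gen w)"])
  fix F :: "gen list \<Rightarrow> 'k" assume F: "annihilates (params_of (flip_params b)) F"
  obtain p1 q1 r1 p2 q2 r2 p3 q3 r3 where b: "b = ((p1, q1, r1), (p2, q2, r2), (p3, q3, r3))"
    by (cases b) auto
  show "annihilates (params_of b) (\<lambda>w. F (rev (map flip_gen w)))"
    using F by (simp add: b)
next
  have "flip_gen (flip_gen g) = g" for g by (cases g) auto
  then show "rev (map flip_gen (rev (map flip_gen w))) = w" for w
    by (simp add: rev_map comp_def)
qed simp

text \<open>For each module of the list below, the coefficient triples for which it satisfies the
  first, second and third relation. The modules are quotients of the regular right modules of
  algebras with up to three relations of each shape, cut off after degree 6 and reduced to
  dimension 5 in degree 5 and dimension 1 in degree 6.\<close>

definition patterns :: "((nat \<times> nat \<times> nat) list \<times> (nat \<times> nat \<times> nat) list \<times> (nat \<times> nat \<times> nat) list)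
  list"
  where "patterns = [
   ([(0, 0, 0), (0, 0, 1), (0, 1, 0), (0, 1, 1)],
    [(0, 0, 0), (0, 1, 0), (1, 0, 0), (1, 1, 0)],
    [(0, 0, 0), (0, 1, 1)]),
   ([(0, 0, 0), (0, 0, 1), (0, 1, 0), (0, 1, 1)],
    [(0, 0, 0), (0, 1, 0), (1, 0, 0), (1, 1, 0)],
    [(0, 0, 0), (0, 1, 0), (1, 0, 0), (1, 1, 0)]),
   ([(0, 0, 0), (0, 0, 1)],
    [(0, 0, 0), (0, 1, 0), (1, 0, 1), (1, 1, 1)],
    [(0, 0, 0), (1, 0, 1)]),
   ([(0, 0, 0), (0, 0, 1)],
    [(0, 0, 0), (0, 0, 1), (0, 1, 0), (0, 1, 1)],
    [(0, 0, 0), (0, 0, 1), (0, 1, 0), (0, 1, 1)]),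
   ([(0, 0, 0), (0, 0, 1), (1, 1, 0), (1, 1, 1)],
    [(0, 0, 0), (0, 1, 0), (1, 0, 0), (1, 1, 0)],
    [(0, 0, 0), (0, 1, 0), (1, 0, 0), (1, 1, 0)]),
   ([(0, 0, 0), (0, 0, 1)],
    [(0, 0, 0), (0, 0, 1), (0, 1, 0), (0, 1, 1), (1, 0, 0), (1, 0, 1), (1, 1, 0), (1, 1, 1)],
    [(0, 0, 0), (0, 1, 0), (1, 0, 0), (1, 1, 0)]),
   ([(0, 0, 0), (0, 0, 1)],
    [(0, 0, 0), (0, 0, 1), (0, 1, 0), (0, 1, 1)],
    [(0, 0, 0), (1, 0, 1)]),
   ([(0, 0, 0), (0, 1, 0), (1, 0, 0), (1, 1, 0)],
    [(0, 0, 0), (0, 1, 1)],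
    [(0, 0, 0), (1, 1, 1)]),
   ([(0, 0, 0), (0, 1, 0), (1, 0, 0), (1, 1, 0)],
    [(0, 0, 0), (0, 1, 1)],
    [(0, 0, 0), (1, 0, 1)]),
   ([(0, 0, 0), (0, 1, 0), (1, 0, 0), (1, 1, 0)],
    [(0, 0, 0), (1, 1, 1)],
    [(0, 0, 0), (1, 1, 1)]),
   ([(0, 0, 0), (0, 1, 1)],
    [(0, 0, 0), (0, 1, 1)],
    [(0, 0, 0), (1, 0, 1)]),
   ([(0, 0, 0), (0, 0, 1)],
    [(0, 0, 0), (0, 0, 1), (1, 1, 0), (1, 1, 1)],
    [(0, 0, 0), (1, 1, 1)]),
   ([(0, 0, 0), (0, 0, 1), (1, 1, 0), (1, 1, 1)],
    [(0, 0, 0), (1, 1, 1)],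
    [(0, 0, 0), (1, 1, 1)]),
   ([(0, 0, 0), (0, 1, 1), (1, 0, 1), (1, 1, 0)],
    [(0, 0, 0), (1, 1, 1)],
    [(0, 0, 0), (1, 1, 1)]),
   ([(0, 0, 0), (0, 1, 1)],
    [(0, 0, 0), (1, 0, 1)],
    [(0, 0, 0), (1, 1, 1)]),
   ([(0, 0, 0), (0, 1, 1)],
    [(0, 0, 0), (0, 1, 1)],
    [(0, 0, 0), (1, 1, 1)]),
   ([(0, 0, 0), (0, 1, 1)],
    [(0, 0, 0), (0, 1, 1)],
    [(0, 0, 0), (0, 1, 1)])]"

text \<open>Each module is generated by the basis vector 0. It comes with five words of length 5 and
  one word of length 6 that send this generator to different basis vectors.\<close>

definition modules :: "(module_table \<times> gen list list) list"
  where "modules = [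
   ([([1], [2], []), ([], [3], []), ([], [4], []), ([], [5], []), ([], [6], []), ([], [7], [8]),
     ([], [9], []), ([10], [11], [12]), ([], [], [10]), ([], [13], [14]), ([], [], []),
     ([15], [15], [15]), ([], [], [15]), ([], [15], [15]), ([], [], [])],
    [[GenX, GenY, GenY, GenY, GenX], [GenX, GenY, GenY, GenY, GenY],
     [GenX, GenY, GenY, GenY, GenZ], [GenY, GenY, GenY, GenY, GenY],
     [GenY, GenY, GenY, GenY, GenZ], [GenX, GenY, GenY, GenY, GenY, GenX]]),
   ([([], [1], []), ([], [2], [3]), ([], [4], [5]), ([], [], [6]), ([], [7], [8]),
     ([], [], [9]), ([], [], [10]), ([], [11], [12]), ([], [], [13]), ([], [], [14]),
     ([], [], [15]), ([], [16], []), ([], [], []), ([], [], []), ([], [], []), ([], [], [])],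
    [[GenY, GenY, GenY, GenY, GenY], [GenY, GenY, GenY, GenY, GenZ],
     [GenY, GenY, GenY, GenZ, GenZ], [GenY, GenY, GenZ, GenZ, GenZ],
     [GenY, GenZ, GenZ, GenZ, GenZ], [GenY, GenY, GenY, GenY, GenY, GenY]]),
   ([([], [1], [2]), ([], [], [3]), ([], [4], []), ([], [5], []), ([6], [], [7]),
     ([8], [], [9]), ([], [10], []), ([], [11], [10]), ([], [12], []), ([], [13], [12]),
     ([14], [], []), ([15], [14], [16]), ([17], [], []), ([17], [17], []), ([], [], []),
     ([], [], []), ([], [17], [])],
    [[GenY, GenZ, GenY, GenX, GenY], [GenY, GenZ, GenY, GenZ, GenY],
     [GenZ, GenY, GenX, GenY, GenX], [GenZ, GenY, GenZ, GenY, GenX],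
     [GenZ, GenY, GenZ, GenY, GenZ], [GenY, GenZ, GenY, GenX, GenY, GenX]]),
   ([([1], [2], [3]), ([], [4], []), ([], [], [5]), ([6], [], []), ([], [], [7]), ([], [8], []),
     ([], [9], []), ([10], [11], []), ([], [], [12]), ([], [], [13]), ([], [14], []),
     ([], [], [15]), ([16], [17], []), ([18], [14, 18], []), ([], [], [19]), ([19], [19], []),
     ([], [19], []), ([], [], [19]), ([], [], [])],
    [[GenX, GenY, GenZ, GenX, GenY], [GenX, GenY, GenZ, GenY, GenZ],
     [GenY, GenZ, GenY, GenZ, GenX], [GenY, GenZ, GenY, GenZ, GenY],
     [GenZ, GenX, GenY, GenZ, GenX], [GenX, GenY, GenZ, GenX, GenY, GenZ]]),
   ([([], [1], [2]), ([], [3], [4]), ([], [4], [5]), ([], [6], [7]), ([], [7], [8]),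
     ([], [8], [9]), ([], [10], [11]), ([], [11], [12]), ([], [12], [13]), ([], [13], [14]),
     ([], [15], [15]), ([], [15], [16]), ([], [16], [17]), ([], [17], [18]), ([], [18], [19]),
     ([], [20], [20]), ([], [20], []), ([], [], []), ([], [], []), ([], [], [20])],
    [[GenY, GenY, GenY, GenY, GenY], [GenY, GenY, GenY, GenZ, GenZ],
     [GenY, GenY, GenZ, GenZ, GenZ], [GenY, GenZ, GenZ, GenZ, GenZ],
     [GenZ, GenZ, GenZ, GenZ, GenZ], [GenY, GenY, GenY, GenY, GenY, GenY]]),
   ([([], [1], [2]), ([], [], [3]), ([], [4], [5]), ([], [6], [7]), ([], [], [8]),
     ([], [9], [10]), ([], [], [11]), ([], [12], [13]), ([], [11, 12, 13], [14]),
     ([], [], [14]), ([], [12], [15]), ([], [16], [17]), ([], [], [18]), ([], [16], [19]),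
     ([], [20], [18, 20]), ([], [16, 18, 19], [17, 18, 19]), ([], [], [21]), ([], [21], [21]),
     ([], [21], [21]), ([], [21], [21]), ([], [], [21])],
    [[GenY, GenZ, GenY, GenZ, GenY], [GenY, GenZ, GenY, GenZ, GenZ],
     [GenY, GenZ, GenZ, GenY, GenZ], [GenY, GenZ, GenZ, GenZ, GenZ],
     [GenZ, GenY, GenZ, GenZ, GenY], [GenY, GenZ, GenY, GenZ, GenY, GenZ]]),
   ([([], [1], [2]), ([3], [], [4]), ([], [5], []), ([], [6], []), ([7], [8], [6]),
     ([9], [], [10]), ([11], [], [12]), ([], [12], []), ([13], [], [14]), ([], [15], []),
     ([13], [16], [15]), ([], [17], []), ([18], [], [17]), ([], [19], []), ([20], [21], [19]),
     ([20], [], [19]), ([17, 19, 21], [], [18]), ([22], [], [22]), ([], [22], []),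
     ([22], [], []), ([], [], []), ([], [], [22])],
    [[GenY, GenX, GenY, GenX, GenY], [GenY, GenX, GenY, GenZ, GenX],
     [GenY, GenZ, GenY, GenX, GenY], [GenY, GenZ, GenY, GenZ, GenX],
     [GenY, GenZ, GenY, GenZ, GenY], [GenY, GenX, GenY, GenX, GenY, GenX]]),
   ([([1], [2], [3]), ([4], [5], [6]), ([7], [6], []), ([8], [], [5, 7]), ([9], [10], [11]),
     ([10], [11], []), ([11], [], []), ([12], [11], []), ([13], [], []), ([14], [15], [16]),
     ([15], [16], []), ([16], [], []), ([17], [16], []), ([18], [], []), ([19], [20], [21]),
     ([20], [21], []), ([21], [], []), ([22], [21], []), ([23], [], []), ([24], [], [24]),
     ([], [24], []), ([24], [], []), ([24], [24], []), ([], [], [])],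
    [[GenX, GenX, GenX, GenX, GenX], [GenX, GenX, GenX, GenX, GenY],
     [GenX, GenX, GenX, GenX, GenZ], [GenY, GenX, GenX, GenX, GenX],
     [GenZ, GenX, GenX, GenX, GenX], [GenX, GenX, GenX, GenX, GenX, GenX]]),
   ([([1], [2], [3]), ([4], [5], [6]), ([7], [6], []), ([8], [], [5]), ([9], [], []),
     ([10], [], []), ([11], [], []), ([12], [], []), ([13], [], []), ([14], [], []),
     ([15], [], []), ([16], [], []), ([17], [], []), ([18], [], []), ([19], [], []),
     ([20], [], []), ([21], [], []), ([22], [], []), ([23], [], []), ([24], [], []),
     ([], [], []), ([], [], []), ([24], [], []), ([24], [], [])],
    [[GenX, GenX, GenX, GenX, GenX], [GenX, GenY, GenX, GenX, GenX],
     [GenX, GenZ, GenX, GenX, GenX], [GenY, GenX, GenX, GenX, GenX],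
     [GenZ, GenX, GenX, GenX, GenX], [GenX, GenX, GenX, GenX, GenX, GenX]]),
   ([([1], [2], [3]), ([4], [5], [6]), ([7], [8], []), ([6, 8], [], [5, 7]), ([9], [10], [11]),
     ([12], [13], []), ([11, 13], [], [10, 12]), ([10], [13], []), ([13], [], []),
     ([14], [15], [16]), ([17], [18], []), ([16, 18], [], [15, 17]), ([15], [18], []),
     ([18], [], []), ([19], [20], [21]), ([22], [23], []), ([21, 23], [], [20, 22]),
     ([20], [23], []), ([23], [], []), ([24], [24], []), ([], [], []), ([], [], [24]),
     ([24], [], []), ([], [], [])],
    [[GenX, GenX, GenX, GenX, GenX], [GenX, GenX, GenX, GenX, GenY],
     [GenX, GenX, GenX, GenX, GenZ], [GenX, GenX, GenX, GenY, GenX],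
     [GenX, GenX, GenX, GenY, GenY], [GenX, GenX, GenX, GenX, GenX, GenX]]),
   ([([1], [2], [3]), ([4], [5], [6]), ([7], [6], [8]), ([6], [4], [5]), ([9], [10], [11]),
     ([10], [11], [9]), ([11], [9], [10]), ([10], [12], [9]), ([13], [10], [12]),
     ([14], [15], [16]), ([15], [16], [14]), ([16], [14], [15]), ([17], [14], [18]),
     ([14], [18], [16]), ([19], [20], [21]), ([20], [21], [19]), ([21], [19], [20]),
     ([21], [22], [20]), ([23], [21], [22]), ([24], [24], []), ([24], [], [24]),
     ([], [24], [24]), ([], [24], []), ([24], [], [24])],
    [[GenX, GenX, GenX, GenX, GenX], [GenX, GenX, GenX, GenX, GenY],
     [GenX, GenX, GenX, GenX, GenZ], [GenY, GenX, GenY, GenX, GenY],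
     [GenY, GenX, GenY, GenZ, GenX], [GenX, GenX, GenX, GenX, GenX, GenX]]),
   ([([1], [2], [3]), ([], [4], [5]), ([5], [], [6]), ([5], [7], [4, 5]), ([8], [], [9]),
     ([], [10], [8]), ([8], [11], [10]), ([8, 9, 10], [], [12]), ([], [13], [14]),
     ([14], [15], [13]), ([14], [], [16]), ([13, 16], [], [17]), ([13, 14, 16], [18], [13, 15]),
     ([19], [], [20]), ([], [21], [19]), ([20, 21], [], [22]), ([19], [23], [21]),
     ([20, 21], [19, 20, 22, 23], [23]), ([20, 21, 22, 23], [], [19, 20, 21, 22, 23]),
     ([], [24], [24]), ([24], [], [24]), ([24], [], []), ([24], [24], []), ([24], [], [24])],
    [[GenX, GenY, GenX, GenY, GenX], [GenX, GenY, GenX, GenY, GenZ],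
     [GenX, GenY, GenX, GenZ, GenY], [GenX, GenY, GenZ, GenY, GenZ],
     [GenX, GenZ, GenY, GenZ, GenY], [GenX, GenY, GenX, GenY, GenX, GenY]]),
   ([([1], [2], [3]), ([], [4], [5]), ([6], [5, 6], [7]), ([6], [7], [4, 6]), ([8], [9], [10]),
     ([9], [10], [8]), ([], [11], [12]), ([10, 11, 12], [8, 12], [9, 11]), ([], [13], [14]),
     ([], [15], [16]), ([14, 15], [16], [13]), ([17], [14, 15, 17], [18]),
     ([14, 15, 17], [18], [17]), ([19], [20], [21]), ([20], [21], [19]), ([20], [22], [23]),
     ([22], [23], [20]), ([], [21], [19, 20, 23]), ([19, 20, 22, 23], [20], [21]), ([], [], []),
     ([], [24], []), ([24], [], []), ([], [], [24]), ([], [24], [24])],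
    [[GenX, GenY, GenX, GenY, GenX], [GenX, GenY, GenX, GenY, GenY],
     [GenX, GenY, GenX, GenY, GenZ], [GenX, GenY, GenY, GenY, GenY],
     [GenX, GenY, GenY, GenY, GenZ], [GenX, GenY, GenX, GenY, GenY, GenY]]),
   ([([1], [2], [3]), ([4], [5], [6]), ([7], [8], [4]), ([6, 8], [4], [5, 7]),
     ([9], [10], [11]), ([12], [13], [9]), ([11, 13], [9], [10, 12]), ([10], [11, 13], [14]),
     ([13], [9, 14], [10]), ([15], [16], [17]), ([18], [19], [15]), ([17, 19], [15], [16, 18]),
     ([16], [17, 19], [20]), ([19], [15, 20], [16]), ([15, 20], [18], [17, 19]),
     ([21], [22], [23]), ([21, 23], [24], [21]), ([23, 24], [21], [21, 22, 23]),
     ([22], [23, 24], [25]), ([24], [21, 25], [22]), ([21, 25], [21, 23], [23, 24]),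
     ([], [26], [26]), ([], [], []), ([26], [], [26]), ([], [], [26]), ([], [], [26])],
    [[GenX, GenX, GenX, GenX, GenX], [GenX, GenX, GenX, GenX, GenY],
     [GenX, GenX, GenX, GenX, GenZ], [GenX, GenX, GenX, GenY, GenY],
     [GenX, GenX, GenY, GenX, GenZ], [GenX, GenX, GenX, GenX, GenX, GenY]]),
   ([([1], [2], [3]), ([4], [5], [6]), ([7], [8], [9]), ([8], [4], [5, 7]), ([10], [11], [12]),
     ([13], [14], [15]), ([14], [10], [11, 13]), ([11, 13], [12], [10]), ([12, 14], [15], [13]),
     ([15], [11, 13], [14]), ([16], [17], [18]), ([19], [20], [21]), ([20], [16], [17, 19]),
     ([17, 19], [18], [16]), ([18, 20], [21], [19]), ([21], [17, 19], [20]), ([22], [23], [24]),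
     ([25], [26], [22, 23, 25, 26]), ([26], [22], [23, 25]), ([23, 25], [24], [22]),
     ([24, 26], [22, 23, 25, 26], [25]), ([22, 23, 25, 26], [23, 25], [26]), ([], [], [27]),
     ([], [], [27]), ([], [], []), ([], [27], []), ([27], [27], [])],
    [[GenX, GenX, GenX, GenX, GenX], [GenX, GenX, GenX, GenX, GenY],
     [GenX, GenX, GenX, GenX, GenZ], [GenX, GenX, GenX, GenY, GenX],
     [GenX, GenX, GenX, GenY, GenY], [GenX, GenX, GenX, GenX, GenX, GenZ]]),
   ([([1], [2], [3]), ([4], [5], [6]), ([7], [6], [8]), ([9], [4], [5, 7]), ([10], [11], [12]),
     ([13], [12], [14]), ([15], [10], [11, 13]), ([16], [17], [10]), ([18], [16], [15, 17]),
     ([12, 17], [14], [11]), ([19], [20], [21]), ([22], [21], [23]), ([24], [19], [20, 22]),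
     ([25], [26], [19]), ([27], [25], [24, 26]), ([21, 26], [23], [20]),
     ([20], [24], [19, 23, 27]), ([21, 24], [19, 23, 27], [20, 22, 25]),
     ([19, 27], [20, 22, 25], [24]), ([], [28], []), ([29], [], [30]), ([31], [], [28, 29]),
     ([32], [], []), ([30], [32], [31]), ([], [30], [28]), ([28], [31], []),
     ([31], [], [28, 29, 32]), ([30], [28, 29, 32], [31]), ([], [], [33]), ([], [], []),
     ([33], [], []), ([], [33], []), ([], [], [])],
    [[GenX, GenX, GenX, GenX, GenY], [GenX, GenX, GenX, GenY, GenX],
     [GenX, GenX, GenX, GenY, GenZ], [GenX, GenX, GenX, GenZ, GenX],
     [GenX, GenX, GenY, GenX, GenX], [GenX, GenX, GenX, GenX, GenY, GenZ]]),
   ([([1], [2], [3]), ([4], [5], [6]), ([7], [6], [8]), ([9], [4], [7]), ([10], [11], [12]),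
     ([13], [12], [14]), ([15], [10], [13]), ([16], [17], [10]), ([18], [16], [15]),
     ([17], [19], [11]), ([20], [21], [22]), ([20, 21, 22], [22], [23]),
     ([24], [20], [20, 21, 22]), ([25], [26], [20]), ([23, 26], [25], [24]), ([26], [27], [21]),
     ([21], [20, 22, 26, 27], [28]), ([22], [28], [29]),
     ([27], [20, 21, 22, 23, 25, 28], [20, 22, 26, 27]),
     ([23], [29], [22, 23, 24, 25, 26, 27, 28, 29]), ([30], [31], [32]),
     ([33], [32], [30, 32, 33]), ([30], [30], [33]), ([34], [33], [30]),
     ([30, 31, 32], [32, 34], [31]), ([31], [31, 33], [30, 32]), ([32], [30, 32], [30, 31, 33]),
     ([30, 32, 33], [30, 31, 33], [30, 32, 33]), ([34], [33], [30, 33]), ([30, 34], [30], [34]),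
     ([], [35], [35]), ([35], [35], [35]), ([], [], [35]), ([35], [], []), ([35], [35], [])],
    [[GenX, GenX, GenX, GenX, GenX], [GenX, GenX, GenX, GenX, GenY],
     [GenX, GenX, GenX, GenX, GenZ], [GenX, GenX, GenX, GenY, GenX],
     [GenX, GenX, GenY, GenZ, GenX], [GenX, GenX, GenX, GenX, GenX, GenY]])]"

fun valid :: "(nat \<times> nat \<times> nat) list \<times> (nat \<times> nat \<times> nat) list \<times> (nat \<times> nat \<times> nat) list \<Rightarrow>
    module_table \<times> gen list list \<Rightarrow> bool"
  where "valid (S1, S2, S3) (M, ws) \<longleftrightarrow>
    list_all (\<lambda>t. relation_holds M t [GenY, GenZ] [GenZ, GenY] [GenX, GenX]) S1 \<and>
    list_all (\<lambda>t. relation_holds M t [GenZ, GenX] [GenX, GenZ] [GenY, GenY]) S2 \<and>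
    list_all (\<lambda>t. relation_holds M t [GenX, GenY] [GenY, GenX] [GenZ, GenZ]) S3 \<and>
    map length ws = [5, 5, 5, 5, 5, 6] \<and> reaches M (take 5 ws) \<and> reaches M (drop 5 ws)"

text \<open>All compositions of the three transformations; together they form a group of order 12.\<close>

definition symmetries :: "(coeffs \<Rightarrow> coeffs) list"
  where "symmetries = [f \<circ> g \<circ> h. f \<leftarrow> [id, rotate_params, rotate_params \<circ> rotate_params],
    g \<leftarrow> [id, opposite_params], h \<leftarrow> [id, flip_params]]"

definition certified :: "coeffs \<Rightarrow> bool"
  where "certified b \<longleftrightarrow> list_ex (\<lambda>f. case f b of (t1, t2, t3) \<Rightarrow>
    list_ex (\<lambda>(S1, S2, S3). t1 \<in> set S1 \<and> t2 \<in> set S2 \<and> t3 \<in> set S3) patterns) symmetries"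

definition bit_triples :: "(nat \<times> nat \<times> nat) list"
  where "bit_triples = [(p, q, r). p \<leftarrow> [0, 1], q \<leftarrow> [0, 1], r \<leftarrow> [0, 1]]"

lemma all_valid: "list_all2 valid patterns modules"
  by code_simp

text \<open>Up to symmetry, every algebra over the field with two elements acts on one of the modules.\<close>

lemma all_certified:
  "list_all (\<lambda>t1. list_all (\<lambda>t2. list_all (\<lambda>t3. certified (t1, t2, t3)) bit_triples) bit_triples)
    bit_triples"
  by code_simp

lemma symmetries_dual_family:
  assumes "f \<in> set symmetries" "dual_family (params_of (f b) :: 'k::field params) n m"
  shows "dual_family (params_of b :: 'k params) n m"
  using assms
  by (auto simp: symmetries_def dest!: dual_family_rotate dual_family_opposite dual_family_flip)

lemma certified_dual_family:
  assumes two: "(2 :: 'k::field) = 0" and cert: "certified b"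
  shows "dual_family (params_of b :: 'k params) 5 5" "dual_family (params_of b :: 'k params) 6 1"
proof -
  obtain f where f: "f \<in> set symmetries"
    "case f b of (t1, t2, t3) \<Rightarrow>
      list_ex (\<lambda>(S1, S2, S3). t1 \<in> set S1 \<and> t2 \<in> set S2 \<and> t3 \<in> set S3) patterns"
    using cert unfolding certified_def list_ex_iff[of _ symmetries] by (elim bexE) (rule that)
  obtain t1 t2 t3 where fb: "f b = (t1, t2, t3)" by (cases "f b")
  obtain P where P: "P \<in> set patterns"
    "case P of (S1, S2, S3) \<Rightarrow> t1 \<in> set S1 \<and> t2 \<in> set S2 \<and> t3 \<in> set S3"
    using f(2) unfolding fb list_ex_iff prod.case by (elim bexE) (rule that)
  obtain S1 S2 S3 where PS: "P = (S1, S2, S3)" by (cases P)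
  have S: "(S1, S2, S3) \<in> set patterns" "t1 \<in> set S1" "t2 \<in> set S2" "t3 \<in> set S3"
    using P by (simp_all add: PS)
  obtain i where i: "i < length patterns" "patterns ! i = (S1, S2, S3)"
    using S(1) unfolding in_set_conv_nth by (elim exE conjE) (rule that)
  obtain M ws where M: "modules ! i = (M, ws)" by (cases "modules ! i")
  have valid: "valid (S1, S2, S3) (M, ws)"
    using list_all2_nthD[OF all_valid i(1)] by (simp add: i(2) M)
  then have supp: "supports M (f b)"
    using S(2-4) by (auto simp: fb list_all_iff)
  have lens: "map length ws = [5, 5, 5, 5, 5, 6]"
    and reach: "reaches M (take 5 ws)" "reaches M (drop 5 ws)"
    using valid by simp_all
  have len: "length ws = 6"
    using arg_cong[OF lens, of length] by simp
  have "map length (take 5 ws) = [5, 5, 5, 5, 5]" "map length (drop 5 ws) = [6]"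
    unfolding take_map[symmetric] drop_map[symmetric] lens by simp_all
  then have "set (map length (take 5 ws)) = {5}" "set (map length (drop 5 ws)) = {6}"
    by simp_all
  then have "\<forall>w\<in>set (take 5 ws). length w = 5" "\<forall>w\<in>set (drop 5 ws). length w = 6"
    unfolding set_map by blast+
  from dual_family_table[OF two supp reach(1) this(1)] dual_family_table[OF two supp reach(2)
    this(2)]
  have "dual_family (params_of (f b) :: 'k params) 5 5" "dual_family (params_of (f b) :: 'k
    params) 6 1"
    by (simp_all add: len)
  then show "dual_family (params_of b :: 'k params) 5 5" "dual_family (params_of b :: 'k params) 6
    1"
    using symmetries_dual_family[OF f(1)] by blast+
qed

lemma two_element_field:
  assumes "CARD('k::field) = 2"
  shows "(UNIV :: 'k set) = {0, 1}" "(2 :: 'k) = 0"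
proof -
  have "finite (UNIV :: 'k set)"
    using assms by (metis card.infinite zero_neq_numeral)
  then show UNIV: "(UNIV :: 'k set) = {0, 1}"
    using assms card_subset_eq[of "UNIV :: 'k set" "{0, 1}"] by simp
  have "1 + 1 \<in> {0, 1 :: 'k}" using UNIV by blast
  then have "(2 :: 'k) = 0 \<or> (2 :: 'k) = 1" by simp
  moreover have "(2 :: 'k) - 1 \<noteq> 0" by simp
  then have "(2 :: 'k) \<noteq> 1" by (metis diff_self)
  ultimately show "(2 :: 'k) = 0" by blast
qed

lemma two_element_field_bounds:
  fixes \<xi> :: "'k::field params"
  assumes card: "CARD('k) = 2"
  shows "5 \<le> sklyanin_dim \<xi> 5" "1 \<le> sklyanin_dim \<xi> 6"
proof -
  define bit where "bit x = (if x = (0 :: 'k) then 0 else 1 :: nat)" for x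
  have bit: "of_nat (bit x) = x" "bit x = 0 \<or> bit x = 1" for x
    using two_element_field(1)[OF card] by (auto simp: bit_def)
  obtain p1 p2 p3 q1 q2 q3 r1 r2 r3 where xi: "\<xi> = (p1, p2, p3, q1, q2, q3, r1, r2, r3)"
    by (cases \<xi>) auto
  define b where "b = ((bit p1, bit q1, bit r1), (bit p2, bit q2, bit r2), (bit p3, bit q3, bit
    r3))"
  have "(bit x, bit y, bit z) \<in> set bit_triples" for x y z
    using bit(2)[of x] bit(2)[of y] bit(2)[of z] by (auto simp: bit_triples_def)
  then have "certified b"
    using all_certified unfolding b_def list_all_iff by blast
  from certified_dual_family[OF two_element_field(2)[OF card] this]
  have "dual_family \<xi> 5 5" "dual_family \<xi> 6 1"
    by (simp_all add: b_def xi bit(1))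
  then show "5 \<le> sklyanin_dim \<xi> 5" "1 \<le> sklyanin_dim \<xi> 6"
    by (auto dest: dual_family_dim)
qed

section \<open>Degrees in which few words survive\<close>

text \<open>By duality, the words in \<open>N\<close> span the degree \<open>n\<close> component. To establish it, relations are
  used as rewriting rules for values of an annihilating functional on words.\<close>

definition determines :: "'k::field params \<Rightarrow> nat \<Rightarrow> gen list set \<Rightarrow> bool"
  where "determines \<xi> n N \<longleftrightarrow> (\<forall>F. annihilates \<xi> F \<longrightarrow> (\<forall>w\<in>N. F w = 0) \<longrightarrow> (\<forall>w. length w = n \<longrightarrow> F w = 0))"

text \<open>Fixing a prefix and a suffix of the argument preserves annihilation, so a rewriting rule
  that is proved for the beginning of words applies at every position.\<close>

lemma annihilates_context:
  assumes "annihilates \<xi> F" shows "annihilates \<xi> (\<lambda>w. F (s @ w @ t))"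
proof -
  obtain p1 p2 p3 q1 q2 q3 r1 r2 r3 where xi: "\<xi> = (p1, p2, p3, q1, q2, q3, r1, r2, r3)"
    by (cases \<xi>) auto
  have "(s @ (u @ w @ v) @ t) = (s @ u) @ w @ (v @ t)" for u w v :: "gen list"
    by simp
  then show ?thesis
    using assms unfolding xi annihilates.simps by presburger
qed

lemma shift1: "annihilates \<xi> F \<Longrightarrow> annihilates \<xi> (\<lambda>w. F (a # w))"
  using annihilates_context[of \<xi> F "[a]" "[]"] by simp

lemmas shift2 = shift1[OF shift1]
lemmas shift3 = shift1[OF shift2]
lemmas shift4 = shift1[OF shift3]
lemmas shift5 = shift1[OF shift4]

lemma shift_right: "annihilates \<xi> F \<Longrightarrow> annihilates \<xi> (\<lambda>w. F (w @ u))"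
  using annihilates_context[of \<xi> F "[]" u] by simp

lemma determines_0: "determines \<xi> 0 {[]}"
  by (simp add: determines_def)

text \<open>Appending a letter to a word of length \<open>n\<close> gives an annihilating functional on words of
  length \<open>n\<close>, so only the words in \<open>N\<close> followed by one letter have to be rewritten.\<close>

lemma determines_Suc:
  assumes det: "determines \<xi> n N" and m: "m = Suc n"
    and step: "\<And>F w g. annihilates \<xi> F \<Longrightarrow> (\<And>w. w \<in> N' \<Longrightarrow> F w = 0) \<Longrightarrow> w \<in> N \<Longrightarrow> F (w @ [g]) = 0"
  shows "determines \<xi> m N'"
  unfolding determines_def m
proof (intro allI impI)
  fix F w assume F: "annihilates \<xi> F" "\<forall>w\<in>N'. F w = 0" "length (w :: gen list) = Suc n"
  then obtain u g where w: "w = u @ [g]" "length u = n"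
    by (cases w rule: rev_cases) auto
  have "annihilates \<xi> (\<lambda>u. F (u @ [g]))"
    using F(1) by (rule shift_right)
  then show "F w = 0"
    using det step[OF F(1)] F(2) w unfolding determines_def by blast
qed

lemma determines_dim: "determines \<xi> n N \<Longrightarrow> finite N \<Longrightarrow> N \<subseteq> words n \<Longrightarrow> sklyanin_dim \<xi> n \<le> card N"
  by (rule sklyanin_dim_le) (auto simp: determines_def)

abbreviation (input) \<x> where "\<x> \<equiv> GenX"
abbreviation (input) \<y> where "\<y> \<equiv> GenY"
abbreviation (input) \<z> where "\<z> \<equiv> GenZ"

section \<open>Algebras that vanish in degree five\<close>

text \<open>The algebra with relations \<open>zy = -xx\<close>, \<open>zx = -yy\<close>, \<open>yx = xy + e zz\<close>. The rules below form
  a noncommutative Groebner basis. Words of one length are compared by the number of letters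
  other than z and then lexicographically with \<open>z < x < y\<close>, so rewriting pushes z to the left
  and replaces x and y by z. Each new rule is obtained from an overlap: a word that contains the
  left sides of two rules is rewritten in two ways.

  Nine words of length 5 are irreducible for the rules of length at most 4. The relations are
  homogeneous for the degrees 0 for z, 1 for x and 2 for y modulo 3, so the linear equations
  between these words split into three blocks of three. The hypotheses on \<open>e\<close> are the factors of
  the three determinants, together with the factor \<open>1 + e\<^sup>2\<close> needed for the rules of length 4.\<close>

lemma generic_family:
  fixes e :: "'k::field"
  assumes nz: "e \<noteq> 0" "(3 :: 'k) \<noteq> 0" "1 + e^2 \<noteq> 0" "3 + e^2 \<noteq> 0" "e^2 - 3 \<noteq> 0"
    "e^3 - e^2 + 3 \<noteq> 0" "e^3 + e^2 - 3 \<noteq> 0"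
  defines "\<xi> \<equiv> (0, 1, 1, 1, 0, -1, 1, 1, e)"
  shows "determines \<xi> 5 {}" "sklyanin_dim \<xi> 2 = 6"
proof -
  obtain t where t: "t * (1 + e^2) = 1"
    using nz(3) by (metis left_inverse)
  \<comment> \<open>The three relations, read as rules for the largest word of each.\<close>
  have xx: "F (\<x> # \<x> # v) = - F (\<z> # \<y> # v)" if F: "annihilates \<xi> F" for F v
    using F[unfolded \<xi>_def annihilates.simps, rule_format, of "[]" v] by (simp add: algebra_simps
      eq_neg_iff_add_eq_0)
  have yy: "F (\<y> # \<y> # v) = - F (\<z> # \<x> # v)" if F: "annihilates \<xi> F" for F v
    using F[unfolded \<xi>_def annihilates.simps, rule_format, of "[]" v] by (simp add: algebra_simps
      eq_neg_iff_add_eq_0)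
  have yx: "F (\<y> # \<x> # v) = F (\<x> # \<y> # v) + e * F (\<z> # \<z> # v)" if F: "annihilates \<xi> F" for F v
    using F[unfolded \<xi>_def annihilates.simps, rule_format, of "[]" v] by (simp add: algebra_simps
      eq_neg_iff_add_eq_0)
  \<comment> \<open>Overlaps of length 3. The method name is qualified because the theory of abstract rings has
    one of the same name.\<close>
  have xzy: "F (\<x> # \<z> # \<y> # v) = F (\<z> # \<x> # \<y> # v) + e * F (\<z> # \<z> # \<z> # v)"
    if F: "annihilates \<xi> F" for F v
    using trans[OF sym[OF xx[OF F, of "\<x> # v"]] xx[OF shift1[OF F]]]
    unfolding xx[OF F] yy[OF F] yx[OF F] xx[OF shift1[OF F]] yy[OF shift1[OF F]] yx[OF shift1[OF F]]
    by Groebner_Basis.algebra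
  have yzx: "F (\<y> # \<z> # \<x> # v) = F (\<z> # \<x> # \<y> # v)" if F: "annihilates \<xi> F" for F v
    using trans[OF sym[OF yy[OF F, of "\<y> # v"]] yy[OF shift1[OF F]]]
    unfolding xx[OF F] yy[OF F] yx[OF F] xx[OF shift1[OF F]] yy[OF shift1[OF F]] yx[OF shift1[OF F]]
    by Groebner_Basis.algebra
  have xzx: "F (\<x> # \<z> # \<x> # v) = e * F (\<y> # \<z> # \<z> # v) + (e - 1) * F (\<z> # \<z> # \<y> # v)"
    if F: "annihilates \<xi> F" for F v
    using trans[OF sym[OF yy[OF F, of "\<x> # v"]] yx[OF shift1[OF F]]]
    unfolding xx[OF F] yy[OF F] yx[OF F] xx[OF shift1[OF F]] yy[OF shift1[OF F]] yx[OF shift1[OF F]]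
    by Groebner_Basis.algebra
  have yzy: "F (\<y> # \<z> # \<y> # v) = - e * F (\<x> # \<z> # \<z> # v) - (1 + e) * F (\<z> # \<z> # \<x> # v)"
    if F: "annihilates \<xi> F" for F v
    using trans[OF sym[OF yx[OF F, of "\<x> # v"]] xx[OF shift1[OF F]]]
    unfolding xx[OF F] yy[OF F] yx[OF F] xx[OF shift1[OF F]] yy[OF shift1[OF F]] yx[OF shift1[OF F]]
    by Groebner_Basis.algebra
  note R3 = xx yy yx xzy yzx xzx yzy
  \<comment> \<open>Overlaps of length 4.\<close>
  have yzzy: "F (\<y> # \<z> # \<z> # \<y> # v) = - e * F (\<z> # \<x> # \<z> # \<z> # v) - F (\<z> # \<z> # \<z> # \<x> # v)"
    if F: "annihilates \<xi> F" for F v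
    using trans[OF sym[OF yx[OF F, of "\<z> # \<x> # v"]] xzx[OF shift1[OF F]]]
    unfolding R3[OF F] R3[OF shift1[OF F]] R3[OF shift2[OF F]] by Groebner_Basis.algebra
  have xzzx: "F (\<x> # \<z> # \<z> # \<x> # v) = e * F (\<z> # \<y> # \<z> # \<z> # v) - F (\<z> # \<z> # \<z> # \<y> # v)"
    if F: "annihilates \<xi> F" for F v
    using trans[OF sym[OF xzy[OF F, of "\<y> # v"]] yy[OF shift2[OF F]]]
    unfolding R3[OF F] R3[OF shift1[OF F]] R3[OF shift2[OF F]] by Groebner_Basis.algebra
  have xzzz: "F (\<x> # \<z> # \<z> # \<z> # v) = (1 + e) * F (\<z> # \<x> # \<z> # \<z> # v) + 3 * F (\<z> # \<z> # \<z> # \<x> # v)"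
    if F: "annihilates \<xi> F" for F v
  proof -
    have "e * F (\<x> # \<z> # \<z> # \<z> # v) = e * ((1 + e) * F (\<z> # \<x> # \<z> # \<z> # v) + 3 * F (\<z> # \<z> # \<z> # \<x>
      # v))"
      using trans[OF sym[OF xx[OF F, of "\<z> # \<y> # v"]] xzy[OF shift1[OF F]]] yzzy[OF F, of v]
      unfolding R3[OF F] R3[OF shift1[OF F]] R3[OF shift2[OF F]] by Groebner_Basis.algebra
    then show ?thesis using nz(1) by simp
  qed
  have yzzz: "F (\<y> # \<z> # \<z> # \<z> # v) = (1 - e) * F (\<z> # \<y> # \<z> # \<z> # v) + 3 * F (\<z> # \<z> # \<z> # \<y> # v)"
    if F: "annihilates \<xi> F" for F v
  proof -
    have "e * F (\<y> # \<z> # \<z> # \<z> # v) = e * ((1 - e) * F (\<z> # \<y> # \<z> # \<z> # v) + 3 * F (\<z> # \<z> # \<z> # \<y>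
      # v))"
      using trans[OF sym[OF yzy[OF F, of "\<x> # v"]] yx[OF shift2[OF F]]] xzzx[OF F, of v]
      unfolding R3[OF F] R3[OF shift1[OF F]] R3[OF shift2[OF F]] by Groebner_Basis.algebra
    then show ?thesis using nz(1) by simp
  qed
  have xzzy: "F (\<x> # \<z> # \<z> # \<y> # v) = t * (1 - 2 * e - e^2) * F (\<z> # \<z> # \<x> # \<y> # v) + t * (e -
    e^2) * F (\<z> # \<z> # \<z> # \<z> # v)"
    if F: "annihilates \<xi> F" for F v
  proof -
    have "(1 + e^2) * F (\<x> # \<z> # \<z> # \<y> # v) = (1 - 2 * e - e^2) * F (\<z> # \<z> # \<x> # \<y> # v) + (e -
      e^2) * F (\<z> # \<z> # \<z> # \<z> # v)"
      using trans[OF sym[OF yzy[OF F, of "\<y> # v"]] yy[OF shift2[OF F]]] trans[OF sym[OF xzx[OF F,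
        of "\<x> # v"]] xx[OF shift2[OF F]]]
      unfolding R3[OF F] R3[OF shift1[OF F]] R3[OF shift2[OF F]] by Groebner_Basis.algebra
    then show ?thesis using t by Groebner_Basis.algebra
  qed
  have yzzx: "F (\<y> # \<z> # \<z> # \<x> # v) = t * (1 + 2 * e - e^2) * F (\<z> # \<z> # \<x> # \<y> # v) + t * (e^2 -
    e^3) * F (\<z> # \<z> # \<z> # \<z> # v)"
    if F: "annihilates \<xi> F" for F v
  proof -
    have "F (\<y> # \<z> # \<z> # \<x> # v) = e * F (\<x> # \<z> # \<z> # \<y> # v) + (1 + e) * F (\<z> # \<z> # \<x> # \<y> # v)"
      using trans[OF sym[OF yzy[OF F, of "\<y> # v"]] yy[OF shift2[OF F]]]
      unfolding R3[OF F] R3[OF shift1[OF F]] R3[OF shift2[OF F]] by Groebner_Basis.algebra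
    then show ?thesis unfolding xzzy[OF F] using t by Groebner_Basis.algebra
  qed
  have xyzz: "F (\<x> # \<y> # \<z> # \<z> # v) = t * (e^2 - 3) * F (\<z> # \<z> # \<x> # \<y> # v) + t * (1 - e)^2 * F (\<z>
    # \<z> # \<z> # \<z> # v)"
    if F: "annihilates \<xi> F" for F v
  proof -
    have "e * F (\<x> # \<y> # \<z> # \<z> # v) = (1 - e) * F (\<x> # \<z> # \<z> # \<y> # v) - F (\<z> # \<z> # \<x> # \<y> # v)"
      using trans[OF sym[OF xx[OF F, of "\<z> # \<x> # v"]] xzx[OF shift1[OF F]]]
      unfolding R3[OF F] R3[OF shift1[OF F]] R3[OF shift2[OF F]] by Groebner_Basis.algebra
    then have "e * F (\<x> # \<y> # \<z> # \<z> # v) = e * (t * (e^2 - 3) * F (\<z> # \<z> # \<x> # \<y> # v) + t * (1 -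
      e)^2 * F (\<z> # \<z> # \<z> # \<z> # v))"
      unfolding xzzy[OF F] using t by Groebner_Basis.algebra
    then show ?thesis using nz(1) by simp
  qed
  note R4 = R3 yzzy xzzz xzzx yzzz xzzy yzzx xyzz
  \<comment> \<open>The block of weight 2; its determinant is, up to sign, the common factor in the proofs of
    the three equations derived from it.\<close>
  have p1: "(e^3 - 3 * e - 3 * e^2 - e^4) * F (\<z> # \<z> # \<y> # \<z> # \<z> # v) - 3 * e * (1 + e) * F (\<z> # \<z>
    # \<z> # \<y> # \<z> # v) + (9 + 3 * e^3) * F (\<z> # \<z> # \<z> # \<z> # \<y> # v) = 0"
    if F: "annihilates \<xi> F" for F v
    using trans[OF sym[OF xx[OF F, of "\<z> # \<z> # \<z> # v"]] xzzz[OF shift1[OF F]]] t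
    unfolding R4[OF F] R4[OF shift1[OF F]] R4[OF shift2[OF F]] R4[OF shift3[OF F]]
    by Groebner_Basis.algebra
  have p2: "(3 * e^2 - e^3 + e^4) * F (\<z> # \<z> # \<y> # \<z> # \<z> # v) + 3 * e^2 * F (\<z> # \<z> # \<z> # \<y> # \<z> #
    v) + (2 * e^2 - 3 - 3 * e - 3 * e^3) * F (\<z> # \<z> # \<z> # \<z> # \<y> # v) = 0"
    if F: "annihilates \<xi> F" for F v
    using trans[OF sym[OF xzy[OF F, of "\<z> # \<y> # v"]] yzy[OF shift2[OF F]]] t
    unfolding R4[OF F] R4[OF shift1[OF F]] R4[OF shift2[OF F]] R4[OF shift3[OF F]]
    by Groebner_Basis.algebra
  have p3: "(3 * e + 3 * e^2 + 4 * e^3) * F (\<z> # \<z> # \<z> # \<z> # \<y> # v) - (3 * e^3 + 2 * e^4 + e^5) *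
    F (\<z> # \<z> # \<y> # \<z> # \<z> # v) = 0"
    if F: "annihilates \<xi> F" for F v
    using trans[OF sym[OF yzy[OF F, of "\<z> # \<x> # v"]] yzx[OF shift2[OF F]]] t
    unfolding R4[OF F] R4[OF shift1[OF F]] R4[OF shift2[OF F]] R4[OF shift3[OF F]]
    by Groebner_Basis.algebra
  have z1: "F (\<z> # \<z> # \<y> # \<z> # \<z> # v) = 0" if F: "annihilates \<xi> F" for F v
  proof -
    have "3 * e^4 * (3 + e^2) * (e^3 - e^2 + 3) * F (\<z> # \<z> # \<y> # \<z> # \<z> # v) = 0"
      using p1[OF F, of v] p2[OF F, of v] p3[OF F, of v] by Groebner_Basis.algebra
    then show ?thesis using nz by simp
  qed
  have z2: "F (\<z> # \<z> # \<z> # \<y> # \<z> # v) = 0" if F: "annihilates \<xi> F" for F v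
  proof -
    have "3 * e^4 * (3 + e^2) * (e^3 - e^2 + 3) * F (\<z> # \<z> # \<z> # \<y> # \<z> # v) = 0"
      using p1[OF F, of v] p2[OF F, of v] p3[OF F, of v] by Groebner_Basis.algebra
    then show ?thesis using nz by simp
  qed
  have z3: "F (\<z> # \<z> # \<z> # \<z> # \<y> # v) = 0" if F: "annihilates \<xi> F" for F v
  proof -
    have "3 * e^4 * (3 + e^2) * (e^3 - e^2 + 3) * F (\<z> # \<z> # \<z> # \<z> # \<y> # v) = 0"
      using p1[OF F, of v] p2[OF F, of v] p3[OF F, of v] by Groebner_Basis.algebra
    then show ?thesis using nz by simp
  qed
  \<comment> \<open>The block of weight 1.\<close>
  have q1: "(3 * e - 3 * e^2 - e^3 - e^4) * F (\<z> # \<z> # \<x> # \<z> # \<z> # v) + 3 * e * (1 - e) * F (\<z> # \<z>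
    # \<z> # \<x> # \<z> # v) + (9 - 3 * e^3) * F (\<z> # \<z> # \<z> # \<z> # \<x> # v) = 0"
    if F: "annihilates \<xi> F" for F v
    using trans[OF sym[OF yy[OF F, of "\<z> # \<z> # \<z> # v"]] yzzz[OF shift1[OF F]]] t
    unfolding R4[OF F] R4[OF shift1[OF F]] R4[OF shift2[OF F]] R4[OF shift3[OF F]]
    by Groebner_Basis.algebra
  have q2: "(3 * e^2 + e^3 + e^4) * F (\<z> # \<z> # \<x> # \<z> # \<z> # v) + 3 * e^2 * F (\<z> # \<z> # \<z> # \<x> # \<z> #
    v) + (3 * e + 2 * e^2 + 3 * e^3 - 3) * F (\<z> # \<z> # \<z> # \<z> # \<x> # v) = 0"
    if F: "annihilates \<xi> F" for F v
    using trans[OF sym[OF yzx[OF F, of "\<z> # \<x> # v"]] xzx[OF shift2[OF F]]] t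
    unfolding R4[OF F] R4[OF shift1[OF F]] R4[OF shift2[OF F]] R4[OF shift3[OF F]]
    by Groebner_Basis.algebra
  have q3: "3 * e^2 * F (\<z> # \<z> # \<x> # \<z> # \<z> # v) + 3 * e * F (\<z> # \<z> # \<z> # \<x> # \<z> # v) + (6 * e + 3 *
    e^2) * F (\<z> # \<z> # \<z> # \<z> # \<x> # v) = 0"
    if F: "annihilates \<xi> F" for F v
    using trans[OF sym[OF xzx[OF F, of "\<z> # \<y> # v"]] xzy[OF shift2[OF F]]] t
    unfolding R4[OF F] R4[OF shift1[OF F]] R4[OF shift2[OF F]] R4[OF shift3[OF F]]
    by Groebner_Basis.algebra
  have z4: "F (\<z> # \<z> # \<x> # \<z> # \<z> # v) = 0" if F: "annihilates \<xi> F" for F v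
  proof -
    have "3 * e^2 * (3 + e^2) * (e^3 + e^2 - 3) * F (\<z> # \<z> # \<x> # \<z> # \<z> # v) = 0"
      using q1[OF F, of v] q2[OF F, of v] q3[OF F, of v] by Groebner_Basis.algebra
    then show ?thesis using nz by simp
  qed
  have z5: "F (\<z> # \<z> # \<z> # \<x> # \<z> # v) = 0" if F: "annihilates \<xi> F" for F v
  proof -
    have "3 * e^2 * (3 + e^2) * (e^3 + e^2 - 3) * F (\<z> # \<z> # \<z> # \<x> # \<z> # v) = 0"
      using q1[OF F, of v] q2[OF F, of v] q3[OF F, of v] by Groebner_Basis.algebra
    then show ?thesis using nz by simp
  qed
  have z6: "F (\<z> # \<z> # \<z> # \<z> # \<x> # v) = 0" if F: "annihilates \<xi> F" for F v
  proof -
    have "3 * e^2 * (3 + e^2) * (e^3 + e^2 - 3) * F (\<z> # \<z> # \<z> # \<z> # \<x> # v) = 0"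
      using q1[OF F, of v] q2[OF F, of v] q3[OF F, of v] by Groebner_Basis.algebra
    then show ?thesis using nz by simp
  qed
  \<comment> \<open>The block of weight 0, which is triangular once \<open>zzzxy\<close> and \<open>zzzzz\<close> are known to vanish.\<close>
  have s1: "(3 + e^2 - 2 * e^3) * F (\<z> # \<z> # \<z> # \<x> # \<y> # v) - (e^3 + e^4) * F (\<z> # \<z> # \<z> # \<z> # \<z> #
    v) = 0"
    if F: "annihilates \<xi> F" for F v
    using trans[OF sym[OF xx[OF F, of "\<z> # \<z> # \<x> # v"]] xzzx[OF shift1[OF F]]] t
    unfolding R4[OF F] R4[OF shift1[OF F]] R4[OF shift2[OF F]] R4[OF shift3[OF F]]
    by Groebner_Basis.algebra
  have s2: "(3 + e^2 + 2 * e^3) * F (\<z> # \<z> # \<z> # \<x> # \<y> # v) + (3 * e + 2 * e^3 + e^4) * F (\<z> # \<z> #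
    \<z> # \<z> # \<z> # v) = 0"
    if F: "annihilates \<xi> F" for F v
    using trans[OF sym[OF yy[OF F, of "\<z> # \<z> # \<y> # v"]] yzzy[OF shift1[OF F]]] t
    unfolding R4[OF F] R4[OF shift1[OF F]] R4[OF shift2[OF F]] R4[OF shift3[OF F]]
    by Groebner_Basis.algebra
  have s3: "(e^2 - 3) * F (\<z> # \<z> # \<x> # \<y> # \<z> # v) + (4 * e^3 - 9 - e^2) * F (\<z> # \<z> # \<z> # \<x> # \<y> #
    v) + (3 * e^3 + e^4 - 3 * e - e^2) * F (\<z> # \<z> # \<z> # \<z> # \<z> # v) = 0"
    if F: "annihilates \<xi> F" for F v
    using trans[OF sym[OF xyzz[OF F, of "\<z> # v"]] yzzz[OF shift1[OF F]]] t
    unfolding R4[OF F] R4[OF shift1[OF F]] R4[OF shift2[OF F]] R4[OF shift3[OF F]]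
    by Groebner_Basis.algebra
  have z7: "F (\<z> # \<z> # \<z> # \<x> # \<y> # v) = 0" if F: "annihilates \<xi> F" for F v
  proof -
    have "3 * e * (3 + e^2) * (1 + e^2) * F (\<z> # \<z> # \<z> # \<x> # \<y> # v) = 0"
      using s1[OF F, of v] s2[OF F, of v] by Groebner_Basis.algebra
    then show ?thesis using nz by simp
  qed
  have z8: "F (\<z> # \<z> # \<z> # \<z> # \<z> # v) = 0" if F: "annihilates \<xi> F" for F v
  proof -
    have "3 * e * (3 + e^2) * (1 + e^2) * F (\<z> # \<z> # \<z> # \<z> # \<z> # v) = 0"
      using s1[OF F, of v] s2[OF F, of v] by Groebner_Basis.algebra
    then show ?thesis using nz by simp
  qed
  have z9: "F (\<z> # \<z> # \<x> # \<y> # \<z> # v) = 0" if F: "annihilates \<xi> F" for F v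
    using s3[OF F, of v] z7[OF F, of v] z8[OF F, of v] nz(5) by simp
  note R = R4 z1 z2 z3 z4 z5 z6 z7 z8 z9
  have N1: "determines \<xi> 1 {[\<x>], [\<y>], [\<z>]}"
  proof (rule determines_Suc[OF determines_0])
    show "1 = Suc 0" by simp
    fix F and w :: "gen list" and g assume F: "annihilates \<xi> F" and N: "\<And>w. w \<in> {[\<x>], [\<y>], [\<z>]} \<Longrightarrow>
      F w = 0"
      and w: "w \<in> {[]}"
    have zeros: "F [\<x>] = 0" "F [\<y>] = 0" "F [\<z>] = 0"
      using N by simp_all
    show "F (w @ [g]) = 0"
      using w by (cases g) (auto simp: zeros R[OF F] )
  qed
  have N2: "determines \<xi> 2 {[\<x>, \<y>], [\<x>, \<z>], [\<y>, \<z>], [\<z>, \<x>], [\<z>, \<y>], [\<z>, \<z>]}"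
  proof (rule determines_Suc[OF N1])
    show "2 = Suc 1" by simp
    fix F and w :: "gen list" and g assume F: "annihilates \<xi> F" and N: "\<And>w. w \<in> {[\<x>, \<y>], [\<x>, \<z>],
      [\<y>, \<z>], [\<z>, \<x>], [\<z>, \<y>], [\<z>, \<z>]} \<Longrightarrow> F w = 0"
      and w: "w \<in> {[\<x>], [\<y>], [\<z>]}"
    have zeros: "F [\<x>, \<y>] = 0" "F [\<x>, \<z>] = 0" "F [\<y>, \<z>] = 0" "F [\<z>, \<x>] = 0" "F [\<z>, \<y>] = 0" "F [\<z>,
      \<z>] = 0"
      using N by simp_all
    show "F (w @ [g]) = 0"
      using w by (cases g) (auto simp: zeros R[OF F] )
  qed
  have N3: "determines \<xi> 3 {[\<x>, \<y>, \<z>], [\<x>, \<z>, \<z>], [\<y>, \<z>, \<z>], [\<z>, \<x>, \<y>], [\<z>, \<x>, \<z>], [\<z>, \<y>, \<z>], [\<z>,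
    \<z>, \<x>], [\<z>, \<z>, \<y>], [\<z>, \<z>, \<z>]}"
  proof (rule determines_Suc[OF N2])
    show "3 = Suc 2" by simp
    fix F and w :: "gen list" and g assume F: "annihilates \<xi> F" and N: "\<And>w. w \<in> {[\<x>, \<y>, \<z>], [\<x>, \<z>,
      \<z>], [\<y>, \<z>, \<z>], [\<z>, \<x>, \<y>], [\<z>, \<x>, \<z>], [\<z>, \<y>, \<z>], [\<z>, \<z>, \<x>], [\<z>, \<z>, \<y>], [\<z>, \<z>, \<z>]} \<Longrightarrow> F w = 0"
      and w: "w \<in> {[\<x>, \<y>], [\<x>, \<z>], [\<y>, \<z>], [\<z>, \<x>], [\<z>, \<y>], [\<z>, \<z>]}"
    have zeros: "F [\<x>, \<y>, \<z>] = 0" "F [\<x>, \<z>, \<z>] = 0" "F [\<y>, \<z>, \<z>] = 0" "F [\<z>, \<x>, \<y>] = 0" "F [\<z>, \<x>,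
      \<z>] = 0" "F [\<z>, \<y>, \<z>] = 0" "F [\<z>, \<z>, \<x>] = 0" "F [\<z>, \<z>, \<y>] = 0" "F [\<z>, \<z>, \<z>] = 0"
      using N by simp_all
    show "F (w @ [g]) = 0"
      using w by (cases g) (auto simp: zeros R[OF F] R[OF shift1[OF F]])
  qed
  have N4: "determines \<xi> 4 {[\<z>, \<x>, \<y>, \<z>], [\<z>, \<x>, \<z>, \<z>], [\<z>, \<y>, \<z>, \<z>], [\<z>, \<z>, \<x>, \<y>], [\<z>, \<z>, \<x>, \<z>],
    [\<z>, \<z>, \<y>, \<z>], [\<z>, \<z>, \<z>, \<x>], [\<z>, \<z>, \<z>, \<y>], [\<z>, \<z>, \<z>, \<z>]}"
  proof (rule determines_Suc[OF N3])
    show "4 = Suc 3" by simp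
    fix F and w :: "gen list" and g assume F: "annihilates \<xi> F" and N: "\<And>w. w \<in> {[\<z>, \<x>, \<y>, \<z>], [\<z>,
      \<x>, \<z>, \<z>], [\<z>, \<y>, \<z>, \<z>], [\<z>, \<z>, \<x>, \<y>], [\<z>, \<z>, \<x>, \<z>], [\<z>, \<z>, \<y>, \<z>], [\<z>, \<z>, \<z>, \<x>], [\<z>, \<z>, \<z>,
        \<y>], [\<z>, \<z>, \<z>, \<z>]} \<Longrightarrow> F w = 0"
      and w: "w \<in> {[\<x>, \<y>, \<z>], [\<x>, \<z>, \<z>], [\<y>, \<z>, \<z>], [\<z>, \<x>, \<y>], [\<z>, \<x>, \<z>], [\<z>, \<y>, \<z>], [\<z>, \<z>, \<x>],
        [\<z>, \<z>, \<y>], [\<z>, \<z>, \<z>]}"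
    have zeros: "F [\<z>, \<x>, \<y>, \<z>] = 0" "F [\<z>, \<x>, \<z>, \<z>] = 0" "F [\<z>, \<y>, \<z>, \<z>] = 0" "F [\<z>, \<z>, \<x>, \<y>] =
      0" "F [\<z>, \<z>, \<x>, \<z>] = 0" "F [\<z>, \<z>, \<y>, \<z>] = 0" "F [\<z>, \<z>, \<z>, \<x>] = 0" "F [\<z>, \<z>, \<z>, \<y>] = 0" "F
        [\<z>, \<z>, \<z>, \<z>] = 0"
      using N by simp_all
    show "F (w @ [g]) = 0"
      using w by (cases g) (auto simp: zeros R[OF F] R[OF shift1[OF F]] R[OF shift2[OF F]])
  qed
  have N5: "determines \<xi> 5 {}"
  proof (rule determines_Suc[OF N4])
    show "5 = Suc 4" by simp
    fix F and w :: "gen list" and g assume F: "annihilates \<xi> F" and N: "\<And>w. w \<in> {} \<Longrightarrow> F w = 0"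
      and w: "w \<in> {[\<z>, \<x>, \<y>, \<z>], [\<z>, \<x>, \<z>, \<z>], [\<z>, \<y>, \<z>, \<z>], [\<z>, \<z>, \<x>, \<y>], [\<z>, \<z>, \<x>, \<z>], [\<z>, \<z>, \<y>,
        \<z>], [\<z>, \<z>, \<z>, \<x>], [\<z>, \<z>, \<z>, \<y>], [\<z>, \<z>, \<z>, \<z>]}"
    show "F (w @ [g]) = 0"
      using w by (cases g) (auto simp: R[OF F] R[OF shift1[OF F]] R[OF shift2[OF F]] R[OF
        shift3[OF F]])
  qed
  show "determines \<xi> 5 {}" by (fact N5)
  have "sklyanin_dim \<xi> 2 \<le> card {[\<x>, \<y>], [\<x>, \<z>], [\<y>, \<z>], [\<z>, \<x>], [\<z>, \<y>], [\<z>, \<z>]}"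
    using N2 by (rule determines_dim) (simp_all add: words_def)
  then show "sklyanin_dim \<xi> 2 = 6"
    using sklyanin_dim_2(1)[of \<xi>] by simp
qed

text \<open>Ordered rewriting that decides equality of sums modulo 3: a negative summand is replaced
  by two positive ones, sorting makes equal summands adjacent, and triples are deleted.\<close>

lemma norm_three:
  assumes "(3 :: 'k::field) = 0"
  shows "- x = x + (x :: 'k)" "x - y = x + (y + (y :: 'k))" "x + (x + x) = (0 :: 'k)" "x + (x + (x
    + y)) = (y :: 'k)"
    "x + y = y + (x :: 'k)" "x + y + z = x + (y + z :: 'k)" "x + (y + z) = y + (x + z :: 'k)"
    "x + 0 = (x :: 'k)" "0 + x = (x :: 'k)"
proof -
  have triple: "x + (x + x) = 0" for x :: 'k
  proof -
    have "x + (x + x) = 3 * x" by simp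
    then show ?thesis by (simp only: assms mult_zero_left)
  qed
  then show "- x = x + x" "x + (x + x) = 0" for x :: 'k
    by (simp_all add: minus_unique)
  then show "x - y = x + (y + y)" for x y :: 'k
    by (metis diff_conv_add_uminus)
  show "x + (x + (x + y)) = y" for x y :: 'k
    using triple[of x] by (metis add.assoc add_0)
qed (simp_all add: add_ac)

text \<open>The analogous rewriting modulo 2.\<close>

lemma norm_two:
  assumes "(2 :: 'k::field) = 0"
  shows "- x = (x :: 'k)" "x - y = x + (y :: 'k)" "x + x = (0 :: 'k)" "x + (x + y) = (y :: 'k)"
    "x + y = y + (x :: 'k)" "x + y + z = x + (y + z :: 'k)" "x + (y + z) = y + (x + z :: 'k)"
    "x + 0 = (x :: 'k)" "0 + x = (x :: 'k)"
proof -
  have double: "x + x = 0" for x :: 'k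
  proof -
    have "x + x = 2 * x" by simp
    then show ?thesis by (simp only: assms mult_zero_left)
  qed
  then show "- x = x" "x + x = 0" for x :: 'k
    by (simp_all add: minus_unique)
  then show "x - y = x + y" for x y :: 'k
    by (metis diff_conv_add_uminus)
  show "x + (x + y) = y" for x y :: 'k
    using double[of x] by (metis add.assoc add_0)
qed (simp_all add: add_ac)

lemma diff_zero: "a = b \<Longrightarrow> a - b = (0 :: 'k::field)"
  by simp

text \<open>In characteristic 3 the determinants of the previous family vanish. The relations \<open>xx =
  -zy\<close>, \<open>xz = -yy - zx\<close>, \<open>xy = yx - zz\<close> serve instead, with the degree-lexicographic order given
  by \<open>z < y < x\<close>. The numbers of new rules in degrees 3, 4 and 5 are 3, 3 and 9.\<close>

lemma char_three_family:
  assumes three: "(3 :: 'k::field) = 0"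
  defines "\<xi> \<equiv> (0, 1, 1, 1, 1, -1, 1, 1, 1) :: 'k params"
  shows "determines \<xi> 5 {}" "sklyanin_dim \<xi> 2 = 6"
proof -
  have xx: "F (\<x> # \<x> # v) = - F (\<z> # \<y> # v)" if F: "annihilates \<xi> F" for F v
  proof -
    have "F (\<x> # \<x> # v) - (- F (\<z> # \<y> # v)) = 0"
      using F[unfolded \<xi>_def annihilates.simps, rule_format, of "[]" v, simplified]
      by (simp only: norm_three[OF three])
    then show ?thesis by (rule iffD2[OF eq_iff_diff_eq_0])
  qed
  have xz: "F (\<x> # \<z> # v) = - F (\<y> # \<y> # v) - F (\<z> # \<x> # v)" if F: "annihilates \<xi> F" for F v
  proof -
    have "F (\<x> # \<z> # v) - (- F (\<y> # \<y> # v) - F (\<z> # \<x> # v)) = 0"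
      using F[unfolded \<xi>_def annihilates.simps, rule_format, of "[]" v, simplified]
      by (simp only: norm_three[OF three])
    then show ?thesis by (rule iffD2[OF eq_iff_diff_eq_0])
  qed
  have xy: "F (\<x> # \<y> # v) = F (\<y> # \<x> # v) - F (\<z> # \<z> # v)" if F: "annihilates \<xi> F" for F v
  proof -
    have "F (\<x> # \<y> # v) - (F (\<y> # \<x> # v) - F (\<z> # \<z> # v)) = 0"
      using F[unfolded \<xi>_def annihilates.simps, rule_format, of "[]" v, simplified]
      by (simp only: norm_three[OF three])
    then show ?thesis by (rule iffD2[OF eq_iff_diff_eq_0])
  qed
  note R2 = xx xz xy
  have yyy: "F (\<y> # \<y> # \<y> # v) = F (\<z> # \<y> # \<x> # v) + F (\<z> # \<z> # \<z> # v)"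
    if F: "annihilates \<xi> F" for F v
  proof -
    note eq = trans[OF sym[OF xx[OF F, of "\<x> # v"]] xx[OF shift1[OF F]]]
    have "F (\<y> # \<y> # \<y> # v) - (F (\<z> # \<y> # \<x> # v) + F (\<z> # \<z> # \<z> # v)) = 0"
      using eq[THEN sym, THEN diff_zero]
      unfolding R2[OF F] R2[OF shift1[OF F]]
      by (simp only: norm_three[OF three])
    then show ?thesis by (rule iffD2[OF eq_iff_diff_eq_0])
  qed
  have yzz: "F (\<y> # \<z> # \<z> # v) = - F (\<z> # \<y> # \<z> # v)" if F: "annihilates \<xi> F" for F v
  proof -
    note eq = trans[OF sym[OF xx[OF F, of "\<z> # v"]] xz[OF shift1[OF F]]]
    have "F (\<y> # \<z> # \<z> # v) - (- F (\<z> # \<y> # \<z> # v)) = 0"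
      using eq[THEN sym, THEN diff_zero]
      unfolding R2[OF F] R2[OF shift1[OF F]] yyy[OF F]
      by (simp only: norm_three[OF three])
    then show ?thesis by (rule iffD2[OF eq_iff_diff_eq_0])
  qed
  have yyz: "F (\<y> # \<y> # \<z> # v) = F (\<y> # \<z> # \<y> # v) - F (\<z> # \<z> # \<x> # v)"
    if F: "annihilates \<xi> F" for F v
  proof -
    note eq = trans[OF sym[OF xx[OF F, of "\<y> # v"]] xy[OF shift1[OF F]]]
    have "F (\<y> # \<y> # \<z> # v) - (F (\<y> # \<z> # \<y> # v) - F (\<z> # \<z> # \<x> # v)) = 0"
      using eq[THEN sym, THEN diff_zero]
      unfolding R2[OF F] R2[OF shift1[OF F]] yyy[OF F] yzz[OF F]
      by (simp only: norm_three[OF three])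
    then show ?thesis by (rule iffD2[OF eq_iff_diff_eq_0])
  qed
  note R3 = R2 yyy yzz yyz
  have yzyx: "F (\<y> # \<z> # \<y> # \<x> # v) = F (\<z> # \<y> # \<y> # \<x> # v) + F (\<z> # \<z> # \<z> # \<y> # v)"
    if F: "annihilates \<xi> F" for F v
  proof -
    note eq = trans[OF sym[OF yyy[OF F, of "\<y> # v"]] yyy[OF shift1[OF F]]]
    have "F (\<y> # \<z> # \<y> # \<x> # v) - (F (\<z> # \<y> # \<y> # \<x> # v) + F (\<z> # \<z> # \<z> # \<y> # v)) = 0"
      using eq[THEN sym, THEN diff_zero]
      unfolding R3[OF F] R3[OF shift1[OF F]] R3[OF shift2[OF F]]
      by (simp only: norm_three[OF three])
    then show ?thesis by (rule iffD2[OF eq_iff_diff_eq_0])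
  qed
  have yzyy: "F (\<y> # \<z> # \<y> # \<y> # v) = F (\<z> # \<y> # \<z> # \<x> # v) - F (\<z> # \<z> # \<z> # \<z> # v)"
    if F: "annihilates \<xi> F" for F v
  proof -
    note eq = trans[OF sym[OF yyy[OF F, of "\<z> # v"]] yyz[OF shift1[OF F]]]
    have "F (\<y> # \<z> # \<y> # \<y> # v) - (F (\<z> # \<y> # \<z> # \<x> # v) - F (\<z> # \<z> # \<z> # \<z> # v)) = 0"
      using eq[THEN sym, THEN diff_zero]
      unfolding R3[OF F] R3[OF shift1[OF F]] R3[OF shift2[OF F]] yzyx[OF F]
      by (simp only: norm_three[OF three])
    then show ?thesis by (rule iffD2[OF eq_iff_diff_eq_0])
  qed
  have yzyz: "F (\<y> # \<z> # \<y> # \<z> # v) = F (\<z> # \<z> # \<y> # \<y> # v) + F (\<z> # \<z> # \<z> # \<x> # v)"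
    if F: "annihilates \<xi> F" for F v
  proof -
    note eq = trans[OF sym[OF yyz[OF F, of "\<z> # v"]] yzz[OF shift1[OF F]]]
    have "F (\<y> # \<z> # \<y> # \<z> # v) - (F (\<z> # \<z> # \<y> # \<y> # v) + F (\<z> # \<z> # \<z> # \<x> # v)) = 0"
      using eq[THEN sym, THEN diff_zero]
      unfolding R3[OF F] R3[OF shift1[OF F]] R3[OF shift2[OF F]] yzyx[OF F] yzyy[OF F]
      by (simp only: norm_three[OF three])
    then show ?thesis by (rule iffD2[OF eq_iff_diff_eq_0])
  qed
  note R4 = R3 yzyx yzyy yzyz
  have zzzzx: "F (\<z> # \<z> # \<z> # \<z> # \<x> # v) = 0" if F: "annihilates \<xi> F" for F v
  proof -
    note eq = trans[OF sym[OF yyz[OF F, of "\<y> # \<x> # v"]] yzyx[OF shift1[OF F]]]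
    have "F (\<z> # \<z> # \<z> # \<z> # \<x> # v) - (0) = 0"
      using eq[THEN diff_zero]
      unfolding R4[OF F] R4[OF shift1[OF F]] R4[OF shift2[OF F]] R4[OF shift3[OF F]]
      by (simp only: norm_three[OF three])
    then show ?thesis by (rule iffD2[OF eq_iff_diff_eq_0])
  qed
  have zzyzx: "F (\<z> # \<z> # \<y> # \<z> # \<x> # v) = F (\<z> # \<z> # \<z> # \<y> # \<x> # v)"
    if F: "annihilates \<xi> F" for F v
  proof -
    note eq = trans[OF sym[OF yzyx[OF F, of "\<x> # v"]] xx[OF shift3[OF F]]]
    have "F (\<z> # \<z> # \<y> # \<z> # \<x> # v) - (F (\<z> # \<z> # \<z> # \<y> # \<x> # v)) = 0"
      using eq[THEN sym, THEN diff_zero]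
      unfolding R4[OF F] R4[OF shift1[OF F]] R4[OF shift2[OF F]] R4[OF shift3[OF F]] zzzzx[OF F]
      by (simp only: norm_three[OF three])
    then show ?thesis by (rule iffD2[OF eq_iff_diff_eq_0])
  qed
  have zzyyx: "F (\<z> # \<z> # \<y> # \<y> # \<x> # v) = F (\<z> # \<z> # \<z> # \<z> # \<y> # v)"
    if F: "annihilates \<xi> F" for F v
  proof -
    note eq = trans[OF sym[OF yzyy[OF F, of "\<y> # v"]] yyy[OF shift2[OF F]]]
    have "F (\<z> # \<z> # \<y> # \<y> # \<x> # v) - (F (\<z> # \<z> # \<z> # \<z> # \<y> # v)) = 0"
      using eq[THEN sym, THEN diff_zero]
      unfolding R4[OF F] R4[OF shift1[OF F]] R4[OF shift2[OF F]] R4[OF shift3[OF F]] zzzzx[OF F]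
        zzyzx[OF F]
      by (simp only: norm_three[OF three])
    then show ?thesis by (rule iffD2[OF eq_iff_diff_eq_0])
  qed
  have zzzyx: "F (\<z> # \<z> # \<z> # \<y> # \<x> # v) = 0" if F: "annihilates \<xi> F" for F v
  proof -
    note eq = trans[OF sym[OF yzyy[OF F, of "\<z> # v"]] yyz[OF shift2[OF F]]]
    have "F (\<z> # \<z> # \<z> # \<y> # \<x> # v) - (0) = 0"
      using eq[THEN sym, THEN diff_zero]
      unfolding R4[OF F] R4[OF shift1[OF F]] R4[OF shift2[OF F]] R4[OF shift3[OF F]] zzzzx[OF F]
        zzyzx[OF F] zzyyx[OF F]
      by (simp only: norm_three[OF three])
    then show ?thesis by (rule iffD2[OF eq_iff_diff_eq_0])
  qed
  have zzyzy: "F (\<z> # \<z> # \<y> # \<z> # \<y> # v) = - F (\<z> # \<z> # \<z> # \<y> # \<y> # v)"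
    if F: "annihilates \<xi> F" for F v
  proof -
    note eq = trans[OF sym[OF yzyz[OF F, of "\<z> # v"]] yzz[OF shift2[OF F]]]
    have "F (\<z> # \<z> # \<y> # \<z> # \<y> # v) - (- F (\<z> # \<z> # \<z> # \<y> # \<y> # v)) = 0"
      using eq[THEN diff_zero]
      unfolding R4[OF F] R4[OF shift1[OF F]] R4[OF shift2[OF F]] R4[OF shift3[OF F]] zzzzx[OF F]
        zzyzx[OF F] zzyyx[OF F] zzzyx[OF F]
      by (simp only: norm_three[OF three])
    then show ?thesis by (rule iffD2[OF eq_iff_diff_eq_0])
  qed
  have zzzyy: "F (\<z> # \<z> # \<z> # \<y> # \<y> # v) = 0" if F: "annihilates \<xi> F" for F v
  proof -
    note eq = trans[OF sym[OF yyy[OF F, of "\<y> # \<y> # v"]] yyy[OF shift2[OF F]]]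
    have "F (\<z> # \<z> # \<z> # \<y> # \<y> # v) - (0) = 0"
      using eq[THEN sym, THEN diff_zero]
      unfolding R4[OF F] R4[OF shift1[OF F]] R4[OF shift2[OF F]] R4[OF shift3[OF F]] zzzzx[OF F]
        zzyzx[OF F] zzyyx[OF F] zzzyx[OF F] zzyzy[OF F]
      by (simp only: norm_three[OF three])
    then show ?thesis by (rule iffD2[OF eq_iff_diff_eq_0])
  qed
  have zzzzy: "F (\<z> # \<z> # \<z> # \<z> # \<y> # v) = 0" if F: "annihilates \<xi> F" for F v
  proof -
    note eq = trans[OF sym[OF yyz[OF F, of "\<y> # \<y> # v"]] yzyy[OF shift1[OF F]]]
    have "F (\<z> # \<z> # \<z> # \<z> # \<y> # v) - (0) = 0"
      using eq[THEN diff_zero]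
      unfolding R4[OF F] R4[OF shift1[OF F]] R4[OF shift2[OF F]] R4[OF shift3[OF F]] zzzzx[OF F]
        zzyzx[OF F] zzyyx[OF F] zzzyx[OF F] zzyzy[OF F] zzzyy[OF F]
      by (simp only: norm_three[OF three])
    then show ?thesis by (rule iffD2[OF eq_iff_diff_eq_0])
  qed
  have zzzzz: "F (\<z> # \<z> # \<z> # \<z> # \<z> # v) = 0" if F: "annihilates \<xi> F" for F v
  proof -
    note eq = trans[OF sym[OF yyz[OF F, of "\<y> # \<z> # v"]] yzyz[OF shift1[OF F]]]
    have "F (\<z> # \<z> # \<z> # \<z> # \<z> # v) - (0) = 0"
      using eq[THEN diff_zero]
      unfolding R4[OF F] R4[OF shift1[OF F]] R4[OF shift2[OF F]] R4[OF shift3[OF F]] zzzzx[OF F]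
        zzyzx[OF F] zzyyx[OF F] zzzyx[OF F] zzyzy[OF F] zzzyy[OF F] zzzzy[OF F]
      by (simp only: norm_three[OF three])
    then show ?thesis by (rule iffD2[OF eq_iff_diff_eq_0])
  qed
  have zzzyz: "F (\<z> # \<z> # \<z> # \<y> # \<z> # v) = 0" if F: "annihilates \<xi> F" for F v
  proof -
    note eq = trans[OF sym[OF yzyx[OF F, of "\<z> # v"]] xz[OF shift3[OF F]]]
    have "F (\<z> # \<z> # \<z> # \<y> # \<z> # v) - (0) = 0"
      using eq[THEN sym, THEN diff_zero]
      unfolding R4[OF F] R4[OF shift1[OF F]] R4[OF shift2[OF F]] R4[OF shift3[OF F]] zzzzx[OF F]
        zzyzx[OF F] zzyyx[OF F] zzzyx[OF F] zzyzy[OF F] zzzyy[OF F] zzzzy[OF F] zzzzz[OF F]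
      by (simp only: norm_three[OF three])
    then show ?thesis by (rule iffD2[OF eq_iff_diff_eq_0])
  qed
  note R5 = R4 zzzzx zzyzx zzyyx zzzyx zzyzy zzzyy zzzzy zzzzz zzzyz
  have N1: "determines \<xi> 1 {[\<x>], [\<y>], [\<z>]}"
  proof (rule determines_Suc[OF determines_0])
    show "1 = Suc 0" by simp
    fix F and w :: "gen list" and g
    assume F: "annihilates \<xi> F" and N: "\<And>w. w \<in> {[\<x>], [\<y>], [\<z>]} \<Longrightarrow> F w = 0"
      and w: "w \<in> {[]}"
    have zeros: "F [\<x>] = 0" "F [\<y>] = 0" "F [\<z>] = 0"
      using N by simp_all
    show "F (w @ [g]) = 0"
      using w by (cases g) (auto simp: zeros R2[OF F] )
  qed
  have N2: "determines \<xi> 2 {[\<y>, \<x>], [\<y>, \<y>], [\<y>, \<z>], [\<z>, \<x>], [\<z>, \<y>], [\<z>, \<z>]}"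
  proof (rule determines_Suc[OF N1])
    show "2 = Suc 1" by simp
    fix F and w :: "gen list" and g
    assume F: "annihilates \<xi> F" and N: "\<And>w. w \<in> {[\<y>, \<x>], [\<y>, \<y>], [\<y>, \<z>], [\<z>, \<x>], [\<z>, \<y>], [\<z>, \<z>]} \<Longrightarrow>
      F w = 0"
      and w: "w \<in> {[\<x>], [\<y>], [\<z>]}"
    have zeros: "F [\<y>, \<x>] = 0" "F [\<y>, \<y>] = 0" "F [\<y>, \<z>] = 0" "F [\<z>, \<x>] = 0" "F [\<z>, \<y>] = 0" "F [\<z>,
      \<z>] = 0"
      using N by simp_all
    show "F (w @ [g]) = 0"
      using w by (cases g) (auto simp: zeros R2[OF F] )
  qed
  have N3: "determines \<xi> 3 {[\<y>, \<y>, \<x>], [\<y>, \<z>, \<x>], [\<y>, \<z>, \<y>], [\<z>, \<y>, \<x>], [\<z>, \<y>, \<y>], [\<z>, \<y>, \<z>], [\<z>,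
    \<z>, \<x>], [\<z>, \<z>, \<y>], [\<z>, \<z>, \<z>]}"
  proof (rule determines_Suc[OF N2])
    show "3 = Suc 2" by simp
    fix F and w :: "gen list" and g
    assume F: "annihilates \<xi> F" and N: "\<And>w. w \<in> {[\<y>, \<y>, \<x>], [\<y>, \<z>, \<x>], [\<y>, \<z>, \<y>], [\<z>, \<y>, \<x>], [\<z>,
      \<y>, \<y>], [\<z>, \<y>, \<z>], [\<z>, \<z>, \<x>], [\<z>, \<z>, \<y>], [\<z>, \<z>, \<z>]} \<Longrightarrow> F w = 0"
      and w: "w \<in> {[\<y>, \<x>], [\<y>, \<y>], [\<y>, \<z>], [\<z>, \<x>], [\<z>, \<y>], [\<z>, \<z>]}"
    have zeros: "F [\<y>, \<y>, \<x>] = 0" "F [\<y>, \<z>, \<x>] = 0" "F [\<y>, \<z>, \<y>] = 0" "F [\<z>, \<y>, \<x>] = 0" "F [\<z>, \<y>,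
      \<y>] = 0" "F [\<z>, \<y>, \<z>] = 0" "F [\<z>, \<z>, \<x>] = 0" "F [\<z>, \<z>, \<y>] = 0" "F [\<z>, \<z>, \<z>] = 0"
      using N by simp_all
    show "F (w @ [g]) = 0"
      using w by (cases g) (auto simp: zeros R3[OF F] R3[OF shift1[OF F]])
  qed
  have N4: "determines \<xi> 4 {[\<z>, \<y>, \<y>, \<x>], [\<z>, \<y>, \<z>, \<x>], [\<z>, \<y>, \<z>, \<y>], [\<z>, \<z>, \<y>, \<x>], [\<z>, \<z>, \<y>, \<y>],
    [\<z>, \<z>, \<y>, \<z>], [\<z>, \<z>, \<z>, \<x>], [\<z>, \<z>, \<z>, \<y>], [\<z>, \<z>, \<z>, \<z>]}"
  proof (rule determines_Suc[OF N3])
    show "4 = Suc 3" by simp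
    fix F and w :: "gen list" and g
    assume F: "annihilates \<xi> F" and N: "\<And>w. w \<in> {[\<z>, \<y>, \<y>, \<x>], [\<z>, \<y>, \<z>, \<x>], [\<z>, \<y>, \<z>, \<y>], [\<z>, \<z>,
      \<y>, \<x>], [\<z>, \<z>, \<y>, \<y>], [\<z>, \<z>, \<y>, \<z>], [\<z>, \<z>, \<z>, \<x>], [\<z>, \<z>, \<z>, \<y>], [\<z>, \<z>, \<z>, \<z>]} \<Longrightarrow> F w = 0"
      and w: "w \<in> {[\<y>, \<y>, \<x>], [\<y>, \<z>, \<x>], [\<y>, \<z>, \<y>], [\<z>, \<y>, \<x>], [\<z>, \<y>, \<y>], [\<z>, \<y>, \<z>], [\<z>, \<z>, \<x>],
        [\<z>, \<z>, \<y>], [\<z>, \<z>, \<z>]}"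
    have zeros: "F [\<z>, \<y>, \<y>, \<x>] = 0" "F [\<z>, \<y>, \<z>, \<x>] = 0" "F [\<z>, \<y>, \<z>, \<y>] = 0" "F [\<z>, \<z>, \<y>, \<x>] =
      0" "F [\<z>, \<z>, \<y>, \<y>] = 0" "F [\<z>, \<z>, \<y>, \<z>] = 0" "F [\<z>, \<z>, \<z>, \<x>] = 0" "F [\<z>, \<z>, \<z>, \<y>] = 0" "F
        [\<z>, \<z>, \<z>, \<z>] = 0"
      using N by simp_all
    show "F (w @ [g]) = 0"
      using w by (cases g) (auto simp: zeros R4[OF F] R4[OF shift1[OF F]] R4[OF shift2[OF F]])
  qed
  have N5: "determines \<xi> 5 {}"
  proof (rule determines_Suc[OF N4])
    show "5 = Suc 4" by simp
    fix F and w :: "gen list" and g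
    assume F: "annihilates \<xi> F" and N: "\<And>w. w \<in> {} \<Longrightarrow> F w = 0"
      and w: "w \<in> {[\<z>, \<y>, \<y>, \<x>], [\<z>, \<y>, \<z>, \<x>], [\<z>, \<y>, \<z>, \<y>], [\<z>, \<z>, \<y>, \<x>], [\<z>, \<z>, \<y>, \<y>], [\<z>, \<z>, \<y>,
        \<z>], [\<z>, \<z>, \<z>, \<x>], [\<z>, \<z>, \<z>, \<y>], [\<z>, \<z>, \<z>, \<z>]}"
    show "F (w @ [g]) = 0"
      using w by (cases g) (auto simp: R5[OF F] R5[OF shift1[OF F]] R5[OF shift2[OF F]] R5[OF
        shift3[OF F]])
  qed
  show "determines \<xi> 5 {}" by (fact N5)
  have "sklyanin_dim \<xi> 2 \<le> 6"
    using determines_dim[OF N2] by (simp add: words_def)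
  then show "sklyanin_dim \<xi> 2 = 6"
    using sklyanin_dim_2(1)[of \<xi>] by simp
qed

section \<open>An algebra over the two-element field\<close>

text \<open>The relations \<open>zy = xx\<close>, \<open>yy = xz\<close>, \<open>yx = zz + xy\<close> over a field of characteristic 2, with
  the degree-lexicographic order given by \<open>x < z < y\<close>. The set of irreducible words shrinks to
  one word in degree 6 and is empty in degree 7.\<close>

lemma char_two_example:
  assumes two: "(2 :: 'k::field) = 0"
  defines "\<xi> \<equiv> (0, 0, 1, 1, 1, 1, 1, 1, 1) :: 'k params"
  shows "sklyanin_dim \<xi> 2 \<le> 6" "sklyanin_dim \<xi> 3 \<le> 9" "sklyanin_dim \<xi> 4 \<le> 9" "sklyanin_dim \<xi> 5 \<le>
    5" "sklyanin_dim \<xi> 6 \<le> 1"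
    "determines \<xi> 7 {}"
proof -
  have zy: "F (\<z> # \<y> # v) = F (\<x> # \<x> # v)" if F: "annihilates \<xi> F" for F v
  proof -
    have "F (\<z> # \<y> # v) - (F (\<x> # \<x> # v)) = 0"
      using F[unfolded \<xi>_def annihilates.simps, rule_format, of "[]" v, simplified]
      by (simp only: norm_two[OF two])
    then show ?thesis by (rule iffD2[OF eq_iff_diff_eq_0])
  qed
  have yy: "F (\<y> # \<y> # v) = F (\<x> # \<z> # v)" if F: "annihilates \<xi> F" for F v
  proof -
    have "F (\<y> # \<y> # v) - (F (\<x> # \<z> # v)) = 0"
      using F[unfolded \<xi>_def annihilates.simps, rule_format, of "[]" v, simplified]
      by (simp only: norm_two[OF two])
    then show ?thesis by (rule iffD2[OF eq_iff_diff_eq_0])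
  qed
  have yx: "F (\<y> # \<x> # v) = F (\<z> # \<z> # v) + F (\<x> # \<y> # v)" if F: "annihilates \<xi> F" for F v
  proof -
    have "F (\<y> # \<x> # v) - (F (\<z> # \<z> # v) + F (\<x> # \<y> # v)) = 0"
      using F[unfolded \<xi>_def annihilates.simps, rule_format, of "[]" v, simplified]
      by (simp only: norm_two[OF two])
    then show ?thesis by (rule iffD2[OF eq_iff_diff_eq_0])
  qed
  note R2 = zy yy yx
  have zxz: "F (\<z> # \<x> # \<z> # v) = F (\<x> # \<x> # \<y> # v)" if F: "annihilates \<xi> F" for F v
  proof -
    note eq = trans[OF sym[OF zy[OF F, of "\<y> # v"]] yy[OF shift1[OF F]]]
    have "F (\<z> # \<x> # \<z> # v) - (F (\<x> # \<x> # \<y> # v)) = 0"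
      using eq[THEN diff_zero]
      unfolding R2[OF F] R2[OF shift1[OF F]]
      by (simp only: norm_two[OF two])
    then show ?thesis by (rule iffD2[OF eq_iff_diff_eq_0])
  qed
  have zzz: "F (\<z> # \<z> # \<z> # v) = F (\<z> # \<x> # \<y> # v) + F (\<x> # \<x> # \<x> # v)"
    if F: "annihilates \<xi> F" for F v
  proof -
    note eq = trans[OF sym[OF zy[OF F, of "\<x> # v"]] yx[OF shift1[OF F]]]
    have "F (\<z> # \<z> # \<z> # v) - (F (\<z> # \<x> # \<y> # v) + F (\<x> # \<x> # \<x> # v)) = 0"
      using eq[THEN diff_zero]
      unfolding R2[OF F] R2[OF shift1[OF F]] zxz[OF F]
      by (simp only: norm_two[OF two])
    then show ?thesis by (rule iffD2[OF eq_iff_diff_eq_0])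
  qed
  have zxy: "F (\<z> # \<x> # \<y> # v) = F (\<x> # \<y> # \<z> # v)" if F: "annihilates \<xi> F" for F v
  proof -
    note eq = trans[OF sym[OF yy[OF F, of "\<y> # v"]] yy[OF shift1[OF F]]]
    have "F (\<z> # \<x> # \<y> # v) - (F (\<x> # \<y> # \<z> # v)) = 0"
      using eq[THEN diff_zero]
      unfolding R2[OF F] R2[OF shift1[OF F]] zxz[OF F] zzz[OF F]
      by (simp only: norm_two[OF two])
    then show ?thesis by (rule iffD2[OF eq_iff_diff_eq_0])
  qed
  have yzz: "F (\<y> # \<z> # \<z> # v) = F (\<z> # \<x> # \<x> # v) + F (\<x> # \<z> # \<x> # v) + F (\<x> # \<x> # \<z> # v)"
    if F: "annihilates \<xi> F" for F v
  proof -
    note eq = trans[OF sym[OF yy[OF F, of "\<x> # v"]] yx[OF shift1[OF F]]]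
    have "F (\<y> # \<z> # \<z> # v) - (F (\<z> # \<x> # \<x> # v) + F (\<x> # \<z> # \<x> # v) + F (\<x> # \<x> # \<z> # v)) = 0"
      using eq[THEN diff_zero]
      unfolding R2[OF F] R2[OF shift1[OF F]] zxz[OF F] zzz[OF F] zxy[OF F]
      by (simp only: norm_two[OF two])
    then show ?thesis by (rule iffD2[OF eq_iff_diff_eq_0])
  qed
  note R3 = R2 zxz zzz zxy yzz
  have zzxx: "F (\<z> # \<z> # \<x> # \<x> # v) = F (\<z> # \<x> # \<x> # \<z> # v) + F (\<x> # \<x> # \<x> # \<y> # v)"
    if F: "annihilates \<xi> F" for F v
  proof -
    note eq = trans[OF sym[OF zy[OF F, of "\<z> # \<z> # v"]] yzz[OF shift1[OF F]]]
    have "F (\<z> # \<z> # \<x> # \<x> # v) - (F (\<z> # \<x> # \<x> # \<z> # v) + F (\<x> # \<x> # \<x> # \<y> # v)) = 0"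
      using eq[THEN diff_zero]
      unfolding R3[OF F] R3[OF shift1[OF F]] R3[OF shift2[OF F]]
      by (simp only: norm_two[OF two])
    then show ?thesis by (rule iffD2[OF eq_iff_diff_eq_0])
  qed
  have zxxx: "F (\<z> # \<x> # \<x> # \<x> # v) = F (\<x> # \<x> # \<x> # \<z> # v)" if F: "annihilates \<xi> F" for F v
  proof -
    note eq = trans[OF sym[OF zxz[OF F, of "\<y> # v"]] zy[OF shift2[OF F]]]
    have "F (\<z> # \<x> # \<x> # \<x> # v) - (F (\<x> # \<x> # \<x> # \<z> # v)) = 0"
      using eq[THEN diff_zero]
      unfolding R3[OF F] R3[OF shift1[OF F]] R3[OF shift2[OF F]] zzxx[OF F]
      by (simp only: norm_two[OF two])
    then show ?thesis by (rule iffD2[OF eq_iff_diff_eq_0])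
  qed
  have zxxz: "F (\<z> # \<x> # \<x> # \<z> # v) = F (\<x> # \<z> # \<z> # \<x> # v) + F (\<x> # \<x> # \<z> # \<z> # v) + F (\<x> # \<x> # \<x>
    # \<y> # v)"
    if F: "annihilates \<xi> F" for F v
  proof -
    note eq = trans[OF sym[OF zxy[OF F, of "\<y> # v"]] yy[OF shift2[OF F]]]
    have "F (\<z> # \<x> # \<x> # \<z> # v) - (F (\<x> # \<z> # \<z> # \<x> # v) + F (\<x> # \<x> # \<z> # \<z> # v) + F (\<x> # \<x> # \<x> #
      \<y> # v)) = 0"
      using eq[THEN diff_zero]
      unfolding R3[OF F] R3[OF shift1[OF F]] R3[OF shift2[OF F]] zzxx[OF F] zxxx[OF F]
      by (simp only: norm_two[OF two])
    then show ?thesis by (rule iffD2[OF eq_iff_diff_eq_0])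
  qed
  have zxxy: "F (\<z> # \<x> # \<x> # \<y> # v) = F (\<x> # \<y> # \<z> # \<x> # v) + F (\<x> # \<x> # \<y> # \<z> # v)"
    if F: "annihilates \<xi> F" for F v
  proof -
    note eq = trans[OF sym[OF zxy[OF F, of "\<x> # v"]] yx[OF shift2[OF F]]]
    have "F (\<z> # \<x> # \<x> # \<y> # v) - (F (\<x> # \<y> # \<z> # \<x> # v) + F (\<x> # \<x> # \<y> # \<z> # v)) = 0"
      using eq[THEN diff_zero]
      unfolding R3[OF F] R3[OF shift1[OF F]] R3[OF shift2[OF F]] zzxx[OF F] zxxx[OF F] zxxz[OF F]
      by (simp only: norm_two[OF two])
    then show ?thesis by (rule iffD2[OF eq_iff_diff_eq_0])
  qed
  have yzxx: "F (\<y> # \<z> # \<x> # \<x> # v) = F (\<x> # \<y> # \<z> # \<x> # v) + F (\<x> # \<x> # \<x> # \<x> # v)"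
    if F: "annihilates \<xi> F" for F v
  proof -
    note eq = trans[OF sym[OF yzz[OF F, of "\<y> # v"]] zy[OF shift2[OF F]]]
    have "F (\<y> # \<z> # \<x> # \<x> # v) - (F (\<x> # \<y> # \<z> # \<x> # v) + F (\<x> # \<x> # \<x> # \<x> # v)) = 0"
      using eq[THEN diff_zero]
      unfolding R3[OF F] R3[OF shift1[OF F]] R3[OF shift2[OF F]] zzxx[OF F] zxxx[OF F] zxxz[OF F]
        zxxy[OF F]
      by (simp only: norm_two[OF two])
    then show ?thesis by (rule iffD2[OF eq_iff_diff_eq_0])
  qed
  note R4 = R3 zzxx zxxx zxxz zxxy yzxx
  have xxxxz: "F (\<x> # \<x> # \<x> # \<x> # \<z> # v) = 0" if F: "annihilates \<xi> F" for F v
  proof -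
    note eq = trans[OF sym[OF zy[OF F, of "\<z> # \<x> # \<x> # v"]] yzxx[OF shift1[OF F]]]
    have "F (\<x> # \<x> # \<x> # \<x> # \<z> # v) - (0) = 0"
      using eq[THEN diff_zero]
      unfolding R4[OF F] R4[OF shift1[OF F]] R4[OF shift2[OF F]] R4[OF shift3[OF F]]
      by (simp only: norm_two[OF two])
    then show ?thesis by (rule iffD2[OF eq_iff_diff_eq_0])
  qed
  have xxyzx: "F (\<x> # \<x> # \<y> # \<z> # \<x> # v) = F (\<x> # \<x> # \<x> # \<y> # \<z> # v) + F (\<x> # \<x> # \<x> # \<x> # \<x> # v)"
    if F: "annihilates \<xi> F" for F v
  proof -
    note eq = trans[OF sym[OF zzxx[OF F, of "\<z> # v"]] zxxz[OF shift1[OF F]]]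
    have "F (\<x> # \<x> # \<y> # \<z> # \<x> # v) - (F (\<x> # \<x> # \<x> # \<y> # \<z> # v) + F (\<x> # \<x> # \<x> # \<x> # \<x> # v)) = 0"
      using eq[THEN diff_zero]
      unfolding R4[OF F] R4[OF shift1[OF F]] R4[OF shift2[OF F]] R4[OF shift3[OF F]] xxxxz[OF F]
      by (simp only: norm_two[OF two])
    then show ?thesis by (rule iffD2[OF eq_iff_diff_eq_0])
  qed
  have xxxxx: "F (\<x> # \<x> # \<x> # \<x> # \<x> # v) = 0" if F: "annihilates \<xi> F" for F v
  proof -
    note eq = trans[OF sym[OF yzxx[OF F, of "\<x> # v"]] zxxx[OF shift1[OF F]]]
    have "F (\<x> # \<x> # \<x> # \<x> # \<x> # v) - (0) = 0"
      using eq[THEN diff_zero]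
      unfolding R4[OF F] R4[OF shift1[OF F]] R4[OF shift2[OF F]] R4[OF shift3[OF F]] xxxxz[OF F]
        xxyzx[OF F]
      by (simp only: norm_two[OF two])
    then show ?thesis by (rule iffD2[OF eq_iff_diff_eq_0])
  qed
  have xxzxx: "F (\<x> # \<x> # \<z> # \<x> # \<x> # v) = 0" if F: "annihilates \<xi> F" for F v
  proof -
    note eq = trans[OF sym[OF yzxx[OF F, of "\<z> # v"]] zxxz[OF shift1[OF F]]]
    have "F (\<x> # \<x> # \<z> # \<x> # \<x> # v) - (0) = 0"
      using eq[THEN diff_zero]
      unfolding R4[OF F] R4[OF shift1[OF F]] R4[OF shift2[OF F]] R4[OF shift3[OF F]] xxxxz[OF F]
        xxyzx[OF F] xxxxx[OF F]
      by (simp only: norm_two[OF two])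
    then show ?thesis by (rule iffD2[OF eq_iff_diff_eq_0])
  qed
  note R5 = R4 xxxxz xxyzx xxxxx xxzxx
  have xxxzzx: "F (\<x> # \<x> # \<x> # \<z> # \<z> # \<x> # v) = 0" if F: "annihilates \<xi> F" for F v
  proof -
    note eq = trans[OF sym[OF xxzxx[OF F, of "\<z> # v"]] zxxz[OF shift2[OF F]]]
    have "F (\<x> # \<x> # \<x> # \<z> # \<z> # \<x> # v) - (0) = 0"
      using eq[THEN diff_zero]
      unfolding R5[OF F] R5[OF shift1[OF F]] R5[OF shift2[OF F]] R5[OF shift3[OF F]] R5[OF
        shift4[OF F]]
      by (simp only: norm_two[OF two])
    then show ?thesis by (rule iffD2[OF eq_iff_diff_eq_0])
  qed
  note R6 = R5 xxxzzx
  have N1: "determines \<xi> 1 {[\<x>], [\<y>], [\<z>]}"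
  proof (rule determines_Suc[OF determines_0])
    show "1 = Suc 0" by simp
    fix F and w :: "gen list" and g
    assume F: "annihilates \<xi> F" and N: "\<And>w. w \<in> {[\<x>], [\<y>], [\<z>]} \<Longrightarrow> F w = 0"
      and w: "w \<in> {[]}"
    have zeros: "F [\<x>] = 0" "F [\<y>] = 0" "F [\<z>] = 0"
      using N by simp_all
    show "F (w @ [g]) = 0"
      using w by (cases g) (auto simp: zeros R2[OF F] )
  qed
  have N2: "determines \<xi> 2 {[\<x>, \<x>], [\<x>, \<y>], [\<x>, \<z>], [\<y>, \<z>], [\<z>, \<x>], [\<z>, \<z>]}"
  proof (rule determines_Suc[OF N1])
    show "2 = Suc 1" by simp
    fix F and w :: "gen list" and g
    assume F: "annihilates \<xi> F" and N: "\<And>w. w \<in> {[\<x>, \<x>], [\<x>, \<y>], [\<x>, \<z>], [\<y>, \<z>], [\<z>, \<x>], [\<z>, \<z>]} \<Longrightarrow>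
      F w = 0"
      and w: "w \<in> {[\<x>], [\<y>], [\<z>]}"
    have zeros: "F [\<x>, \<x>] = 0" "F [\<x>, \<y>] = 0" "F [\<x>, \<z>] = 0" "F [\<y>, \<z>] = 0" "F [\<z>, \<x>] = 0" "F [\<z>,
      \<z>] = 0"
      using N by simp_all
    show "F (w @ [g]) = 0"
      using w by (cases g) (auto simp: zeros R2[OF F] )
  qed
  have N3: "determines \<xi> 3 {[\<x>, \<x>, \<x>], [\<x>, \<x>, \<y>], [\<x>, \<x>, \<z>], [\<x>, \<y>, \<z>], [\<x>, \<z>, \<x>], [\<x>, \<z>, \<z>], [\<y>,
    \<z>, \<x>], [\<z>, \<x>, \<x>], [\<z>, \<z>, \<x>]}"
  proof (rule determines_Suc[OF N2])
    show "3 = Suc 2" by simp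
    fix F and w :: "gen list" and g
    assume F: "annihilates \<xi> F" and N: "\<And>w. w \<in> {[\<x>, \<x>, \<x>], [\<x>, \<x>, \<y>], [\<x>, \<x>, \<z>], [\<x>, \<y>, \<z>], [\<x>,
      \<z>, \<x>], [\<x>, \<z>, \<z>], [\<y>, \<z>, \<x>], [\<z>, \<x>, \<x>], [\<z>, \<z>, \<x>]} \<Longrightarrow> F w = 0"
      and w: "w \<in> {[\<x>, \<x>], [\<x>, \<y>], [\<x>, \<z>], [\<y>, \<z>], [\<z>, \<x>], [\<z>, \<z>]}"
    have zeros: "F [\<x>, \<x>, \<x>] = 0" "F [\<x>, \<x>, \<y>] = 0" "F [\<x>, \<x>, \<z>] = 0" "F [\<x>, \<y>, \<z>] = 0" "F [\<x>, \<z>,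
      \<x>] = 0" "F [\<x>, \<z>, \<z>] = 0" "F [\<y>, \<z>, \<x>] = 0" "F [\<z>, \<x>, \<x>] = 0" "F [\<z>, \<z>, \<x>] = 0"
      using N by simp_all
    show "F (w @ [g]) = 0"
      using w by (cases g) (auto simp: zeros R3[OF F] R3[OF shift1[OF F]])
  qed
  have N4: "determines \<xi> 4 {[\<x>, \<x>, \<x>, \<x>], [\<x>, \<x>, \<x>, \<y>], [\<x>, \<x>, \<x>, \<z>], [\<x>, \<x>, \<y>, \<z>], [\<x>, \<x>, \<z>, \<x>],
    [\<x>, \<x>, \<z>, \<z>], [\<x>, \<y>, \<z>, \<x>], [\<x>, \<z>, \<x>, \<x>], [\<x>, \<z>, \<z>, \<x>]}"
  proof (rule determines_Suc[OF N3])
    show "4 = Suc 3" by simp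
    fix F and w :: "gen list" and g
    assume F: "annihilates \<xi> F" and N: "\<And>w. w \<in> {[\<x>, \<x>, \<x>, \<x>], [\<x>, \<x>, \<x>, \<y>], [\<x>, \<x>, \<x>, \<z>], [\<x>, \<x>,
      \<y>, \<z>], [\<x>, \<x>, \<z>, \<x>], [\<x>, \<x>, \<z>, \<z>], [\<x>, \<y>, \<z>, \<x>], [\<x>, \<z>, \<x>, \<x>], [\<x>, \<z>, \<z>, \<x>]} \<Longrightarrow> F w = 0"
      and w: "w \<in> {[\<x>, \<x>, \<x>], [\<x>, \<x>, \<y>], [\<x>, \<x>, \<z>], [\<x>, \<y>, \<z>], [\<x>, \<z>, \<x>], [\<x>, \<z>, \<z>], [\<y>, \<z>, \<x>],
        [\<z>, \<x>, \<x>], [\<z>, \<z>, \<x>]}"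
    have zeros: "F [\<x>, \<x>, \<x>, \<x>] = 0" "F [\<x>, \<x>, \<x>, \<y>] = 0" "F [\<x>, \<x>, \<x>, \<z>] = 0" "F [\<x>, \<x>, \<y>, \<z>] =
      0" "F [\<x>, \<x>, \<z>, \<x>] = 0" "F [\<x>, \<x>, \<z>, \<z>] = 0" "F [\<x>, \<y>, \<z>, \<x>] = 0" "F [\<x>, \<z>, \<x>, \<x>] = 0" "F
        [\<x>, \<z>, \<z>, \<x>] = 0"
      using N by simp_all
    show "F (w @ [g]) = 0"
      using w by (cases g) (auto simp: zeros R4[OF F] R4[OF shift1[OF F]] R4[OF shift2[OF F]])
  qed
  have N5: "determines \<xi> 5 {[\<x>, \<x>, \<x>, \<x>, \<y>], [\<x>, \<x>, \<x>, \<y>, \<z>], [\<x>, \<x>, \<x>, \<z>, \<x>], [\<x>, \<x>, \<x>, \<z>, \<z>],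
    [\<x>, \<x>, \<z>, \<z>, \<x>]}"
  proof (rule determines_Suc[OF N4])
    show "5 = Suc 4" by simp
    fix F and w :: "gen list" and g
    assume F: "annihilates \<xi> F" and N: "\<And>w. w \<in> {[\<x>, \<x>, \<x>, \<x>, \<y>], [\<x>, \<x>, \<x>, \<y>, \<z>], [\<x>, \<x>, \<x>, \<z>,
      \<x>], [\<x>, \<x>, \<x>, \<z>, \<z>], [\<x>, \<x>, \<z>, \<z>, \<x>]} \<Longrightarrow> F w = 0"
      and w: "w \<in> {[\<x>, \<x>, \<x>, \<x>], [\<x>, \<x>, \<x>, \<y>], [\<x>, \<x>, \<x>, \<z>], [\<x>, \<x>, \<y>, \<z>], [\<x>, \<x>, \<z>, \<x>], [\<x>, \<x>, \<z>,
        \<z>], [\<x>, \<y>, \<z>, \<x>], [\<x>, \<z>, \<x>, \<x>], [\<x>, \<z>, \<z>, \<x>]}"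
    have zeros: "F [\<x>, \<x>, \<x>, \<x>, \<y>] = 0" "F [\<x>, \<x>, \<x>, \<y>, \<z>] = 0" "F [\<x>, \<x>, \<x>, \<z>, \<x>] = 0" "F [\<x>, \<x>,
      \<x>, \<z>, \<z>] = 0" "F [\<x>, \<x>, \<z>, \<z>, \<x>] = 0"
      using N by simp_all
    show "F (w @ [g]) = 0"
      using w by (cases g) (auto simp: zeros R5[OF F] R5[OF shift1[OF F]] R5[OF shift2[OF F]]
        R5[OF shift3[OF F]])
  qed
  have N6: "determines \<xi> 6 {[\<x>, \<x>, \<x>, \<x>, \<y>, \<z>]}"
  proof (rule determines_Suc[OF N5])
    show "6 = Suc 5" by simp
    fix F and w :: "gen list" and g
    assume F: "annihilates \<xi> F" and N: "\<And>w. w \<in> {[\<x>, \<x>, \<x>, \<x>, \<y>, \<z>]} \<Longrightarrow> F w = 0"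
      and w: "w \<in> {[\<x>, \<x>, \<x>, \<x>, \<y>], [\<x>, \<x>, \<x>, \<y>, \<z>], [\<x>, \<x>, \<x>, \<z>, \<x>], [\<x>, \<x>, \<x>, \<z>, \<z>], [\<x>, \<x>, \<z>,
        \<z>, \<x>]}"
    have zeros: "F [\<x>, \<x>, \<x>, \<x>, \<y>, \<z>] = 0"
      using N by simp_all
    show "F (w @ [g]) = 0"
      using w by (cases g) (auto simp: zeros R6[OF F] R6[OF shift1[OF F]] R6[OF shift2[OF F]]
        R6[OF shift3[OF F]] R6[OF shift4[OF F]])
  qed
  have N7: "determines \<xi> 7 {}"
  proof (rule determines_Suc[OF N6])
    show "7 = Suc 6" by simp
    fix F and w :: "gen list" and g
    assume F: "annihilates \<xi> F" and N: "\<And>w. w \<in> {} \<Longrightarrow> F w = 0"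
      and w: "w \<in> {[\<x>, \<x>, \<x>, \<x>, \<y>, \<z>]}"
    show "F (w @ [g]) = 0"
      using w by (cases g) (auto simp: R6[OF F] R6[OF shift1[OF F]] R6[OF shift2[OF F]] R6[OF
        shift3[OF F]] R6[OF shift4[OF F]] R6[OF shift5[OF F]])
  qed
  show "sklyanin_dim \<xi> 2 \<le> 6"
    using determines_dim[OF N2] by (simp add: words_def)
  show "sklyanin_dim \<xi> 3 \<le> 9"
    using determines_dim[OF N3] by (simp add: words_def)
  show "sklyanin_dim \<xi> 4 \<le> 9"
    using determines_dim[OF N4] by (simp add: words_def)
  show "sklyanin_dim \<xi> 5 \<le> 5"
    using determines_dim[OF N5] by (simp add: words_def)
  show "sklyanin_dim \<xi> 6 \<le> 1"
    using determines_dim[OF N6] by (simp add: words_def)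
  show "determines \<xi> 7 {}" by (fact N7)
qed

section \<open>The minimal Hilbert series\<close>

lemma determines_empty_dim:
  assumes "determines \<xi> m {}" "m \<le> n"
  shows "sklyanin_dim \<xi> n = 0"
proof -
  have "determines \<xi> n {}"
    using assms(2)
  proof (induction n rule: dec_induct)
    case base
    show ?case by (rule assms(1))
  next
    case (step k)
    show ?case by (rule determines_Suc[OF step.IH]) simp_all
  qed
  from determines_dim[OF this] show ?thesis by simp
qed

text \<open>If 2 and 3 are nonzero, the generic family works for \<open>e = 1\<close>. In characteristic 2 the
  conditions on \<open>e\<close> reduce to \<open>e \<noteq> 0\<close>, \<open>e \<noteq> 1\<close> and \<open>e\<^sup>3 + e\<^sup>2 + 1 \<noteq> 0\<close>. If some \<open>a\<close> other than 0
  and 1 is a root of the cubic, its inverse is not: otherwise \<open>a\<close> would also be a root of the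
  reciprocal polynomial \<open>a\<^sup>3 + a + 1\<close>, and subtracting gives \<open>a (a - 1) = 0\<close>.\<close>

lemma finite_example:
  assumes "CARD('k::field) \<noteq> 2"
  obtains \<xi> :: "'k::field params" where "determines \<xi> 5 {}" "sklyanin_dim \<xi> 2 = 6"
proof (cases "(3 :: 'k) = 0")
  case True
  then show thesis using char_three_family that by blast
next
  case three: False
  note witness = that
  show thesis
  proof (cases "(2 :: 'k) = 0")
    case two: True
    obtain a :: 'k where a: "a \<noteq> 0" "a \<noteq> 1"
    proof (rule ccontr)
      assume "\<not> thesis"
      then have "UNIV = {0, 1 :: 'k}" using that by blast
      then have "CARD('k) = card {0, 1 :: 'k}" by simp
      with assms show False by simp
    qed
    have char2: "x + x = 0" "- x = x" for x :: 'k
      using norm_two[OF two] by simp_all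
    have "(3 :: 'k) = 2 + 1" by simp
    then have three_one: "(3 :: 'k) = 1"
      unfolding two by simp
    have ok: thesis if e: "e \<noteq> 0" "e \<noteq> 1" "e^3 + e^2 + 1 \<noteq> 0" for e :: 'k
    proof -
      have "1 + e^2 = (1 + e)^2"
        by (simp add: power2_sum two)
      moreover have "1 + e \<noteq> 0"
      proof
        assume "1 + e = 0"
        then have "e = - 1" by (simp add: add_eq_0_iff)
        with e(2) char2(2)[of 1] show False by simp
      qed
      ultimately have "1 + e^2 \<noteq> 0" by simp
      with e show thesis
        by (intro witness[OF generic_family(1)[of e] generic_family(2)[of e]])
          (simp_all add: three_one char2 diff_conv_add_uminus add.commute del: add_uminus_conv_diff)
    qed
    show thesis
    proof (cases "a^3 + a^2 + 1 = 0")
      case False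
      then show thesis using ok a by blast
    next
      case True
      define b where "b = inverse a"
      have b: "b \<noteq> 0" "b \<noteq> 1" "a * b = 1"
        using a by (simp_all add: b_def)
      have "b^3 + b^2 + 1 \<noteq> 0"
      proof
        assume "b^3 + b^2 + 1 = 0"
        moreover have "a^3 * (b^3 + b^2 + 1) = (a * b)^3 + a * (a * b)^2 + a^3"
          by (simp add: power2_eq_square power3_eq_cube algebra_simps)
        ultimately have "1 + a + a^3 = 0"
          by (simp add: b(3))
        moreover have "a * (a - 1) = (a^3 + a^2 + 1) - (1 + a + a^3)"
          by (simp add: power2_eq_square algebra_simps)
        ultimately have "a * (a - 1) = 0"
          using True by simp
        with a show False by simp
      qed
      then show thesis using ok b by blast
    qed
  next
    case two: False
    have "(4 :: 'k) = 2 * 2" by simp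
    then have four: "(4 :: 'k) \<noteq> 0" using two by (metis mult_eq_0_iff)
    have "(1 :: 'k) - 3 = - 2" by simp
    then have "(1 :: 'k) - 3 \<noteq> 0" using two by (metis neg_equal_0_iff_equal)
    then show thesis
      using two three four
      by (intro witness[OF generic_family(1)[of 1] generic_family(2)[of 1]]) simp_all
  qed
qed

text \<open>A single algebra that is minimal in degree \<open>n\<close> computes the coefficient.\<close>

lemma min_hilbert_series_nth:
  fixes \<xi> :: "'k::field params"
  assumes "\<And>\<eta> :: 'k params. sklyanin_dim \<xi> n \<le> sklyanin_dim \<eta> n"
  shows "fps_nth (min_hilbert_series TYPE('k)) n = int (sklyanin_dim \<xi> n)"
proof -
  have "(INF \<eta> :: 'k params. sklyanin_dim \<eta> n) = sklyanin_dim \<xi> n"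
    using assms by (intro cInf_eq_minimum) auto
  then show ?thesis by (simp add: min_hilbert_series_def)
qed

lemma numeral_fps_X_power_nth:
  "fps_nth (numeral k * fps_X ^ j :: int fps) n = (if n = j then numeral k else 0)"
  by (simp only: numeral_fps_const fps_mult_left_const_nth fps_X_power_nth) simp

lemma numeral_fps_X_nth: "fps_nth (numeral k * fps_X :: int fps) n = (if n = 1 then numeral k else
  0)"
  using numeral_fps_X_power_nth[of k 1 n] by simp

theorem theorem7p2:
  shows "(CARD('k::field) \<noteq> 2 \<longrightarrow>
            min_hilbert_series TYPE('k) =
              1 + 3 * fps_X + 6 * fps_X ^ 2 + 9 * fps_X ^ 3 + 9 * fps_X ^ 4) \<and>
         (CARD('k) = 2 \<longrightarrow>
            min_hilbert_series TYPE('k) =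
              1 + 3 * fps_X + 6 * fps_X ^ 2 + 9 * fps_X ^ 3 + 9 * fps_X ^ 4
                + 5 * fps_X ^ 5 + fps_X ^ 6) \<and>
         (\<exists>\<xi>::'k params. sklyanin_hilbert_series \<xi> = min_hilbert_series TYPE('k))"
proof -
  \<comment> \<open>The claimed coefficients; \<open>of_bool\<close> cuts off the list access beyond the end of the list.\<close>
  define d :: "nat \<Rightarrow> nat" where "d n = (if CARD('k) = 2 then [1, 3, 6, 9, 9, 5, 1] else [1, 3, 6,
    9, 9]) ! n
    * of_bool (n < (if CARD('k) = 2 then 7 else 5))" for n
  have small: "n < 7 \<Longrightarrow> n = 0 \<or> n = 1 \<or> n = 2 \<or> n = 3 \<or> n = 4 \<or> n = 5 \<or> n = 6" for n :: nat
    by auto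
  have lower: "d n \<le> sklyanin_dim \<eta> n" for \<eta> :: "'k params" and n
    using sklyanin_dim_0[of \<eta>] sklyanin_dim_1[of \<eta>] sklyanin_dim_2[of \<eta>] sklyanin_dim_3[of \<eta>]
      sklyanin_dim_4[of \<eta>] two_element_field_bounds[of \<eta>] small[of n]
    by (cases "n < 7") (auto simp: d_def)
  obtain \<xi> :: "'k params" where upper: "\<And>n. sklyanin_dim \<xi> n \<le> d n"
  proof (cases "CARD('k) = 2")
    case True
    let ?\<xi> = "(0, 0, 1, 1, 1, 1, 1, 1, 1) :: 'k params"
    note ex = char_two_example[OF two_element_field(2)[OF True]]
    have "sklyanin_dim ?\<xi> n \<le> d n" for n
      using sklyanin_dim_0[of ?\<xi>] sklyanin_dim_1[of ?\<xi>] ex(1-5) determines_empty_dim[OF ex(6), of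
        n] small[of n] True
      by (cases "n < 7") (auto simp: d_def)
    then show thesis by (rule that)
  next
    case False
    then obtain \<xi> :: "'k params" where \<xi>: "determines \<xi> 5 {}" "sklyanin_dim \<xi> 2 = 6"
      by (rule finite_example)
    have small: "n < 5 \<Longrightarrow> n = 0 \<or> n = 1 \<or> n = 2 \<or> n = 3 \<or> n = 4" for n :: nat
      by auto
    have "sklyanin_dim \<xi> n \<le> d n" for n
      using sklyanin_dim_0[of \<xi>] sklyanin_dim_1[of \<xi>] \<xi>(2)
        sklyanin_dims_if_dim_5_eq_0[OF determines_empty_dim[OF \<xi>(1) order_refl] \<xi>(2)]
        determines_empty_dim[OF \<xi>(1), of n] small[of n] False
      by (cases "n < 5") (auto simp: d_def)
    then show thesis by (rule that)
  qed
  have dim: "sklyanin_dim \<xi> n = d n" for n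
    using lower upper by (rule antisym[rotated])
  have min: "fps_nth (min_hilbert_series TYPE('k)) n = int (d n)" for n
    using min_hilbert_series_nth[of \<xi> n] lower by (simp add: dim)
  have "sklyanin_hilbert_series \<xi> = min_hilbert_series TYPE('k)"
    by (simp add: fps_eq_iff min sklyanin_hilbert_series_def dim)
  moreover have "min_hilbert_series TYPE('k) =
      1 + 3 * fps_X + 6 * fps_X ^ 2 + 9 * fps_X ^ 3 + 9 * fps_X ^ 4" if "CARD('k) \<noteq> 2"
  proof (rule fps_ext)
    fix n
    show "fps_nth (min_hilbert_series TYPE('k)) n =
      fps_nth (1 + 3 * fps_X + 6 * fps_X ^ 2 + 9 * fps_X ^ 3 + 9 * fps_X ^ 4) n"
      unfolding fps_add_nth numeral_fps_X_power_nth numeral_fps_X_nth fps_one_nth min d_def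
      using that small[of n] by (cases "n < 7") auto
  qed
  moreover have "min_hilbert_series TYPE('k) =
      1 + 3 * fps_X + 6 * fps_X ^ 2 + 9 * fps_X ^ 3 + 9 * fps_X ^ 4 + 5 * fps_X ^ 5 + fps_X ^ 6"
    if "CARD('k) = 2"
  proof (rule fps_ext)
    fix n
    show "fps_nth (min_hilbert_series TYPE('k)) n =
      fps_nth (1 + 3 * fps_X + 6 * fps_X ^ 2 + 9 * fps_X ^ 3 + 9 * fps_X ^ 4 + 5 * fps_X ^ 5 +
        fps_X ^ 6) n"
      unfolding fps_add_nth numeral_fps_X_power_nth numeral_fps_X_nth fps_one_nth fps_X_power_nth
        min d_def
      using that small[of n] by (cases "n < 7") auto
  qed
  ultimately show ?thesis by blast
qed

end
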